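(* Let $L>0$ and let $\gamma=(\gamma_j)_{j\in\mathbb{Z}}$ be a strictly positive symmetric sequence ($\gamma_{-j}=\gamma_j$) with $\gamma_0=1$ and $(\gamma_n)_{n\in\mathbb{N}_0}$ non-decreasing. Then the data-driven projection estimator $\widehat\lambda_{\widehat k_n}$ defined in the context is rate optimal over the class $\Lambda(\gamma,L)$; that is, there is a constant $C$ not depending on $n$ such that for all $n\in\mathbb{N}$ $$\sup_{\lambda\in\Lambda(\gamma,L)}\mathbb{E}\big[\|\widehat\lambda_{\widehat k_n}-\lambda\|^2\big]\le C\ \inf_{\widetilde\lambda}\ \sup_{\lambda\in\Lambda(\gamma,L)}\mathbb{E}\big[\|\widetilde\lambda-\lambda\|^2\big],$$ where the infimum is over all estimators $\widetilde\lambda$ of $\lambda$ based on $N_1,\ldots,N_n$.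
   Context: $\mathbb{L}^2=\mathbb{L}^2([0,1],\mathrm{d}x)$ with inner product $\langle s,t\rangle=\int_0^1 s(x)t(x)\,\mathrm{d}x$ and norm $\|\cdot\|$. The orthonormal basis $\{\phi_j\}_{j\in\mathbb{Z}}$ of $\mathbb{L}^2$ is $\phi_0=1$, $\phi_j(t)=\sqrt2\cos(2\pi jt)$, $\phi_{-j}(t)=\sqrt2\sin(2\pi jt)$ for $j=1,2,\ldots$. For $\lambda\in\mathbb{L}^2$, $\beta_j=\int_0^1\lambda(t)\phi_j(t)\,\mathrm{d}t$. The class of intensities is $$\Lambda(\gamma,L)=\Big\{\lambda\in\mathbb{L}^2:\ \lambda\ge0,\ \sum_{j\in\mathbb{Z}}\gamma_j^2\beta_j^2\le L^2\Big\}.$$ One observes $N_1,\ldots,N_n$, i.i.d. Poisson point processes on $[0,1]$ with intensity function $\lambda$ (with respect to Lebesgue measure); $\mathbb{E}$ is the expectation under the true intensity $\lambda$. An estimator is a measurable function of $(N_1,\ldots,N_n)$ with values in $\mathbb{L}^2$. Set $\widehat\beta_j=\frac1n\sum_{i=1}^n\int_0^1\phi_j(t)\,\mathrm{d}N_i(t)$ and, for $k\in\mathbb{N}_0$, $\widehat\lambda_k=\sum_{0\le|j|\le k}\widehat\beta_j\phi_j$ (in particular $\widehat\lambda_n$ is the case $k=n$). The contrast is $\Upsilon_n(t)=\|t\|^2-2\langle\widehat\lambda_n,t\rangle$, $t\in\mathbb{L}^2$; the random penalty is $\mathrm{pen}_k=24\,(\widehat\beta_0\vee1)\,\frac{2k+1}{n}$;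 and the selected dimension is $$\widehat k_n=\operatorname*{argmin}_{0\le k\le n}\{\Upsilon_n(\widehat\lambda_k)+\mathrm{pen}_k\}.$$ *)

theory Defs
  imports "HOL-Probability.Probability"
begin

section \<open>The space of square-integrable functions on the unit interval\<close>

definition unit_leb :: "real measure" where
  "unit_leb = restrict_space lborel {0..1}"

text \<open>Elements of the Hilbert space are represented by functions that are square-integrable on
  the unit interval; two functions that agree almost everywhere there stand for the same element.
  Values outside the unit interval are irrelevant.\<close>

definition L2_fun :: "(real \<Rightarrow> real) set" where
  "L2_fun = {f \<in> borel_measurable unit_leb. integrable unit_leb (\<lambda>x. (f x)\<^sup>2)}"

definition L2_inner :: "(real \<Rightarrow> real) \<Rightarrow> (real \<Rightarrow> real) \<Rightarrow> real" where
  "L2_inner s t = (LINT x|unit_leb. s x * t x)"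

definition L2_norm :: "(real \<Rightarrow> real) \<Rightarrow> real" where
  "L2_norm s = sqrt (L2_inner s s)"

text \<open>Borel sigma-algebra of the (semi-)norm topology. Open sets are closed under almost-everywhere
  equality, so this is the Borel sigma-algebra of the quotient space, pulled back to functions.\<close>

definition L2_borel :: "(real \<Rightarrow> real) measure" where
  "L2_borel = sigma L2_fun
     {V. V \<subseteq> L2_fun \<and>
         (\<forall>f\<in>V. \<exists>e>0. \<forall>g\<in>L2_fun. L2_norm (\<lambda>x. g x - f x) < e \<longrightarrow> g \<in> V)}"

definition trig_basis :: "int \<Rightarrow> real \<Rightarrow> real" where
  "trig_basis j t =
     (if j = 0 then 1
      else if 0 < j then sqrt 2 * cos (2 * pi * of_int j * t)
      else sqrt 2 * sin (2 * pi * of_int (- j) * t))"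

definition intensity_class :: "(int \<Rightarrow> real) \<Rightarrow> real \<Rightarrow> (real \<Rightarrow> real) set" where
  "intensity_class \<gamma> L =
     {lam \<in> L2_fun. (AE x in unit_leb. 0 \<le> lam x) \<and>
        (\<lambda>j. (\<gamma> j)\<^sup>2 * (L2_inner lam (trig_basis j))\<^sup>2) summable_on UNIV \<and>
        (\<Sum>\<^sub>\<infinity>j. (\<gamma> j)\<^sup>2 * (L2_inner lam (trig_basis j))\<^sup>2) \<le> L\<^sup>2}"

section \<open>Poisson point processes on the unit interval\<close>

text \<open>Point configurations are finite integer-valued measures; the interval is compact, so local
  finiteness is finiteness. The sigma-algebra on configurations is generated by the counts.\<close>

definition configs :: "real measure set" where
  "configs = {\<mu>. sets \<mu> = sets unit_leb \<and> (\<forall>A\<in>sets unit_leb. \<exists>k::nat. emeasure \<mu> A = of_nat k)}"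

definition config_space :: "real measure measure" where
  "config_space = sigma configs
     {{\<mu> \<in> configs. emeasure \<mu> A \<in> B} | A B. A \<in> sets unit_leb \<and> B \<in> sets borel}"

text \<open>The Poisson weights are written out because \<open>poisson_pmf\<close> is only available for strictly
  positive rates, whereas the mean measure may vanish on a set.\<close>

definition poisson_process ::
    "'w measure \<Rightarrow> ('w \<Rightarrow> real measure) \<Rightarrow> (real \<Rightarrow> real) \<Rightarrow> bool" where
  "poisson_process M X lam \<longleftrightarrow>
     prob_space M \<and> X \<in> measurable M config_space \<and>
     (\<forall>A\<in>sets unit_leb. \<forall>k::nat.
        measure M {\<omega> \<in> space M. emeasure (X \<omega>) A = of_nat k} =
          (LINT x:A|unit_leb. lam x) ^ k / fact k * exp (- (LINT x:A|unit_leb. lam x))) \<and>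
     (\<forall>(A :: nat \<Rightarrow> real set) I. finite I \<longrightarrow> A ` I \<subseteq> sets unit_leb \<longrightarrow> disjoint_family_on A I \<longrightarrow>
        prob_space.indep_vars M (\<lambda>_. borel) (\<lambda>i \<omega>. emeasure (X \<omega>) (A i)) I)"

definition poisson_sample ::
    "nat \<Rightarrow> 'w measure \<Rightarrow> (nat \<Rightarrow> 'w \<Rightarrow> real measure) \<Rightarrow> (real \<Rightarrow> real) \<Rightarrow> bool" where
  "poisson_sample n M N lam \<longleftrightarrow>
     prob_space M \<and>
     prob_space.indep_vars M (\<lambda>_. config_space) N {..<n} \<and>
     (\<forall>i<n. poisson_process M (N i) lam)"

section \<open>Estimators and risk\<close>

type_synonym sample = "nat \<Rightarrow> real measure"
type_synonym estimator = "sample \<Rightarrow> real \<Rightarrow> real"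

definition estimators :: "nat \<Rightarrow> estimator set" where
  "estimators n = measurable (Pi\<^sub>M {..<n} (\<lambda>_. config_space)) L2_borel"

definition risk ::
    "nat \<Rightarrow> 'w measure \<Rightarrow> (nat \<Rightarrow> 'w \<Rightarrow> real measure) \<Rightarrow> estimator \<Rightarrow> (real \<Rightarrow> real) \<Rightarrow> ennreal" where
  "risk n M N est lam =
     (\<integral>\<^sup>+\<omega>. ennreal ((L2_norm (\<lambda>x. est (\<lambda>i\<in>{..<n}. N i \<omega>) x - lam x))\<^sup>2) \<partial>M)"

text \<open>\<open>M lam\<close> is the probability measure under which the true intensity is \<open>lam\<close>.\<close>

definition max_risk ::
    "nat \<Rightarrow> ((real \<Rightarrow> real) \<Rightarrow> 'w measure) \<Rightarrow> (nat \<Rightarrow> 'w \<Rightarrow> real measure) \<Rightarrow>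
       (real \<Rightarrow> real) set \<Rightarrow> estimator \<Rightarrow> ennreal" where
  "max_risk n M N \<Lambda> est = (SUP lam\<in>\<Lambda>. risk n (M lam) N est lam)"

section \<open>The data-driven projection estimator\<close>

definition coeff_est :: "nat \<Rightarrow> sample \<Rightarrow> int \<Rightarrow> real" where
  "coeff_est n \<nu> j = (\<Sum>i<n. (LINT t|\<nu> i. trig_basis j t)) / real n"

definition proj_est :: "nat \<Rightarrow> nat \<Rightarrow> estimator" where
  "proj_est n k \<nu> x = (\<Sum>j\<in>{- int k..int k}. coeff_est n \<nu> j * trig_basis j x)"

definition contrast :: "nat \<Rightarrow> sample \<Rightarrow> (real \<Rightarrow> real) \<Rightarrow> real" where
  "contrast n \<nu> t = (L2_norm t)\<^sup>2 - 2 * L2_inner (proj_est n n \<nu>) t"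

definition pen :: "nat \<Rightarrow> sample \<Rightarrow> nat \<Rightarrow> real" where
  "pen n \<nu> k = 24 * max (coeff_est n \<nu> 0) 1 * (2 * real k + 1) / real n"

text \<open>If the minimiser is not unique, \<open>arg_min_on\<close> picks one by a fixed rule that depends on the
  sample only through the set of minimisers.\<close>

definition selected_dim :: "nat \<Rightarrow> sample \<Rightarrow> nat" where
  "selected_dim n \<nu> = arg_min_on (\<lambda>k. contrast n \<nu> (proj_est n k \<nu>) + pen n \<nu> k) {0..n}"

definition adaptive_est :: "nat \<Rightarrow> estimator" where
  "adaptive_est n \<nu> = proj_est n (selected_dim n \<nu>) \<nu>"

end

theory Submission
  imports Defs
begin

text \<open>
  Both sides of the inequality have the order \<open>(2 * k + 1) / n\<close>, where \<open>k\<close> is the largest dimension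
  with \<open>(\<gamma> k)\<^sup>2 * (2 * k + 1) \<le> n\<close> (\<open>rate_dimension\<close>). At this \<open>k\<close> the squared bias of the
  projection, at most \<open>L\<^sup>2 / (\<gamma> (k + 1))\<^sup>2\<close>, and its variance, at most a constant times
  \<open>(2 * k + 1) / n\<close>, are in balance.

  Upper bound (\<open>risk_adaptive_le\<close>). By completeness of the trigonometric system the loss of the
  projection of dimension \<open>m\<close> is its squared bias plus the noise
  \<open>Z m = (\<Sum>\<bar>j\<bar>\<le>m. (coef j - \<beta> j)\<^sup>2)\<close>. Comparing the criterion at the selected dimension with its value at
  \<open>k\<close> bounds the loss by bias and penalty at \<open>k\<close>, provided that \<open>Z m\<close> is dominated by a fraction of the
  penalty for all \<open>m\<close> at once. As \<open>Z\<close> is monotone in \<open>m\<close>, it is enough to control it at the dyadic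
  dimensions \<open>2 ^ l - 1\<close>. There the deviation of \<open>Z\<close> from its mean, beyond a threshold of order \<open>D / n\<close> with
  \<open>D = 2 * m + 1\<close>, is bounded through the fourth moment of \<open>Z - E Z\<close>, which is of order \<open>D\<^sup>2 * sqrt D / n ^ 4\<close> for \<open>D \<le> 4 * n\<close>
  (\<open>expectation_Q4\<close>); the resulting bound \<open>1 / (n * sqrt D)\<close> is summable over the levels. The second
  moment would give \<open>1 / n\<close> per level and hence a superfluous logarithm. The fourth moment is estimated
  by adding the \<open>n\<close> independent processes one at a time; all that is used of the intensity is its norm:
  Bessel's inequality bounds the Hilbert-Schmidt norm of the covariance matrix of the first \<open>D\<close>
  coefficients by a multiple of \<open>sqrt D\<close>, although the intensity may be unbounded. The random factor in
  the penalty is too small only if the total number of points falls below half of its mean, an event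
  that contributes \<open>O (1 / n)\<close>.

  Lower bound (\<open>minimax_lower_bound\<close>). The \<open>k + 1\<close> translates of a Fejer kernel of degree \<open>k\<close> to
  equidistant nodes are nonnegative, add up to one and interpolate at the nodes. Adding to \<open>L / 2\<close> an
  arbitrary subset of them, each with height \<open>h\<close> of order \<open>sqrt ((k + 1) / n)\<close>, gives intensities in the
  class: positivity holds for every subset, without any summability of the weights. Two subsets that
  differ in one node cannot be distinguished reliably (\<open>poisson_sample_comparison\<close>), while the squared
  errors at the nodes sum to at most \<open>2 * (k + 1)\<close> times the squared norm (\<open>sampling_inequality\<close>). Averaging over
  all subsets gives a risk of order \<open>h\<^sup>2\<close>.
\<close>

section \<open>Square-integrable functions on the unit interval\<close>

lemma space_unit_leb [simp]: "space unit_leb = {0..1}"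
  by (simp add: unit_leb_def space_restrict_space)

lemma sets_unit_leb: "A \<in> sets unit_leb \<longleftrightarrow> A \<subseteq> {0..1} \<and> A \<in> sets borel"
  by (simp add: unit_leb_def sets_restrict_space_iff)

lemma prob_space_unit_leb: "prob_space unit_leb"
  by (rule prob_spaceI) (simp add: unit_leb_def space_restrict_space emeasure_restrict_space)

interpretation unit: prob_space unit_leb by (rule prob_space_unit_leb)

lemma prob_unit_leb [simp]: "measure unit_leb {0..1} = 1"
  using unit.prob_space by simp

lemma borel_measurable_unit_leb: "f \<in> borel_measurable borel \<Longrightarrow> f \<in> borel_measurable unit_leb"
  unfolding unit_leb_def by (intro measurable_restrict_space1) simp

lemma integral_unit_leb: "(LINT x|unit_leb. (f x :: real)) = (LINT x:{0..1}|lborel. f x)"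
  unfolding unit_leb_def set_lebesgue_integral_def by (subst integral_restrict_space) auto

lemma integrable_bounded:
  assumes "f \<in> borel_measurable unit_leb" "\<And>x. x \<in> {0..1} \<Longrightarrow> \<bar>f x\<bar> \<le> (B::real)"
  shows "integrable unit_leb f"
  by (rule unit.integrable_const_bound[where B = B]) (use assms in auto)

abbreviation "sqn f \<equiv> L2_inner f f"

lemma L2_norm_sq: "(L2_norm f)\<^sup>2 = sqn f"
  by (simp add: L2_norm_def L2_inner_def)

lemma sqn_nonneg [simp]: "0 \<le> sqn f"
  by (simp add: L2_inner_def)

lemma L2_funD: "f \<in> L2_fun \<Longrightarrow> f \<in> borel_measurable unit_leb"
  and L2_fun_sq_integrable: "f \<in> L2_fun \<Longrightarrow> integrable unit_leb (\<lambda>x. f x * f x)"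
  by (auto simp: L2_fun_def power2_eq_square)

lemma L2_fun_mult_integrable:
  assumes f: "f \<in> L2_fun" and g: "g \<in> L2_fun" shows "integrable unit_leb (\<lambda>x. f x * g x)"
proof (rule Bochner_Integration.integrable_bound)
  show "integrable unit_leb (\<lambda>x. f x * f x + g x * g x)"
    using f g by (intro Bochner_Integration.integrable_add L2_fun_sq_integrable)
  have "\<bar>u * v\<bar> \<le> \<bar>u * u + v * v\<bar>" for u v :: real
  proof -
    have "0 \<le> \<bar>u\<bar> * \<bar>v\<bar>" by simp
    then have "\<bar>u\<bar> * \<bar>v\<bar> \<le> u * u + v * v"
      using sum_squares_bound[of "\<bar>u\<bar>" "\<bar>v\<bar>"] by (simp only: power2_eq_square abs_mult_self_eq)
    then show ?thesis by (simp add: abs_mult)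
  qed
  then show "AE x in unit_leb. norm (f x * g x) \<le> norm (f x * f x + g x * g x)" by simp
qed (use L2_funD[OF f] L2_funD[OF g] in measurable)

lemma L2_fun_bounded:
  assumes m: "f \<in> borel_measurable unit_leb" and B: "\<And>x. x \<in> {0..1} \<Longrightarrow> \<bar>f x\<bar> \<le> B"
  shows "f \<in> L2_fun"
proof -
  have "integrable unit_leb (\<lambda>x. (f x)\<^sup>2)"
  proof (rule integrable_bounded[where B = "B\<^sup>2"])
    show "\<bar>(f x)\<^sup>2\<bar> \<le> B\<^sup>2" if "x \<in> {0..1}" for x
      using power_mono[OF B[OF that], of 2] by simp
  qed (use m in measurable)
  then show ?thesis using m by (simp add: L2_fun_def)
qed

lemma L2_fun_const [simp]: "(\<lambda>_. c) \<in> L2_fun" by (rule L2_fun_bounded[where B = "\<bar>c\<bar>"]) auto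

lemma L2_fun_scale: "f \<in> L2_fun \<Longrightarrow> (\<lambda>x. c * f x) \<in> L2_fun"
  by (auto simp: L2_fun_def power_mult_distrib)

lemma L2_fun_add:
  assumes f: "f \<in> L2_fun" and g: "g \<in> L2_fun" shows "(\<lambda>x. f x + g x) \<in> L2_fun"
proof -
  have "integrable unit_leb (\<lambda>x. (f x * f x + g x * g x) + 2 * (f x * g x))"
    using f g by (intro Bochner_Integration.integrable_add L2_fun_sq_integrable integrable_mult_right L2_fun_mult_integrable)
  moreover have "(\<lambda>x. (f x + g x)\<^sup>2) = (\<lambda>x. (f x * f x + g x * g x) + 2 * (f x * g x))"
    by (simp add: fun_eq_iff power2_eq_square algebra_simps)
  ultimately have "integrable unit_leb (\<lambda>x. (f x + g x)\<^sup>2)" by simp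
  then show ?thesis using L2_funD[OF f] L2_funD[OF g] by (simp add: L2_fun_def)
qed

lemma L2_fun_diff: "f \<in> L2_fun \<Longrightarrow> g \<in> L2_fun \<Longrightarrow> (\<lambda>x. f x - g x) \<in> L2_fun"
  using L2_fun_add[OF _ L2_fun_scale[of g "-1"]] by simp

lemma L2_fun_sum: "(\<And>j. j \<in> J \<Longrightarrow> f j \<in> L2_fun) \<Longrightarrow> (\<lambda>x. \<Sum>j\<in>J. f j x) \<in> L2_fun"
  by (induction J rule: infinite_finite_induct) (auto intro: L2_fun_add)

lemma L2_inner_commute: "L2_inner f g = L2_inner g f"
  by (simp add: L2_inner_def mult.commute)

lemma L2_inner_scale: "L2_inner (\<lambda>x. c * f x) g = c * L2_inner f g"
  by (simp add: L2_inner_def mult.assoc)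

lemma L2_inner_add:
  assumes "f \<in> L2_fun" "g \<in> L2_fun" "h \<in> L2_fun"
  shows "L2_inner (\<lambda>x. f x + g x) h = L2_inner f h + L2_inner g h"
  using assms L2_fun_mult_integrable by (simp add: L2_inner_def ring_distribs)

lemma L2_inner_diff:
  assumes "f \<in> L2_fun" "g \<in> L2_fun" "h \<in> L2_fun"
  shows "L2_inner (\<lambda>x. f x - g x) h = L2_inner f h - L2_inner g h"
  using assms L2_fun_mult_integrable by (simp add: L2_inner_def ring_distribs)

lemma L2_inner_sum:
  assumes "\<And>j. j \<in> J \<Longrightarrow> f j \<in> L2_fun" "h \<in> L2_fun"
  shows "L2_inner (\<lambda>x. \<Sum>j\<in>J. f j x) h = (\<Sum>j\<in>J. L2_inner (f j) h)"
  using assms L2_fun_mult_integrable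
  by (simp add: L2_inner_def sum_distrib_right Bochner_Integration.integral_sum)

lemma sqn_diff:
  assumes "f \<in> L2_fun" "g \<in> L2_fun"
  shows "sqn (\<lambda>x. f x - g x) = sqn f - 2 * L2_inner f g + sqn g"
proof -
  have "sqn (\<lambda>x. f x - g x) = L2_inner f (\<lambda>x. f x - g x) - L2_inner g (\<lambda>x. f x - g x)"
    using assms by (simp add: L2_inner_diff L2_fun_diff)
  also have "\<dots> = (sqn f - L2_inner g f) - (L2_inner f g - sqn g)"
    using assms by (simp add: L2_inner_commute[of _ "\<lambda>x. f x - g x"] L2_inner_diff)
  finally show ?thesis by (simp add: L2_inner_commute[of g f])
qed

lemma sqn_triangle:
  assumes "f \<in> L2_fun" "g \<in> L2_fun" "h \<in> L2_fun"
  shows "sqn (\<lambda>x. f x - h x) \<le> 2 * sqn (\<lambda>x. f x - g x) + 2 * sqn (\<lambda>x. g x - h x)"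
proof -
  have "sqn (\<lambda>x. f x - h x) \<le> (LINT x|unit_leb. 2 * ((f x - g x) * (f x - g x)) + 2 * ((g x - h x) * (g x - h x)))"
    unfolding L2_inner_def
  proof (rule integral_mono)
    fix x
    show "(f x - h x) * (f x - h x) \<le> 2 * ((f x - g x) * (f x - g x)) + 2 * ((g x - h x) * (g x - h x))"
      using sum_squares_bound[of "f x - g x" "g x - h x"] by (simp add: power2_eq_square algebra_simps)
  qed (use assms L2_fun_diff L2_fun_sq_integrable in auto)
  also have "\<dots> = 2 * sqn (\<lambda>x. f x - g x) + 2 * sqn (\<lambda>x. g x - h x)"
    using assms L2_fun_sq_integrable[OF L2_fun_diff] by (simp add: L2_inner_def)
  finally show ?thesis .
qed

text \<open>The quadratic polynomial \<open>t \<mapsto> sqn (f - t * g)\<close> is nonnegative; its value at the minimum is the claim,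
  and it can be affine only if it is constant.\<close>

lemma L2_Cauchy_Schwarz:
  assumes f: "f \<in> L2_fun" and g: "g \<in> L2_fun"
  shows "(L2_inner f g)\<^sup>2 \<le> sqn f * sqn g"
proof -
  have *: "0 \<le> sqn f - 2 * (t * L2_inner f g) + t\<^sup>2 * sqn g" for t
    using sqn_diff[OF f L2_fun_scale[OF g, of t]] sqn_nonneg[of "\<lambda>x. f x - t * g x"]
    by (simp add: L2_inner_scale L2_inner_commute[of _ "\<lambda>x. t * g x"] L2_inner_commute[of g f] power2_eq_square mult.assoc)
  show ?thesis
  proof (cases "sqn g = 0")
    case True
    show ?thesis
    proof (rule ccontr)
      assume "\<not> ?thesis"
      then have nz: "L2_inner f g \<noteq> 0" using True by auto
      have "0 \<le> sqn f - 2 * ((sqn f + 1) / L2_inner f g * L2_inner f g)"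
        using *[of "(sqn f + 1) / L2_inner f g"] True by simp
      then show False using nz sqn_nonneg[of f] by simp
    qed
  next
    case False
    then have "0 < sqn g" using sqn_nonneg[of g] by linarith
    then show ?thesis using *[of "L2_inner f g / sqn g"] by (simp add: field_simps power2_eq_square)
  qed
qed

section \<open>The trigonometric system\<close>

lemma trig_basis_measurable [measurable]: "trig_basis j \<in> borel_measurable borel"
  unfolding trig_basis_def by measurable

lemma trig_zero_val [simp]: "trig_basis 0 t = 1" by (simp add: trig_basis_def)

lemma trig_basis_bound: "\<bar>trig_basis j t\<bar> \<le> sqrt 2"
  by (auto simp: trig_basis_def abs_mult)

lemma trig_basis_sq_bound: "(trig_basis j t)\<^sup>2 \<le> 2"
  using power_mono[OF trig_basis_bound, of j t 2] by simp

lemma L2_fun_trig [simp]: "trig_basis j \<in> L2_fun"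
  using trig_basis_bound borel_measurable_unit_leb[OF trig_basis_measurable] by (intro L2_fun_bounded) auto

lemma integral_cos: "(LINT t|unit_leb. cos (2 * pi * of_int m * t)) = (if m = 0 then 1 else 0)"
proof (cases "m = 0")
  case True then show ?thesis by (simp add: unit.prob_space)
next
  case False
  have "(LINT t|unit_leb. cos (2 * pi * of_int m * t)) = (\<integral>t. cos (2 * pi * of_int m * t) * indicator {0..1} t \<partial>lborel)"
    by (simp add: integral_unit_leb set_lebesgue_integral_def mult.commute)
  also have "\<dots> = sin (2 * pi * of_int m * 1) / (2 * pi * of_int m) - sin (2 * pi * of_int m * 0) / (2 * pi * of_int m)"
    by (rule integral_FTC_Icc_real) (use False in \<open>auto intro!: derivative_eq_intros continuous_intros simp: field_simps\<close>)
  also have "\<dots> = 0" using sin_int_2pin[of m] by simp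
  finally show ?thesis using False by simp
qed

lemma integral_sin: "(LINT t|unit_leb. sin (2 * pi * of_int m * t)) = 0"
proof (cases "m = 0")
  case False
  have "(LINT t|unit_leb. sin (2 * pi * of_int m * t)) = (\<integral>t. sin (2 * pi * of_int m * t) * indicator {0..1} t \<partial>lborel)"
    by (simp add: integral_unit_leb set_lebesgue_integral_def mult.commute)
  also have "\<dots> = - cos (2 * pi * of_int m * 1) / (2 * pi * of_int m) - - cos (2 * pi * of_int m * 0) / (2 * pi * of_int m)"
    by (rule integral_FTC_Icc_real) (use False in \<open>auto intro!: derivative_eq_intros continuous_intros simp: field_simps\<close>)
  also have "\<dots> = 0" using cos_int_2pin[of m] by simp
  finally show ?thesis .
qed simp

lemma trig_integrable [simp]: "integrable unit_leb (\<lambda>t. cos (c * t))" "integrable unit_leb (\<lambda>t. sin (c * t))"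
  by (auto intro!: integrable_bounded[where B = 1] borel_measurable_unit_leb)

lemma trig_prod:
  fixes i j :: int
  shows "2 * (cos (2 * pi * of_int i * t) * cos (2 * pi * of_int j * t)) = cos (2 * pi * of_int (i - j) * t) + cos (2 * pi * of_int (i + j) * t)"
    "2 * (sin (2 * pi * of_int i * t) * sin (2 * pi * of_int j * t)) = cos (2 * pi * of_int (i - j) * t) - cos (2 * pi * of_int (i + j) * t)"
    "2 * (sin (2 * pi * of_int i * t) * cos (2 * pi * of_int j * t)) = sin (2 * pi * of_int (i + j) * t) + sin (2 * pi * of_int (i - j) * t)"
proof -
  have *: "2 * pi * of_int (i - j) * t = 2 * pi * of_int i * t - 2 * pi * of_int j * t"
    "2 * pi * of_int (i + j) * t = 2 * pi * of_int i * t + 2 * pi * of_int j * t"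
    by (simp_all add: algebra_simps)
  show "2 * (cos (2 * pi * of_int i * t) * cos (2 * pi * of_int j * t)) = cos (2 * pi * of_int (i - j) * t) + cos (2 * pi * of_int (i + j) * t)"
    "2 * (sin (2 * pi * of_int i * t) * sin (2 * pi * of_int j * t)) = cos (2 * pi * of_int (i - j) * t) - cos (2 * pi * of_int (i + j) * t)"
    "2 * (sin (2 * pi * of_int i * t) * cos (2 * pi * of_int j * t)) = sin (2 * pi * of_int (i + j) * t) + sin (2 * pi * of_int (i - j) * t)"
    unfolding * cos_add cos_diff sin_add sin_diff by simp_all
qed

lemma sqrt2_mult: "sqrt 2 * x * (sqrt 2 * y) = 2 * (x * y)"
proof -
  have "sqrt 2 * x * (sqrt 2 * y) = (sqrt 2 * sqrt 2) * (x * y)" by (simp only: mult_ac)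
  then show ?thesis by simp
qed

lemma trig_orthonormal: "L2_inner (trig_basis i) (trig_basis j) = (if i = j then 1 else 0)"
proof -
  have one: "L2_inner (\<lambda>t. sqrt 2 * cos (2 * pi * of_int i * t)) (\<lambda>t. sqrt 2 * cos (2 * pi * of_int j * t)) =
      (if i = j then 1 else 0)" if "i > 0" "j > 0" for i j
  proof -
    have "L2_inner (\<lambda>t. sqrt 2 * cos (2 * pi * of_int i * t)) (\<lambda>t. sqrt 2 * cos (2 * pi * of_int j * t)) =
       (LINT t|unit_leb. cos (2 * pi * of_int (i - j) * t) + cos (2 * pi * of_int (i + j) * t))"
      unfolding L2_inner_def sqrt2_mult trig_prod(1) ..
    then show ?thesis using that by (simp add: integral_cos del: of_int_diff of_int_add)
  qed
  have two: "L2_inner (\<lambda>t. sqrt 2 * sin (2 * pi * of_int i * t)) (\<lambda>t. sqrt 2 * sin (2 * pi * of_int j * t)) =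
      (if i = j then 1 else 0)" if "i > 0" "j > 0" for i j
  proof -
    have "L2_inner (\<lambda>t. sqrt 2 * sin (2 * pi * of_int i * t)) (\<lambda>t. sqrt 2 * sin (2 * pi * of_int j * t)) =
       (LINT t|unit_leb. cos (2 * pi * of_int (i - j) * t) - cos (2 * pi * of_int (i + j) * t))"
      unfolding L2_inner_def sqrt2_mult trig_prod(2) ..
    then show ?thesis using that by (simp add: integral_cos del: of_int_diff of_int_add)
  qed
  have three: "L2_inner (\<lambda>t. sqrt 2 * sin (2 * pi * of_int i * t)) (\<lambda>t. sqrt 2 * cos (2 * pi * of_int j * t)) = 0" for i j
  proof -
    have "L2_inner (\<lambda>t. sqrt 2 * sin (2 * pi * of_int i * t)) (\<lambda>t. sqrt 2 * cos (2 * pi * of_int j * t)) =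
       (LINT t|unit_leb. sin (2 * pi * of_int (i + j) * t) + sin (2 * pi * of_int (i - j) * t))"
      unfolding L2_inner_def sqrt2_mult trig_prod(3) ..
    then show ?thesis by (simp add: integral_sin del: of_int_diff of_int_add)
  qed
  have c: "trig_basis i = (\<lambda>t. sqrt 2 * cos (2 * pi * of_int i * t))" if "i > 0" for i
    using that by (auto simp: trig_basis_def)
  have s: "trig_basis i = (\<lambda>t. sqrt 2 * sin (2 * pi * of_int (-i) * t))" if "i < 0" for i
    using that by (auto simp: trig_basis_def)
  have z: "trig_basis 0 = (\<lambda>t. 1)" by (auto simp: trig_basis_def)
  have zc: "L2_inner (\<lambda>t. 1) (\<lambda>t. sqrt 2 * cos (2 * pi * of_int i * t)) = 0" if "i > 0" for i
    using that integral_cos[of i] by (simp add: L2_inner_def)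
  have zs: "L2_inner (\<lambda>t. 1) (\<lambda>t. sqrt 2 * sin (2 * pi * of_int i * t)) = 0" for i
    using integral_sin[of i] by (simp add: L2_inner_def)
  have zz: "L2_inner (\<lambda>t. 1) (\<lambda>t. 1) = 1" by (simp add: L2_inner_def unit.prob_space)
  consider "i = 0" | "i > 0" | "i < 0" by linarith
  then show ?thesis
  proof cases
    case 1
    consider "j = 0" | "j > 0" | "j < 0" by linarith
    then show ?thesis using 1 zz by cases (auto simp only: z c s zc zs split: if_split)
  next
    case 2
    consider "j = 0" | "j > 0" | "j < 0" by linarith
    then show ?thesis using 2 zc[of i] one[of i j] three[of "-j" i]
      by cases (auto simp only: z c s L2_inner_commute[of "\<lambda>t. sqrt 2 * cos (2 * pi * of_int i * t)"] split: if_split)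
  next
    case 3
    consider "j = 0" | "j > 0" | "j < 0" by linarith
    then show ?thesis using 3 zs[of "-i"] two[of "-i" "-j"] three[of "-i" j]
      by cases (auto simp only: z c s L2_inner_commute[of "\<lambda>t. sqrt 2 * sin (2 * pi * of_int (-i) * t)" "\<lambda>_. 1"] split: if_split)
  qed
qed

lemma L2_inner_trig_sum:
  assumes f: "f \<in> L2_fun"
  shows "L2_inner f (\<lambda>x. \<Sum>j\<in>J. c j * trig_basis j x) = (\<Sum>j\<in>J. c j * L2_inner f (trig_basis j))"
proof -
  have "L2_inner (\<lambda>x. \<Sum>j\<in>J. c j * trig_basis j x) f = (\<Sum>j\<in>J. c j * L2_inner (trig_basis j) f)"
    using f by (subst L2_inner_sum) (auto intro: L2_fun_scale simp: L2_inner_scale)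
  then show ?thesis by (simp add: L2_inner_commute)
qed

lemma L2_fun_trig_sum [simp]: "(\<lambda>x. \<Sum>j\<in>J. c j * trig_basis j x) \<in> L2_fun"
  by (intro L2_fun_sum L2_fun_scale) simp

lemma L2_inner_trig_sum_basis:
  assumes "finite J"
  shows "L2_inner (\<lambda>x. \<Sum>j\<in>J. c j * trig_basis j x) (trig_basis l) = (if l \<in> J then c l else 0)"
  using assms L2_inner_trig_sum[of "trig_basis l" c J]
  by (simp add: L2_inner_commute[of _ "trig_basis l"] trig_orthonormal if_distrib sum.delta cong: if_cong)

lemma sqn_trig_sum:
  assumes "finite J" shows "sqn (\<lambda>x. \<Sum>j\<in>J. c j * trig_basis j x) = (\<Sum>j\<in>J. (c j)\<^sup>2)"
  using assms by (simp add: L2_inner_trig_sum L2_inner_trig_sum_basis power2_eq_square)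

text \<open>Pythagoras: the distance to a trigonometric sum splits into the distance to the Fourier partial
  sum and the distance between the two coefficient vectors.\<close>

lemma sqn_diff_trig_sum:
  assumes f: "f \<in> L2_fun" and J: "finite J"
  shows "sqn (\<lambda>x. (\<Sum>j\<in>J. c j * trig_basis j x) - f x) =
     sqn f - (\<Sum>j\<in>J. (L2_inner f (trig_basis j))\<^sup>2) + (\<Sum>j\<in>J. (c j - L2_inner f (trig_basis j))\<^sup>2)"
proof -
  have "(\<Sum>j\<in>J. (c j - L2_inner f (trig_basis j))\<^sup>2) =
      (\<Sum>j\<in>J. (c j)\<^sup>2) + (\<Sum>j\<in>J. (L2_inner f (trig_basis j))\<^sup>2) - 2 * (\<Sum>j\<in>J. c j * L2_inner f (trig_basis j))"
    by (simp add: power2_diff sum.distrib sum_subtractf sum_distrib_left mult.assoc)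
  moreover have "sqn (\<lambda>x. (\<Sum>j\<in>J. c j * trig_basis j x) - f x) =
      sqn (\<lambda>x. \<Sum>j\<in>J. c j * trig_basis j x) - 2 * L2_inner (\<lambda>x. \<Sum>j\<in>J. c j * trig_basis j x) f + sqn f"
    by (rule sqn_diff[OF L2_fun_trig_sum f])
  moreover have "L2_inner (\<lambda>x. \<Sum>j\<in>J. c j * trig_basis j x) f = (\<Sum>j\<in>J. c j * L2_inner f (trig_basis j))"
    using L2_inner_trig_sum[OF f, of c J] by (simp only: L2_inner_commute[of _ f])
  ultimately show ?thesis using sqn_trig_sum[OF J, of c] by linarith
qed

lemma Bessel:
  assumes f: "f \<in> L2_fun" and J: "finite J"
  shows "(\<Sum>j\<in>J. (L2_inner f (trig_basis j))\<^sup>2) \<le> sqn f"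
  using sqn_diff_trig_sum[OF assms, of "\<lambda>j. L2_inner f (trig_basis j)"]
    sqn_nonneg[of "\<lambda>x. (\<Sum>j\<in>J. L2_inner f (trig_basis j) * trig_basis j x) - f x"] by simp

section \<open>Completeness\<close>

definition trig_poly :: "(real \<Rightarrow> real) \<Rightarrow> bool" where
  "trig_poly p \<longleftrightarrow> (\<exists>(m::nat) c. \<forall>t. p t = (\<Sum>j\<in>{- int m..int m}. c j * trig_basis j t))"

lemma trig_poly_basis: "trig_poly (trig_basis j)"
  unfolding trig_poly_def
proof (intro exI allI)
  fix t
  have "(\<Sum>l\<in>{- int (nat \<bar>j\<bar>)..int (nat \<bar>j\<bar>)}. (if l = j then 1 else 0) * trig_basis l t) =
      (\<Sum>l\<in>{- int (nat \<bar>j\<bar>)..int (nat \<bar>j\<bar>)}. if l = j then trig_basis l t else 0)"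
    by (intro sum.cong) auto
  also have "\<dots> = trig_basis j t" by (subst sum.delta) auto
  finally show "trig_basis j t = (\<Sum>l\<in>{- int (nat \<bar>j\<bar>)..int (nat \<bar>j\<bar>)}. (if l = j then 1 else 0) * trig_basis l t)" ..
qed

lemma trig_sum_extend:
  assumes "m \<le> (k::nat)"
  shows "(\<Sum>j\<in>{- int m..int m}. c j * trig_basis j t) =
    (\<Sum>j\<in>{- int k..int k}. (if \<bar>j\<bar> \<le> int m then c j else 0) * trig_basis j t)"
  by (rule sum.mono_neutral_cong_left) (use assms in auto)

lemma trig_poly_scale: "trig_poly p \<Longrightarrow> trig_poly (\<lambda>t. a * p t)"
  unfolding trig_poly_def
  by (elim exE, rule_tac x = m in exI, rule_tac x = "\<lambda>j. a * c j" in exI) (simp add: sum_distrib_left mult.assoc)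

lemma trig_poly_add:
  assumes "trig_poly p" "trig_poly q" shows "trig_poly (\<lambda>t. p t + q t)"
proof -
  obtain m c where p: "p t = (\<Sum>j\<in>{- int m..int m}. c j * trig_basis j t)" for t
    using assms(1) by (auto simp: trig_poly_def)
  obtain k d where q: "q t = (\<Sum>j\<in>{- int k..int k}. d j * trig_basis j t)" for t
    using assms(2) by (auto simp: trig_poly_def)
  have "p t + q t = (\<Sum>j\<in>{- int (max m k)..int (max m k)}.
      ((if \<bar>j\<bar> \<le> int m then c j else 0) + (if \<bar>j\<bar> \<le> int k then d j else 0)) * trig_basis j t)" for t
    unfolding p q
    by (subst (1 2) trig_sum_extend[of _ "max m k"]) (auto simp: ring_distribs sum.distrib)
  then show ?thesis unfolding trig_poly_def
    by (intro exI[of _ "max m k"] exI[of _ "\<lambda>j. (if \<bar>j\<bar> \<le> int m then c j else 0) + (if \<bar>j\<bar> \<le> int k then d j else 0)"]) blast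
qed

lemma trig_poly_diff: "trig_poly p \<Longrightarrow> trig_poly q \<Longrightarrow> trig_poly (\<lambda>t. p t - q t)"
  using trig_poly_add[OF _ trig_poly_scale[of q "-1"]] by simp

lemma trig_poly_const: "trig_poly (\<lambda>_. c)"
  using trig_poly_scale[OF trig_poly_basis[of 0], of c] by (simp add: trig_basis_def)

lemma trig_poly_sum: "(\<And>j. j \<in> J \<Longrightarrow> trig_poly (f j)) \<Longrightarrow> trig_poly (\<lambda>t. \<Sum>j\<in>J. f j t)"
  by (induction J rule: infinite_finite_induct) (auto intro: trig_poly_const trig_poly_add)

lemma trig_poly_cos: "trig_poly (\<lambda>t. cos (2 * pi * of_int m * t))"
proof -
  have pos: "trig_poly (\<lambda>t. cos (2 * pi * of_int m * t))" if "m > 0" for m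
    using trig_poly_scale[OF trig_poly_basis[of m], of "1 / sqrt 2"] that by (simp add: trig_basis_def)
  consider "m = 0" | "m > 0" | "m < 0" by linarith
  then show ?thesis using pos[of m] pos[of "-m"] by cases (auto simp: trig_poly_const)
qed

lemma trig_poly_sin: "trig_poly (\<lambda>t. sin (2 * pi * of_int m * t))"
proof -
  have pos: "trig_poly (\<lambda>t. sin (2 * pi * of_int m * t))" if "m > 0" for m
    using trig_poly_scale[OF trig_poly_basis[of "-m"], of "1 / sqrt 2"] that by (simp add: trig_basis_def)
  consider "m = 0" | "m > 0" | "m < 0" by linarith
  then show ?thesis using pos[of m] trig_poly_scale[OF pos[of "-m"], of "-1"] by cases (auto simp: trig_poly_const)
qed

text \<open>Product-to-sum formulas; this makes the trigonometric polynomials an algebra, so that polynomials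
  in the coordinates of the circle pull back to trigonometric polynomials.\<close>

lemma trig_poly_basis_mult: "trig_poly (\<lambda>t. trig_basis i t * trig_basis j t)"
proof -
  have form: "\<exists>a m. (trig_basis j = (\<lambda>t. a * cos (2 * pi * of_int m * t))) \<or> (trig_basis j = (\<lambda>t. a * sin (2 * pi * of_int m * t)))" for j
  proof -
    consider "j = 0" | "j > 0" | "j < 0" by linarith
    then show ?thesis
    proof cases
      case 1 then show ?thesis by (intro exI[of _ 1] exI[of _ 0]) (auto simp: trig_basis_def)
    next
      case 2 then show ?thesis by (intro exI[of _ "sqrt 2"] exI[of _ j]) (auto simp: trig_basis_def)
    next
      case 3 then show ?thesis by (intro exI[of _ "sqrt 2"] exI[of _ "-j"] disjI2) (auto simp: trig_basis_def)
    qed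
  qed
  have cc: "trig_poly (\<lambda>t. (a * cos (2 * pi * of_int k * t)) * (b * cos (2 * pi * of_int l * t)))" for a b k l
  proof -
    have "(\<lambda>t. (a * cos (2 * pi * of_int k * t)) * (b * cos (2 * pi * of_int l * t))) =
      (\<lambda>t. (a * b / 2) * (cos (2 * pi * of_int (k - l) * t) + cos (2 * pi * of_int (k + l) * t)))"
      unfolding trig_prod(1)[symmetric] by auto
    then show ?thesis by (simp only:) (intro trig_poly_scale trig_poly_add trig_poly_cos)
  qed
  have ss: "trig_poly (\<lambda>t. (a * sin (2 * pi * of_int k * t)) * (b * sin (2 * pi * of_int l * t)))" for a b k l
  proof -
    have "(\<lambda>t. (a * sin (2 * pi * of_int k * t)) * (b * sin (2 * pi * of_int l * t))) =
      (\<lambda>t. (a * b / 2) * (cos (2 * pi * of_int (k - l) * t) - cos (2 * pi * of_int (k + l) * t)))"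
      unfolding trig_prod(2)[symmetric] by auto
    then show ?thesis by (simp only:) (intro trig_poly_scale trig_poly_diff trig_poly_cos)
  qed
  have sc: "trig_poly (\<lambda>t. (a * sin (2 * pi * of_int k * t)) * (b * cos (2 * pi * of_int l * t)))" for a b k l
  proof -
    have "(\<lambda>t. (a * sin (2 * pi * of_int k * t)) * (b * cos (2 * pi * of_int l * t))) =
      (\<lambda>t. (a * b / 2) * (sin (2 * pi * of_int (k + l) * t) + sin (2 * pi * of_int (k - l) * t)))"
      unfolding trig_prod(3)[symmetric] by auto
    then show ?thesis by (simp only:) (intro trig_poly_scale trig_poly_add trig_poly_sin)
  qed
  have cs: "trig_poly (\<lambda>t. (a * cos (2 * pi * of_int k * t)) * (b * sin (2 * pi * of_int l * t)))" for a b k l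
    using sc[of b l a k] by (simp only: mult.commute)
  obtain a k b l where
    "(trig_basis i = (\<lambda>t. a * cos (2 * pi * of_int k * t))) \<or> (trig_basis i = (\<lambda>t. a * sin (2 * pi * of_int k * t)))"
    "(trig_basis j = (\<lambda>t. b * cos (2 * pi * of_int l * t))) \<or> (trig_basis j = (\<lambda>t. b * sin (2 * pi * of_int l * t)))"
    using form[of i] form[of j] by blast
  then show ?thesis using cc ss sc cs by (elim disjE) (simp_all only:)
qed

lemma trig_poly_mult:
  assumes "trig_poly p" "trig_poly q" shows "trig_poly (\<lambda>t. p t * q t)"
proof -
  obtain m c where p: "p t = (\<Sum>j\<in>{- int m..int m}. c j * trig_basis j t)" for t
    using assms(1) by (auto simp: trig_poly_def)
  obtain k d where q: "q t = (\<Sum>j\<in>{- int k..int k}. d j * trig_basis j t)" for t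
    using assms(2) by (auto simp: trig_poly_def)
  have "(\<lambda>t. p t * q t) = (\<lambda>t. \<Sum>i\<in>{- int m..int m}. \<Sum>j\<in>{- int k..int k}.
      (c i * d j) * (trig_basis i t * trig_basis j t))"
    by (simp add: fun_eq_iff p q sum_product mult_ac)
  then show ?thesis
    by (simp only:) (intro trig_poly_sum trig_poly_scale trig_poly_basis_mult)
qed

lemma trig_poly_L2: "trig_poly p \<Longrightarrow> p \<in> L2_fun"
proof -
  assume "trig_poly p"
  then obtain m c where "p = (\<lambda>t. \<Sum>j\<in>{- int m..int m}. c j * trig_basis j t)"
    by (auto simp: trig_poly_def fun_eq_iff)
  then show ?thesis by simp
qed

lemma trig_poly_real_polynomial:
  fixes p :: "complex \<Rightarrow> real"
  assumes "real_polynomial_function p" shows "trig_poly (\<lambda>t. p (cis (2 * pi * t)))"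
  using assms
proof induction
  case (linear f)
  interpret bounded_linear f by fact
  have "f (cis (2 * pi * t)) = f 1 * cos (2 * pi * of_int 1 * t) + f \<i> * sin (2 * pi * of_int 1 * t)" for t
  proof -
    have "cis (2 * pi * t) = cos (2 * pi * t) *\<^sub>R 1 + sin (2 * pi * t) *\<^sub>R \<i>"
      by (simp add: complex_eq_iff)
    then show ?thesis by (simp add: add scaleR mult.commute)
  qed
  then show ?case
    by (simp only:) (intro trig_poly_add trig_poly_scale trig_poly_cos trig_poly_sin)
qed (auto intro: trig_poly_const trig_poly_add trig_poly_mult)

text \<open>The closure of the trigonometric polynomials. Completeness is shown by enlarging this class in
  steps: continuous functions on the circle (Stone-Weierstrass), indicators of closed subsets of the
  circle, indicators of intervals, of Borel sets, and finally all of the space.\<close>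

definition approximable :: "(real \<Rightarrow> real) \<Rightarrow> bool" where
  "approximable f \<longleftrightarrow> f \<in> L2_fun \<and> (\<forall>e>0. \<exists>p. trig_poly p \<and> sqn (\<lambda>t. f t - p t) < e)"

lemma approximable_closed:
  assumes f: "f \<in> L2_fun" and "\<And>e. 0 < e \<Longrightarrow> \<exists>g. approximable g \<and> sqn (\<lambda>t. f t - g t) < e"
  shows "approximable f"
  unfolding approximable_def
proof (intro conjI f allI impI)
  fix e :: real assume "0 < e"
  then obtain g where g: "approximable g" "sqn (\<lambda>t. f t - g t) < e / 4" using assms(2)[of "e/4"] by auto
  then obtain p where p: "trig_poly p" "sqn (\<lambda>t. g t - p t) < e / 4"
    using \<open>0 < e\<close> unfolding approximable_def by (metis zero_less_divide_iff zero_less_numeral)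
  have "sqn (\<lambda>t. f t - p t) < e"
    using sqn_triangle[OF f _ trig_poly_L2[OF p(1)], of g] g p by (auto simp: approximable_def)
  with p show "\<exists>p. trig_poly p \<and> sqn (\<lambda>t. f t - p t) < e" by blast
qed

lemma approximable_add:
  assumes f: "approximable f" and g: "approximable g" shows "approximable (\<lambda>t. f t + g t)"
  unfolding approximable_def
proof (intro conjI allI impI)
  show L: "(\<lambda>t. f t + g t) \<in> L2_fun" using f g by (auto simp: approximable_def intro: L2_fun_add)
  fix e :: real assume "0 < e"
  then have e4: "0 < e / 4" by simp
  obtain p where p: "trig_poly p" "sqn (\<lambda>t. f t - p t) < e / 4"
    using f e4 unfolding approximable_def by blast
  obtain q where q: "trig_poly q" "sqn (\<lambda>t. g t - q t) < e / 4"
    using g e4 unfolding approximable_def by blast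
  note pq = p q
  have L: "f \<in> L2_fun" "g \<in> L2_fun" "p \<in> L2_fun" "q \<in> L2_fun"
    using f g pq by (auto simp: approximable_def intro: trig_poly_L2)
  have "sqn (\<lambda>t. (f t + g t) - (p t + q t)) \<le> 2 * sqn (\<lambda>t. f t - p t) + 2 * sqn (\<lambda>t. g t - q t)"
    using sqn_triangle[of "\<lambda>t. f t + g t" "\<lambda>t. p t + g t" "\<lambda>t. p t + q t"] L by (simp add: L2_fun_add)
  then have "sqn (\<lambda>t. (f t + g t) - (p t + q t)) < e" using pq by linarith
  with trig_poly_add[OF pq(1,3)] show "\<exists>p. trig_poly p \<and> sqn (\<lambda>t. (f t + g t) - p t) < e" by blast
qed

lemma approximable_trig_poly: "trig_poly p \<Longrightarrow> approximable p"
  unfolding approximable_def using trig_poly_L2 by (auto simp: L2_inner_def intro!: exI[of _ p])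

lemma approximable_scale:
  assumes f: "approximable f" shows "approximable (\<lambda>t. a * f t)"
  unfolding approximable_def
proof (intro conjI allI impI)
  show "(\<lambda>t. a * f t) \<in> L2_fun" using f by (auto simp: approximable_def intro: L2_fun_scale)
  fix e :: real assume e: "0 < e"
  define d where "d = e / (a * a + 1)"
  have pos: "0 < a * a + 1" using zero_le_square[of a] by linarith
  then have d: "0 < d" using e by (simp add: d_def)
  then obtain p where p: "trig_poly p" "sqn (\<lambda>t. f t - p t) < d"
    using f unfolding approximable_def by blast
  have "sqn (\<lambda>t. a * f t - a * p t) = (a * a) * sqn (\<lambda>t. f t - p t)"
    unfolding L2_inner_def integral_mult_right_zero[symmetric]
    by (intro Bochner_Integration.integral_cong) (auto simp: algebra_simps)
  also have "\<dots> \<le> (a * a) * d" using p by (intro mult_left_mono) auto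
  also have "\<dots> < (a * a + 1) * d" using d by (simp add: algebra_simps)
  also have "\<dots> = e" using pos by (simp add: d_def)
  finally show "\<exists>p. trig_poly p \<and> sqn (\<lambda>t. a * f t - p t) < e" using trig_poly_scale[OF p(1)] by blast
qed

lemma approximable_sum: "(\<And>j. j \<in> J \<Longrightarrow> approximable (f j)) \<Longrightarrow> approximable (\<lambda>t. \<Sum>j\<in>J. f j t)"
  by (induction J rule: infinite_finite_induct)
    (auto intro: approximable_add approximable_trig_poly[OF trig_poly_const])

lemma approximable_dominated:
  assumes g: "\<And>n. approximable (g n)" and f: "f \<in> borel_measurable unit_leb" and h: "h \<in> L2_fun"
    and lim: "AE t in unit_leb. (\<lambda>n. g n t) \<longlonglongrightarrow> f t"
    and le: "\<And>n t. t \<in> {0..1} \<Longrightarrow> \<bar>g n t\<bar> \<le> \<bar>h t\<bar>" "\<And>t. t \<in> {0..1} \<Longrightarrow> \<bar>f t\<bar> \<le> \<bar>h t\<bar>"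
  shows "approximable f"
proof (rule approximable_closed)
  show fL: "f \<in> L2_fun"
    unfolding L2_fun_def
  proof (intro CollectI conjI f, rule Bochner_Integration.integrable_bound)
    show "integrable unit_leb (\<lambda>t. (h t)\<^sup>2)" using h by (simp add: L2_fun_def)
    show "AE t in unit_leb. norm ((f t)\<^sup>2) \<le> norm ((h t)\<^sup>2)"
      using le(2) by (intro AE_I2) (auto simp: abs_le_square_iff)
  qed (use f in measurable)
  have gL: "g n \<in> L2_fun" for n using g by (simp add: approximable_def)
  have "(\<lambda>n. LINT t|unit_leb. (f t - g n t) * (f t - g n t)) \<longlonglongrightarrow> (LINT t|unit_leb. 0)"
  proof (rule integral_dominated_convergence)
    show "integrable unit_leb (\<lambda>t. 4 * (h t * h t))" using h L2_fun_sq_integrable by simp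
    show "AE t in unit_leb. (\<lambda>n. (f t - g n t) * (f t - g n t)) \<longlonglongrightarrow> 0"
      using lim by eventually_elim (auto intro!: tendsto_eq_intros)
    show "AE t in unit_leb. norm ((f t - g n t) * (f t - g n t)) \<le> 4 * (h t * h t)" for n
    proof (rule AE_I2)
      fix t assume "t \<in> space unit_leb"
      then have "\<bar>f t - g n t\<bar> \<le> 2 * \<bar>h t\<bar>" using le(1)[of t n] le(2)[of t] by simp
      then have "\<bar>f t - g n t\<bar> * \<bar>f t - g n t\<bar> \<le> (2 * \<bar>h t\<bar>) * (2 * \<bar>h t\<bar>)"
        by (intro mult_mono) auto
      then show "norm ((f t - g n t) * (f t - g n t)) \<le> 4 * (h t * h t)"
        by (simp add: abs_mult)
    qed
  qed (use L2_funD[OF gL] f in measurable)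
  then have "(\<lambda>n. sqn (\<lambda>t. f t - g n t)) \<longlonglongrightarrow> 0" by (simp add: L2_inner_def)
  then have "\<exists>n. sqn (\<lambda>t. f t - g n t) < e" if "0 < e" for e
    using order_tendstoD(2)[OF _ that] eventually_happens'[OF sequentially_bot] by fast
  then show "\<exists>k. approximable k \<and> sqn (\<lambda>t. f t - k t) < e" if "0 < e" for e
    using that g by blast
qed

lemma approximable_circle_continuous:
  fixes h :: "complex \<Rightarrow> real"
  assumes h: "continuous_on (sphere 0 1) h" "\<And>z. \<bar>h z\<bar> \<le> B"
    and m: "(\<lambda>t. h (cis (2 * pi * t))) \<in> borel_measurable borel"
  shows "approximable (\<lambda>t. h (cis (2 * pi * t)))"
  unfolding approximable_def
proof (intro conjI allI impI)
  show L: "(\<lambda>t. h (cis (2 * pi * t))) \<in> L2_fun"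
    by (rule L2_fun_bounded[where B = B]) (use h(2) borel_measurable_unit_leb[OF m] in auto)
  fix e :: real assume e: "0 < e"
  define d where "d = sqrt e / 2"
  have d: "0 < d" "d * d < e" using e by (auto simp: d_def)
  obtain g where g: "real_polynomial_function g" "\<And>z. z \<in> sphere 0 1 \<Longrightarrow> \<bar>h z - g z\<bar> < d"
    using Stone_Weierstrass_real_polynomial_function[OF compact_sphere h(1) d(1)] by metis
  let ?p = "\<lambda>t. g (cis (2 * pi * t))"
  have p: "trig_poly ?p" by (rule trig_poly_real_polynomial[OF g(1)])
  have "sqn (\<lambda>t. h (cis (2 * pi * t)) - ?p t) \<le> (LINT t|unit_leb. d * d)"
    unfolding L2_inner_def
  proof (rule integral_mono)
    show "integrable unit_leb (\<lambda>t. (h (cis (2 * pi * t)) - ?p t) * (h (cis (2 * pi * t)) - ?p t))"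
      using L2_fun_sq_integrable[OF L2_fun_diff[OF L trig_poly_L2[OF p]]] .
    fix t
    have "\<bar>h (cis (2 * pi * t)) - ?p t\<bar> * \<bar>h (cis (2 * pi * t)) - ?p t\<bar> \<le> d * d"
      using g(2)[of "cis (2 * pi * t)"] d by (intro mult_mono) auto
    then show "(h (cis (2 * pi * t)) - ?p t) * (h (cis (2 * pi * t)) - ?p t) \<le> d * d" by simp
  qed simp
  also have "\<dots> < e" using d by (simp add: unit.prob_space)
  finally show "\<exists>p. trig_poly p \<and> sqn (\<lambda>t. h (cis (2 * pi * t)) - p t) < e" using p by blast
qed

lemma cis_measurable [measurable]: "(\<lambda>t. cis (2 * pi * t)) \<in> borel_measurable borel"
  by (intro borel_measurable_continuous_onI continuous_intros)

text \<open>The functions \<open>max 0 (1 - n * infdist z C)\<close> are continuous on the whole plane and decrease to the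
  indicator of \<open>C\<close>, so no continuous function on the circle has to be built from a periodic one.\<close>

lemma approximable_circle_closed:
  assumes C: "closed C" "C \<noteq> {}"
  shows "approximable (\<lambda>t. indicator C (cis (2 * pi * t)))"
proof (rule approximable_dominated)
  define h where "h n z = max 0 (1 - real n * infdist z C)" for n z
  have cont: "continuous_on UNIV (h n)" for n
    unfolding h_def by (intro continuous_intros)
  have le: "\<bar>h n z\<bar> \<le> 1" for n z
    by (auto simp: h_def infdist_nonneg max_def)
  show "approximable (\<lambda>t. h n (cis (2 * pi * t)))" for n
  proof (rule approximable_circle_continuous[where B = 1])
    show "continuous_on (sphere 0 1) (h n)" using cont continuous_on_subset by blast
    show "(\<lambda>t. h n (cis (2 * pi * t))) \<in> borel_measurable borel"
      using measurable_compose[OF cis_measurable borel_measurable_continuous_onI[OF cont]] .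
  qed (rule le)
  have "C \<in> sets borel" using C by auto
  then show "(\<lambda>t. indicator C (cis (2 * pi * t)) :: real) \<in> borel_measurable unit_leb"
    by (intro borel_measurable_unit_leb measurable_compose[OF cis_measurable]) simp
  show "(\<lambda>_. 1) \<in> L2_fun" by simp
  show "AE t in unit_leb. (\<lambda>n. h n (cis (2 * pi * t))) \<longlonglongrightarrow> indicator C (cis (2 * pi * t))"
  proof (rule AE_I2)
    fix t :: real
    let ?z = "cis (2 * pi * t)"
    show "(\<lambda>n. h n ?z) \<longlonglongrightarrow> indicator C ?z"
    proof (cases "?z \<in> C")
      case True then show ?thesis by (simp add: h_def)
    next
      case False
      then have pos: "0 < infdist ?z C"
        using C by (metis in_closed_iff_infdist_zero infdist_nonneg less_eq_real_def)
      obtain N where N: "1 / infdist ?z C < real N" using reals_Archimedean2 by blast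
      have "h n ?z = 0" if "N \<le> n" for n
      proof -
        have "1 / infdist ?z C \<le> real n" using N that by simp
        then have "1 \<le> real n * infdist ?z C" using pos by (simp add: field_simps)
        then show ?thesis by (simp add: h_def)
      qed
      then have "eventually (\<lambda>n. h n ?z = 0) sequentially" using eventually_sequentially by blast
      then show ?thesis using False by (simp add: tendsto_eventually)
    qed
  qed
qed (auto simp: indicator_def infdist_nonneg max_def)

lemma approximable_AE_cong:
  assumes f: "approximable f" and g: "g \<in> borel_measurable unit_leb" and eq: "AE t in unit_leb. g t = f t"
    and B: "\<And>x. x \<in> {0..1} \<Longrightarrow> \<bar>g x\<bar> \<le> B"
  shows "approximable g"
  unfolding approximable_def
proof (intro conjI allI impI)
  show L: "g \<in> L2_fun" using L2_fun_bounded[OF g B] .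
  fix e :: real assume "0 < e"
  then obtain p where p: "trig_poly p" "sqn (\<lambda>t. f t - p t) < e" using f by (auto simp: approximable_def)
  have [measurable]: "f \<in> borel_measurable unit_leb" "p \<in> borel_measurable unit_leb" "g \<in> borel_measurable unit_leb"
    using L2_funD f trig_poly_L2[OF p(1)] g by (auto simp: approximable_def)
  have "sqn (\<lambda>t. g t - p t) = sqn (\<lambda>t. f t - p t)"
    unfolding L2_inner_def
  proof (rule integral_cong_AE)
    show "AE t in unit_leb. (g t - p t) * (g t - p t) = (f t - p t) * (f t - p t)"
      using eq by eventually_elim simp
  qed measurable
  then show "\<exists>p. trig_poly p \<and> sqn (\<lambda>t. g t - p t) < e" using p by metis
qed

lemma AE_unit_leb_neq: "AE t in unit_leb. t \<noteq> c"
proof -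
  have "AE t in lborel. t \<noteq> c" by (rule AE_lborel_singleton)
  then show ?thesis unfolding unit_leb_def by (subst AE_restrict_space_iff) auto
qed

text \<open>After moving the part to the left of an open interval by one period, the complement of the
  interval becomes a single compact interval, whose image on the circle is a closed arc.\<close>

lemma approximable_interval: "approximable (indicator {a<..<b})"
proof -
  \<comment> \<open>truncation to the unit interval changes the indicator only at the end points\<close>
  define a' b' where "a' = max 0 a" and "b' = min 1 b"
  have ind_m: "indicator {a<..<b} \<in> borel_measurable unit_leb"
    by (intro borel_measurable_unit_leb) simp
  show ?thesis
  proof (cases "a' \<le> b'")
    case False
    then have "AE t in unit_leb. (indicator {a<..<b} t :: real) = 0"
      by (intro AE_I2) (auto simp: a'_def b'_def indicator_def)
    then show ?thesis
      using approximable_AE_cong[OF approximable_trig_poly[OF trig_poly_const[of 0]] ind_m, of 1]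
      by (auto simp: indicator_def)
  next
    case True
    define C where "C = (\<lambda>t. cis (2 * pi * t)) ` {b'..a' + 1}"
    have ab: "0 \<le> a'" "b' \<le> 1" by (auto simp: a'_def b'_def)
    have "compact C" unfolding C_def
      by (intro compact_continuous_image continuous_intros) simp
    then have C: "closed C" by (rule compact_imp_closed)
    have Cne: "C \<noteq> {}" unfolding C_def using True ab by auto
    have in_C: "cis (2 * pi * t) \<in> C \<longleftrightarrow> t \<notin> {a'<..<b'}" if t: "t \<in> {0..1}" for t
    proof
      assume "cis (2 * pi * t) \<in> C"
      then obtain s where s: "s \<in> {b'..a'+1}" "cis (2 * pi * t) = cis (2 * pi * s)" by (auto simp: C_def)
      then have "cos (2 * pi * t) = cos (2 * pi * s)" "sin (2 * pi * t) = sin (2 * pi * s)"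
        by (metis cis.sel)+
      then have "sin (2 * pi * t) = sin (2 * pi * s) \<and> cos (2 * pi * t) = cos (2 * pi * s)" by simp
      then obtain k :: int where k: "2 * pi * t = 2 * pi * s + 2 * pi * k"
        using sin_cos_eq_iff by blast
      then have "2 * pi * t = 2 * pi * (s + k)" by (simp add: algebra_simps)
      then have k': "t = s + k" by simp
      show "t \<notin> {a'<..<b'}"
      proof
        assume "t \<in> {a'<..<b'}"
        then have "real_of_int (- 1) < real_of_int k" "real_of_int k < real_of_int 0" using k' s by auto
        then have "- 1 < k" "k < 0" by (simp_all only: of_int_less_iff)
        then show False by simp
      qed
    next
      assume "t \<notin> {a'<..<b'}"
      then consider "b' \<le> t" | "t \<le> a'" by force
      then show "cis (2 * pi * t) \<in> C"
      proof cases
        case 1 then show ?thesis using t ab unfolding C_def by auto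
      next
        case 2
        have "cis (2 * pi * t) = cis (2 * pi * (t + 1))"
          by (simp add: ring_distribs cis_mult[symmetric])
        moreover have "t + 1 \<in> {b'..a'+1}" using 2 t ab by auto
        ultimately show ?thesis unfolding C_def by blast
      qed
    qed
    have "approximable (\<lambda>t. 1 + (-1) * indicator C (cis (2 * pi * t)))"
      by (intro approximable_add approximable_scale approximable_circle_closed C Cne
          approximable_trig_poly[OF trig_poly_const])
    moreover have "AE t in unit_leb. indicator {a<..<b} t = 1 + (-1) * (indicator C (cis (2 * pi * t)) :: real)"
    proof -
      have "AE t in unit_leb. t \<in> {0..1}" by (rule AE_I2) simp
      then show ?thesis
        using AE_unit_leb_neq[of 0] AE_unit_leb_neq[of 1]
      proof eventually_elim
        fix t :: real assume t: "t \<in> {0..1}" "t \<noteq> 0" "t \<noteq> 1"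
        have "t \<in> {a<..<b} \<longleftrightarrow> t \<in> {a'<..<b'}" using t by (auto simp: a'_def b'_def)
        then show "indicator {a<..<b} t = 1 + (-1) * (indicator C (cis (2 * pi * t)) :: real)"
          using in_C[OF t(1)] by (auto simp: indicator_def)
      qed
    qed
    ultimately show ?thesis by (rule approximable_AE_cong[OF _ ind_m, where B = 1]) (auto simp: indicator_def)
  qed
qed

text \<open>Open intervals are an intersection-stable generator, and the class is closed under complements
  and disjoint unions.\<close>

lemma approximable_borel:
  assumes "A \<in> sets borel" shows "approximable (indicator A)"
proof -
  let ?G = "range (\<lambda>(a, b). {a<..<b::real})"
  have borel_eq: "borel = sigma UNIV ?G"
    using borel_eq_box[where 'a = real] by (simp add: box_real)
  have A: "A \<in> sigma_sets UNIV ?G"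
    using assms by (subst (asm) borel_eq) (simp add: sets_measure_of)
  have int: "Int_stable ?G"
  proof (rule Int_stableI)
    fix A B assume "A \<in> ?G" "B \<in> ?G"
    then obtain a b c d where "A = {a<..<b}" "B = {c<..<d}" by auto
    then have "A \<inter> B = (\<lambda>(a, b). {a<..<b}) (max a c, min b d)" by auto
    then show "A \<inter> B \<in> ?G" by blast
  qed
  have m: "indicator A \<in> borel_measurable unit_leb" if "A \<in> sigma_sets UNIV ?G" for A
  proof -
    have "A \<in> sets borel" using that by (subst borel_eq) (simp add: sets_measure_of)
    then show ?thesis by (intro borel_measurable_unit_leb) simp
  qed
  have sub: "?G \<subseteq> Pow UNIV" by simp
  from int sub A show ?thesis
  proof (induction rule: sigma_sets_induct_disjoint)
    case (basic A) then show ?case using approximable_interval by auto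
  next
    case empty show ?case using approximable_trig_poly[OF trig_poly_const[of 0]] by (simp add: indicator_def[abs_def])
  next
    case (compl A)
    have "approximable (\<lambda>t. 1 + (-1) * indicator A t)"
      by (intro approximable_add approximable_scale compl approximable_trig_poly[OF trig_poly_const])
    moreover have "(\<lambda>t. 1 + (-1) * indicator A t) = (indicator (UNIV - A) :: real \<Rightarrow> real)"
      by (auto simp: fun_eq_iff indicator_def)
    ultimately show ?case by simp
  next
    case (union A)
    show ?case
    proof (rule approximable_dominated)
      show "approximable (\<lambda>t. \<Sum>i<n. indicator (A i) t)" for n
        using union by (intro approximable_sum) auto
      have fin: "(\<Sum>i<n. indicator (A i) t) = (indicator (\<Union>i<n. A i) t :: real)" for n t
        using union(1) by (intro indicator_UN_disjoint[symmetric]) (auto intro: disjoint_family_on_mono)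
      show "AE t in unit_leb. (\<lambda>n. \<Sum>i<n. indicator (A i) t) \<longlonglongrightarrow> (indicator (\<Union>i. A i) t :: real)"
        unfolding fin by (intro AE_I2 LIMSEQ_indicator_UN)
      show "indicator (\<Union>i. A i) \<in> borel_measurable unit_leb"
        using union by (intro m sigma_sets.Union) auto
      show "\<bar>\<Sum>i<n. indicator (A i) t\<bar> \<le> \<bar>1 :: real\<bar>" for n t
        unfolding fin by (auto simp: indicator_def)
    qed (auto simp: indicator_def)
  qed
qed

theorem trig_poly_dense:
  assumes f: "f \<in> L2_fun" shows "approximable f"
proof -
  note fm = L2_funD[OF f]
  obtain F where F: "\<And>i. simple_function unit_leb (F i)" "\<And>x. x \<in> space unit_leb \<Longrightarrow> (\<lambda>i. F i x) \<longlonglongrightarrow> f x"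
    "\<And>i x. x \<in> space unit_leb \<Longrightarrow> dist (F i x) 0 \<le> 2 * dist (f x) 0"
    using borel_measurable_implies_sequence_metric[OF fm, of 0] by metis
  show ?thesis
  proof (rule approximable_dominated[where h = "\<lambda>x. 2 * f x"])
    show "approximable (F i)" for i
    proof -
      let ?g = "\<lambda>t. \<Sum>y\<in>F i ` {0..1}. y * indicator (F i -` {y} \<inter> {0..1}) t"
      have fin: "finite (F i ` {0..1})" and s: "F i -` {y} \<inter> {0..1} \<in> sets unit_leb" for y
        using simple_functionD[OF F(1), of i] by auto
      have g: "approximable ?g"
        by (intro approximable_sum approximable_scale approximable_borel) (use s in \<open>auto simp: sets_unit_leb\<close>)
      have eq: "F i t = ?g t" if "t \<in> {0..1}" for t
      proof -
        have "F i t = (\<Sum>y\<in>F i ` space unit_leb. indicator (F i -` {y} \<inter> space unit_leb) t *\<^sub>R y)"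
          by (rule simple_function_indicator_representation_banach[OF F(1)]) (use that in simp)
        also have "\<dots> = ?g t" by (intro sum.cong) (auto simp: mult.commute)
        finally show ?thesis .
      qed
      have m: "F i \<in> borel_measurable unit_leb" using borel_measurable_simple_function[OF F(1)] .
      show ?thesis
      proof (rule approximable_AE_cong[OF g m])
        show "AE t in unit_leb. F i t = ?g t" by (rule AE_I2, rule eq) simp
        show "\<bar>F i x\<bar> \<le> (\<Sum>y\<in>F i ` {0..1}. \<bar>y\<bar>)" if "x \<in> {0..1}" for x
          by (rule member_le_sum[of "F i x" _ abs]) (use that fin in auto)
      qed
    qed
    show "AE t in unit_leb. (\<lambda>n. F n t) \<longlonglongrightarrow> f t" using F(2) by (intro AE_I2)
    show "(\<lambda>x. 2 * f x) \<in> L2_fun" by (rule L2_fun_scale[OF f])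
    show "\<bar>F n t\<bar> \<le> \<bar>2 * f t\<bar>" if "t \<in> {0..1}" for n t
      using F(3)[of t n] that by (simp add: abs_mult)
  qed (use fm in auto)
qed

section \<open>The class of intensities\<close>

text \<open>Among the trigonometric sums of a given degree the Fourier partial sum is closest, so density of
  the trigonometric polynomials becomes convergence of the Fourier series.\<close>

lemma tail_approx:
  assumes f: "f \<in> L2_fun" and e: "0 < e"
  obtains m where "k \<le> m" "sqn f - (\<Sum>j\<in>{- int m..int m}. (L2_inner f (trig_basis j))\<^sup>2) < e"
proof -
  obtain p where p: "trig_poly p" "sqn (\<lambda>t. f t - p t) < e"
    using trig_poly_dense[OF f] e by (auto simp: approximable_def)
  then obtain m c where mc: "p t = (\<Sum>j\<in>{- int m..int m}. c j * trig_basis j t)" for t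
    by (auto simp: trig_poly_def)
  define d where "d j = (if \<bar>j\<bar> \<le> int m then c j else 0)" for j
  have pd: "p = (\<lambda>t. \<Sum>j\<in>{- int (max m k)..int (max m k)}. d j * trig_basis j t)"
    using trig_sum_extend[of m "max m k" c] by (simp add: mc d_def fun_eq_iff)
  have "sqn (\<lambda>t. f t - p t) = sqn (\<lambda>t. p t - f t)"
    unfolding L2_inner_def by (intro Bochner_Integration.integral_cong) (auto simp: algebra_simps)
  then have "sqn f - (\<Sum>j\<in>{- int (max m k)..int (max m k)}. (L2_inner f (trig_basis j))\<^sup>2) < e"
    using p(2) sqn_diff_trig_sum[OF f, of "{- int (max m k)..int (max m k)}" d] sum_nonneg
    unfolding pd by (smt (verit) finite_atLeastAtMost_int sum_nonneg zero_le_power2)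
  then show ?thesis using that[of "max m k"] by simp
qed

lemma intensity_class_sum_le:
  assumes "lam \<in> intensity_class \<gamma> L" "finite J"
  shows "(\<Sum>j\<in>J. (\<gamma> j)\<^sup>2 * (L2_inner lam (trig_basis j))\<^sup>2) \<le> L\<^sup>2"
proof -
  have "(\<Sum>j\<in>J. (\<gamma> j)\<^sup>2 * (L2_inner lam (trig_basis j))\<^sup>2) \<le> (\<Sum>\<^sub>\<infinity>j. (\<gamma> j)\<^sup>2 * (L2_inner lam (trig_basis j))\<^sup>2)"
    using assms by (intro finite_sum_le_infsum) (auto simp: intensity_class_def)
  then show ?thesis using assms by (auto simp: intensity_class_def)
qed

locale weights =
  fixes \<gamma> :: "int \<Rightarrow> real" and L :: real
  assumes L_pos: "0 < L" and \<gamma>_pos: "\<And>j. 0 < \<gamma> j" and \<gamma>_sym: "\<And>j. \<gamma> (- j) = \<gamma> j"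
    and \<gamma>_zero: "\<gamma> 0 = 1" and \<gamma>_mono: "mono (\<lambda>m::nat. \<gamma> (int m))"
begin

lemma \<gamma>_abs: "\<gamma> j = \<gamma> (int (nat \<bar>j\<bar>))"
  using \<gamma>_sym[of j] by (cases "0 \<le> j") auto

lemma \<gamma>_le: "\<bar>i\<bar> \<le> \<bar>j\<bar> \<Longrightarrow> \<gamma> i \<le> \<gamma> j"
  using monoD[OF \<gamma>_mono, of "nat \<bar>i\<bar>" "nat \<bar>j\<bar>"] \<gamma>_abs[of i] \<gamma>_abs[of j] by (simp add: nat_le_eq_zle)

lemma \<gamma>_ge1: "1 \<le> \<gamma> j"
  using \<gamma>_le[of 0 j] \<gamma>_zero by simp

lemma class_L2: "lam \<in> intensity_class \<gamma> L \<Longrightarrow> lam \<in> L2_fun"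
  by (simp add: intensity_class_def)

text \<open>All weights are at least one, so Parseval's identity bounds the norm by the weighted sum.\<close>

lemma class_sqn_le:
  assumes lam: "lam \<in> intensity_class \<gamma> L" shows "sqn lam \<le> L\<^sup>2"
proof (rule field_le_epsilon)
  fix e :: real assume "0 < e"
  then obtain m where m: "sqn lam - (\<Sum>j\<in>{- int m..int m}. (L2_inner lam (trig_basis j))\<^sup>2) < e"
    using tail_approx[OF class_L2[OF lam]] by metis
  have "(\<Sum>j\<in>{- int m..int m}. (L2_inner lam (trig_basis j))\<^sup>2) \<le>
      (\<Sum>j\<in>{- int m..int m}. (\<gamma> j)\<^sup>2 * (L2_inner lam (trig_basis j))\<^sup>2)"
    using one_le_power[OF \<gamma>_ge1, of _ 2] by (intro sum_mono) (simp add: mult_le_cancel_right1)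
  also have "\<dots> \<le> L\<^sup>2" by (rule intensity_class_sum_le[OF lam]) simp
  finally show "sqn lam \<le> L\<^sup>2 + e" using m by simp
qed

lemma class_tail_le:
  assumes lam: "lam \<in> intensity_class \<gamma> L"
  shows "(\<gamma> (int (Suc k)))\<^sup>2 * (sqn lam - (\<Sum>j\<in>{- int k..int k}. (L2_inner lam (trig_basis j))\<^sup>2)) \<le> L\<^sup>2"
proof -
  let ?b = "\<lambda>j. (L2_inner lam (trig_basis j))\<^sup>2" and ?g = "(\<gamma> (int (Suc k)))\<^sup>2"
  have g: "0 < ?g" using \<gamma>_pos[of "int (Suc k)"] by simp
  have "sqn lam - (\<Sum>j\<in>{- int k..int k}. ?b j) \<le> L\<^sup>2 / ?g"
  proof (rule field_le_epsilon)
    fix e :: real assume "0 < e"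
    then obtain m where m: "k \<le> m" "sqn lam - (\<Sum>j\<in>{- int m..int m}. ?b j) < e"
      using tail_approx[OF class_L2[OF lam]] by metis
    let ?R = "{- int m..int m} - {- int k..int k}"
    have split: "(\<Sum>j\<in>{- int m..int m}. ?b j) = (\<Sum>j\<in>?R. ?b j) + (\<Sum>j\<in>{- int k..int k}. ?b j)"
      using m(1) by (intro sum.subset_diff) auto
    have "?g * (\<Sum>j\<in>?R. ?b j) = (\<Sum>j\<in>?R. ?g * ?b j)" by (simp add: sum_distrib_left)
    also have "\<dots> \<le> (\<Sum>j\<in>?R. (\<gamma> j)\<^sup>2 * ?b j)"
      using \<gamma>_pos by (intro sum_mono mult_right_mono power_mono \<gamma>_le) (auto simp: less_imp_le)
    also have "\<dots> \<le> L\<^sup>2" by (rule intensity_class_sum_le[OF lam]) simp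
    finally have "(\<Sum>j\<in>?R. ?b j) \<le> L\<^sup>2 / ?g" using g by (simp add: field_simps)
    then show "sqn lam - (\<Sum>j\<in>{- int k..int k}. ?b j) \<le> L\<^sup>2 / ?g + e" using m(2) split by linarith
  qed
  then show ?thesis using g by (simp add: field_simps)
qed

end

section \<open>Fourth moments of squared norms of sums\<close>

text \<open>Random variables with moments of all orders form an algebra. Every polynomial in the coordinates
  below is therefore integrable, and integrability never needs a separate estimate.\<close>

definition all_moments :: "'a measure \<Rightarrow> ('a \<Rightarrow> real) \<Rightarrow> bool" where
  "all_moments M f \<longleftrightarrow> f \<in> borel_measurable M \<and> (\<forall>p::nat. integrable M (\<lambda>w. \<bar>f w\<bar> ^ p))"

lemma all_moments_integrable: "all_moments M f \<Longrightarrow> integrable M f"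
proof -
  assume f: "all_moments M f"
  then have "integrable M (\<lambda>w. \<bar>f w\<bar> ^ 1)" unfolding all_moments_def by blast
  then have "integrable M (\<lambda>w. norm (f w))" by simp
  then show "integrable M f"
    using f by (auto simp: all_moments_def intro: integrable_norm_cancel)
qed

lemma (in finite_measure) all_moments_const [intro, simp]: "all_moments M (\<lambda>_. c)"
  by (simp add: all_moments_def)

lemma all_moments_add [intro]:
  assumes f: "all_moments M f" and g: "all_moments M g"
  shows "all_moments M (\<lambda>w. f w + g w)"
  unfolding all_moments_def
proof (intro conjI allI)
  have m [measurable]: "f \<in> borel_measurable M" "g \<in> borel_measurable M"
    using f g by (auto simp: all_moments_def)
  then show "(\<lambda>w. f w + g w) \<in> borel_measurable M" by measurable
  fix p :: nat
  have le: "\<bar>x + y\<bar> ^ p \<le> 2 ^ p * (\<bar>x\<bar> ^ p + \<bar>y\<bar> ^ p)" for x y :: real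
  proof -
    have "\<bar>x + y\<bar> ^ p \<le> (2 * max \<bar>x\<bar> \<bar>y\<bar>) ^ p"
      by (intro power_mono) (auto simp: max_def)
    also have "\<dots> = 2 ^ p * max \<bar>x\<bar> \<bar>y\<bar> ^ p" by (simp add: power_mult_distrib)
    also have "\<dots> \<le> 2 ^ p * (\<bar>x\<bar> ^ p + \<bar>y\<bar> ^ p)"
      by (intro mult_left_mono) (auto simp: max_def)
    finally show ?thesis .
  qed
  have i: "integrable M (\<lambda>w. 2 ^ p * (\<bar>f w\<bar> ^ p + \<bar>g w\<bar> ^ p))"
    using f g by (auto simp: all_moments_def)
  show "integrable M (\<lambda>w. \<bar>f w + g w\<bar> ^ p)"
  proof (rule Bochner_Integration.integrable_bound[OF i])
    show "AE w in M. norm (\<bar>f w + g w\<bar> ^ p) \<le> norm (2 ^ p * (\<bar>f w\<bar> ^ p + \<bar>g w\<bar> ^ p))"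
      using le by (intro AE_I2) (simp add: power_abs)
  qed measurable
qed

lemma all_moments_mult [intro]:
  assumes f: "all_moments M f" and g: "all_moments M g"
  shows "all_moments M (\<lambda>w. f w * g w)"
  unfolding all_moments_def
proof (intro conjI allI)
  have m [measurable]: "f \<in> borel_measurable M" "g \<in> borel_measurable M"
    using f g by (auto simp: all_moments_def)
  then show "(\<lambda>w. f w * g w) \<in> borel_measurable M" by measurable
  fix p :: nat
  have le: "\<bar>x * y\<bar> ^ p \<le> \<bar>x\<bar> ^ (2 * p) + \<bar>y\<bar> ^ (2 * p)" for x y :: real
  proof -
    have "\<bar>x * y\<bar> ^ p = \<bar>x\<bar> ^ p * \<bar>y\<bar> ^ p" by (simp add: abs_mult power_mult_distrib)
    also have "\<dots> \<le> (\<bar>x\<bar> ^ p)\<^sup>2 + (\<bar>y\<bar> ^ p)\<^sup>2"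
    proof -
      have "0 \<le> \<bar>x\<bar> ^ p * \<bar>y\<bar> ^ p" by simp
      then show ?thesis
        using sum_squares_bound[of "\<bar>x\<bar> ^ p" "\<bar>y\<bar> ^ p"] by linarith
    qed
    finally show ?thesis by (simp add: power_mult[symmetric] mult.commute)
  qed
  have i: "integrable M (\<lambda>w. \<bar>f w\<bar> ^ (2 * p) + \<bar>g w\<bar> ^ (2 * p))"
    using f g unfolding all_moments_def by (intro Bochner_Integration.integrable_add) blast+
  show "integrable M (\<lambda>w. \<bar>f w * g w\<bar> ^ p)"
  proof (rule Bochner_Integration.integrable_bound[OF i])
    show "AE w in M. norm (\<bar>f w * g w\<bar> ^ p) \<le> norm (\<bar>f w\<bar> ^ (2 * p) + \<bar>g w\<bar> ^ (2 * p))"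
      using le by (intro AE_I2) (simp add: power_abs)
  qed measurable
qed

lemma (in finite_measure) all_moments_power [intro]:
  assumes "all_moments M f" shows "all_moments M (\<lambda>w. f w ^ k)"
  by (induction k) (auto intro: assms)

lemma (in finite_measure) all_moments_diff [intro]:
  assumes "all_moments M f" "all_moments M g" shows "all_moments M (\<lambda>w. f w - g w)"
  using all_moments_add[OF assms(1) all_moments_mult[OF all_moments_const[of "-1"] assms(2)]] by simp

lemma (in finite_measure) all_moments_sum [intro]:
  assumes "\<And>j. j \<in> J \<Longrightarrow> all_moments M (f j)" shows "all_moments M (\<lambda>w. \<Sum>j\<in>J. f j w)"
  using assms by (induction J rule: infinite_finite_induct) auto

lemma all_moments_dominated:
  assumes g: "all_moments M g" and m [measurable]: "f \<in> borel_measurable M"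
    and le: "\<And>w. w \<in> space M \<Longrightarrow> \<bar>f w\<bar> \<le> g w"
  shows "all_moments M f"
  unfolding all_moments_def
proof (intro conjI allI m)
  fix p :: nat
  have "integrable M (\<lambda>w. \<bar>g w\<bar> ^ p)" using g by (simp add: all_moments_def)
  then show "integrable M (\<lambda>w. \<bar>f w\<bar> ^ p)"
  proof (rule Bochner_Integration.integrable_bound)
    show "AE w in M. norm (\<bar>f w\<bar> ^ p) \<le> norm (\<bar>g w\<bar> ^ p)"
    proof (rule AE_I2)
      fix w assume "w \<in> space M"
      then have "\<bar>f w\<bar> \<le> \<bar>g w\<bar>" using le[of w] by linarith
      then show "norm (\<bar>f w\<bar> ^ p) \<le> norm (\<bar>g w\<bar> ^ p)" by (simp add: power_mono)
    qed
  qed measurable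
qed

text \<open>Independent centred random vectors \<open>x (X i)\<close> indexed by \<open>J\<close>, with a common covariance matrix \<open>Sig\<close>.
  The squared Hilbert-Schmidt norm of \<open>Sig\<close> is of order \<open>D = card J\<close>, as for the identity matrix, and
  the squared norms of the vectors have moments as if all coordinates were of order one. For the
  deviation of the squared norm of the sum of \<open>n\<close> such vectors from its mean, a fourth moment of
  order \<open>n ^ 4 * D\<^sup>2 * sqrt D\<close> is derived as long as \<open>D \<le> 4 * n\<close>.\<close>

locale independent_vectors = prob_space M for M :: "'w measure" +
  fixes S :: "'c measure" and X :: "nat \<Rightarrow> 'w \<Rightarrow> 'c" and n :: nat
    and x :: "'j \<Rightarrow> 'c \<Rightarrow> real" and J :: "'j set" and Sig :: "'j \<Rightarrow> 'j \<Rightarrow> real" and b :: real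
  assumes indep: "indep_vars (\<lambda>_. S) X {..<n}"
    and finite_J: "finite J" and J_ne: "J \<noteq> {}" and n_pos: "0 < n"
    and x_meas: "\<And>j. j \<in> J \<Longrightarrow> x j \<in> borel_measurable S"
    and x_moments: "\<And>i j. i < n \<Longrightarrow> j \<in> J \<Longrightarrow> all_moments M (\<lambda>w. x j (X i w))"
    and centred: "\<And>i j. i < n \<Longrightarrow> j \<in> J \<Longrightarrow> expectation (\<lambda>w. x j (X i w)) = 0"
    and cov: "\<And>i j l. i < n \<Longrightarrow> j \<in> J \<Longrightarrow> l \<in> J \<Longrightarrow>
          expectation (\<lambda>w. x j (X i w) * x l (X i w)) = Sig j l"
    and Sig_bound: "(\<Sum>j\<in>J. \<Sum>l\<in>J. (Sig j l)\<^sup>2) \<le> b * real (card J)"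
    and norm_bound: "\<And>i p. i < n \<Longrightarrow> p \<le> 4 \<Longrightarrow>
          expectation (\<lambda>w. (\<Sum>j\<in>J. (x j (X i w))\<^sup>2) ^ p) \<le> b * real (card J) ^ p"
    and b_ge: "1 \<le> b" and card_J: "card J \<le> 4 * n"
begin

definition T :: "nat \<Rightarrow> (nat \<Rightarrow> 'c) \<Rightarrow> 'j \<Rightarrow> real" where "T i \<nu> j = (\<Sum>k<i. x j (\<nu> k))"
definition A :: "nat \<Rightarrow> (nat \<Rightarrow> 'c) \<Rightarrow> real" where "A i \<nu> = (\<Sum>j\<in>J. (T i \<nu> j)\<^sup>2)"
text \<open>The quadratic form of the covariance matrix at the partial sum \<open>T i\<close>: given the first \<open>i\<close> vectors, it
  is the variance of the inner product of \<open>T i\<close> with the next vector.\<close>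

definition F :: "nat \<Rightarrow> (nat \<Rightarrow> 'c) \<Rightarrow> real" where
  "F i \<nu> = (\<Sum>j\<in>J. \<Sum>l\<in>J. Sig j l * (T i \<nu> j * T i \<nu> l))"
text \<open>The mean of \<open>sq\<close>, the squared norm of a single vector; \<open>real i * v\<close> is the mean of the squared norm
  \<open>A i\<close> of \<open>T i\<close>, so that \<open>Q i\<close> is centred.\<close>

definition v :: real where "v = (\<Sum>j\<in>J. Sig j j)"
definition Q :: "nat \<Rightarrow> (nat \<Rightarrow> 'c) \<Rightarrow> real" where "Q i \<nu> = A i \<nu> - real i * v"
definition sq :: "'c \<Rightarrow> real" where "sq c = (\<Sum>j\<in>J. (x j c)\<^sup>2)"
definition ip :: "nat \<Rightarrow> (nat \<Rightarrow> 'c) \<Rightarrow> 'c \<Rightarrow> real" where "ip i \<nu> c = (\<Sum>j\<in>J. T i \<nu> j * x j c)"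
text \<open>The increment of \<open>Q\<close> when the value \<open>c\<close> is added to a partial sum. Its conditional mean given the past
  is zero, so \<open>Q\<close> is a martingale.\<close>

definition eta :: "nat \<Rightarrow> (nat \<Rightarrow> 'c) \<Rightarrow> 'c \<Rightarrow> real" where "eta i \<nu> c = 2 * ip i \<nu> c + (sq c - v)"

text \<open>Statistics of the first \<open>i\<close> observations and of observation \<open>i\<close>. They are functions on the sample
  space, and not random variables, so that independence can be used for each of their products; the
  middle condition says that only the first \<open>i\<close> observations enter.\<close>

definition past :: "nat \<Rightarrow> ((nat \<Rightarrow> 'c) \<Rightarrow> real) \<Rightarrow> bool" where
  "past i g \<longleftrightarrow> g \<in> borel_measurable (PiM {..<i} (\<lambda>_. S)) \<and> (\<forall>\<nu>. g (restrict \<nu> {..<i}) = g \<nu>) \<and>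
     all_moments M (\<lambda>w. g (\<lambda>k. X k w))"
definition present :: "nat \<Rightarrow> ('c \<Rightarrow> real) \<Rightarrow> bool" where
  "present i h \<longleftrightarrow> h \<in> borel_measurable S \<and> all_moments M (\<lambda>w. h (X i w))"

lemma past_const [intro, simp]: "past i (\<lambda>_. c)" by (auto simp: past_def)
lemma past_diff [intro]: "past i g \<Longrightarrow> past i h \<Longrightarrow> past i (\<lambda>\<nu>. g \<nu> - h \<nu>)" by (auto simp: past_def)
lemma past_mult [intro]: "past i g \<Longrightarrow> past i h \<Longrightarrow> past i (\<lambda>\<nu>. g \<nu> * h \<nu>)" by (auto simp: past_def)
lemma past_power [intro]: "past i g \<Longrightarrow> past i (\<lambda>\<nu>. g \<nu> ^ k)" by (auto simp: past_def)
lemma past_sum [intro]: "(\<And>j. j \<in> I \<Longrightarrow> past i (g j)) \<Longrightarrow> past i (\<lambda>\<nu>. \<Sum>j\<in>I. g j \<nu>)"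
  by (auto simp: past_def intro!: borel_measurable_sum)
lemma present_const [intro, simp]: "present i (\<lambda>_. c)" by (auto simp: present_def)
lemma present_diff [intro]: "present i g \<Longrightarrow> present i h \<Longrightarrow> present i (\<lambda>\<nu>. g \<nu> - h \<nu>)" by (auto simp: present_def)
lemma present_mult [intro]: "present i g \<Longrightarrow> present i h \<Longrightarrow> present i (\<lambda>\<nu>. g \<nu> * h \<nu>)" by (auto simp: present_def)
lemma present_power [intro]: "present i g \<Longrightarrow> present i (\<lambda>\<nu>. g \<nu> ^ k)" by (auto simp: present_def)
lemma present_sum [intro]: "(\<And>j. j \<in> I \<Longrightarrow> present i (g j)) \<Longrightarrow> present i (\<lambda>\<nu>. \<Sum>j\<in>I. g j \<nu>)"
  by (auto simp: present_def intro!: borel_measurable_sum)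
lemma present_x [intro]: "i < n \<Longrightarrow> j \<in> J \<Longrightarrow> present i (x j)"
  using x_meas x_moments by (auto simp: present_def)
lemma present_sq [intro]: "i < n \<Longrightarrow> present i sq"
  unfolding sq_def by (intro present_sum present_power present_x)

lemma past_T [intro]:
  assumes "i \<le> n" "j \<in> J" shows "past i (\<lambda>\<nu>. T i \<nu> j)"
proof -
  have "(\<lambda>\<nu>. x j (\<nu> k)) \<in> borel_measurable (PiM {..<i} (\<lambda>_. S))" if "k < i" for k
    using measurable_compose[OF measurable_component_singleton[of k "{..<i}" "\<lambda>_. S"] x_meas[of j]] that assms by auto
  moreover have "all_moments M (\<lambda>w. x j (X k w))" if "k < i" for k
    using x_moments that assms by auto
  ultimately show ?thesis
    by (auto simp: past_def T_def intro!: sum.cong borel_measurable_sum all_moments_sum)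
qed
lemma past_A [intro]: "i \<le> n \<Longrightarrow> past i (A i)"
  unfolding A_def by (intro past_sum past_power past_T)
lemma past_F [intro]: "i \<le> n \<Longrightarrow> past i (F i)"
  unfolding F_def by (intro past_sum past_mult past_const past_T)
lemma past_Q [intro]: "i \<le> n \<Longrightarrow> past i (Q i)"
  unfolding Q_def by (intro past_diff past_A past_const)

abbreviation (input) "Xs \<equiv> (\<lambda>w k. X k w)"

lemma past_am: "past i g \<Longrightarrow> all_moments M (\<lambda>w. g (Xs w))" by (simp add: past_def)
lemma present_am: "present i h \<Longrightarrow> all_moments M (\<lambda>w. h (X i w))" by (simp add: present_def)

lemma am_ip: "i < n \<Longrightarrow> all_moments M (\<lambda>w. ip i (Xs w) (X i w))"
  unfolding ip_def
  by (rule all_moments_sum, rule all_moments_mult[OF past_am[OF past_T] present_am[OF present_x]]) auto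

lemma expectation_past_present:
  assumes i: "i < n" and g: "past i g" and h: "present i h"
  shows "expectation (\<lambda>w. g (Xs w) * h (X i w)) = expectation (\<lambda>w. g (Xs w)) * expectation (\<lambda>w. h (X i w))"
proof -
  have iv: "indep_var (PiM {..<i} (\<lambda>_. S)) (\<lambda>w. restrict (\<lambda>k. X k w) {..<i})
      (PiM {i} (\<lambda>_. S)) (\<lambda>w. restrict (\<lambda>k. X k w) {i})"
    by (rule indep_var_restrict[OF indep]) (use i in auto)
  have "indep_var borel (g \<circ> (\<lambda>w. restrict (\<lambda>k. X k w) {..<i})) borel
      ((\<lambda>\<nu>. h (\<nu> i)) \<circ> (\<lambda>w. restrict (\<lambda>k. X k w) {i}))"
    by (rule indep_var_compose[OF iv])
      (use g h in \<open>auto simp: past_def present_def intro: measurable_compose[OF measurable_component_singleton]\<close>)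
  then have "indep_var borel (\<lambda>w. g (Xs w)) borel (\<lambda>w. h (X i w))"
    using g by (simp add: past_def comp_def)
  then show ?thesis
    by (rule indep_var_lebesgue_integral)
      (use past_am[OF g] present_am[OF h] in \<open>auto intro: all_moments_integrable\<close>)
qed

lemma expectation_ip:
  assumes i: "i < n" and g: "past i g"
  shows "expectation (\<lambda>w. g (Xs w) * ip i (Xs w) (X i w)) = 0"
proof -
  have "expectation (\<lambda>w. g (Xs w) * ip i (Xs w) (X i w)) =
      expectation (\<lambda>w. \<Sum>j\<in>J. (g (Xs w) * T i (Xs w) j) * x j (X i w))"
    by (simp add: ip_def sum_distrib_left mult_ac)
  also have "\<dots> = (\<Sum>j\<in>J. expectation (\<lambda>w. (g (Xs w) * T i (Xs w) j) * x j (X i w)))"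
  proof (rule Bochner_Integration.integral_sum)
    fix j assume "j \<in> J"
    then have p: "past i (\<lambda>\<nu>. g \<nu> * T i \<nu> j)" "present i (x j)"
      using past_mult[OF g past_T[of i j]] i present_x by auto
    show "integrable M (\<lambda>w. g (Xs w) * T i (Xs w) j * x j (X i w))"
      using all_moments_integrable[OF all_moments_mult[OF past_am[OF p(1)] present_am[OF p(2)]]] .
  qed
  also have "\<dots> = (\<Sum>j\<in>J. expectation (\<lambda>w. g (Xs w) * T i (Xs w) j) * expectation (\<lambda>w. x j (X i w)))"
    using expectation_past_present[OF i past_mult[OF g past_T] present_x[OF i]] i
    by (intro sum.cong refl) simp
  finally show ?thesis using centred i by simp
qed

lemma expectation_sum2:
  assumes "\<And>j l. j \<in> J \<Longrightarrow> l \<in> J \<Longrightarrow> integrable M (f j l)"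
  shows "expectation (\<lambda>w. \<Sum>j\<in>J. \<Sum>l\<in>J. f j l w) = (\<Sum>j\<in>J. \<Sum>l\<in>J. expectation (f j l))"
proof -
  have "expectation (\<lambda>w. \<Sum>j\<in>J. \<Sum>l\<in>J. f j l w) = (\<Sum>j\<in>J. expectation (\<lambda>w. \<Sum>l\<in>J. f j l w))"
    by (rule Bochner_Integration.integral_sum) (auto intro: Bochner_Integration.integrable_sum assms)
  also have "\<dots> = (\<Sum>j\<in>J. \<Sum>l\<in>J. expectation (f j l))"
    using assms by (intro sum.cong refl Bochner_Integration.integral_sum) auto
  finally show ?thesis .
qed

lemma expectation_ip2:
  assumes i: "i < n" and g: "past i g"
  shows "expectation (\<lambda>w. g (Xs w) * (ip i (Xs w) (X i w))\<^sup>2) = expectation (\<lambda>w. g (Xs w) * F i (Xs w))"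
proof -
  have p: "past i (\<lambda>\<nu>. g \<nu> * T i \<nu> j * T i \<nu> l)" "present i (\<lambda>c. x j c * x l c)" if "j \<in> J" "l \<in> J" for j l
    
    using past_mult[OF past_mult[OF g past_T[of i j]] past_T[of i l]] i that
      present_mult[OF present_x[of i j] present_x[of i l]] by auto
  have "expectation (\<lambda>w. g (Xs w) * (ip i (Xs w) (X i w))\<^sup>2) =
      expectation (\<lambda>w. \<Sum>j\<in>J. \<Sum>l\<in>J. (g (Xs w) * T i (Xs w) j * T i (Xs w) l) * (x j (X i w) * x l (X i w)))"
    by (simp add: ip_def power2_eq_square sum_product sum_distrib_left mult_ac)
  also have "\<dots> = (\<Sum>j\<in>J. \<Sum>l\<in>J. expectation (\<lambda>w. (g (Xs w) * T i (Xs w) j * T i (Xs w) l) * (x j (X i w) * x l (X i w))))"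
    using all_moments_integrable[OF all_moments_mult[OF past_am[OF p(1)] present_am[OF p(2)]]]
    by (rule expectation_sum2)
  also have "\<dots> = (\<Sum>j\<in>J. \<Sum>l\<in>J. expectation (\<lambda>w. g (Xs w) * T i (Xs w) j * T i (Xs w) l) * Sig j l)"
    using expectation_past_present[OF i p] cov[OF i] by (intro sum.cong refl) simp
  also have "\<dots> = (\<Sum>j\<in>J. \<Sum>l\<in>J. expectation (\<lambda>w. Sig j l * (g (Xs w) * T i (Xs w) j * T i (Xs w) l)))"
    by (simp add: mult.commute)
  also have "\<dots> = expectation (\<lambda>w. \<Sum>j\<in>J. \<Sum>l\<in>J. Sig j l * (g (Xs w) * T i (Xs w) j * T i (Xs w) l))"
    using all_moments_integrable[OF all_moments_mult[OF all_moments_const past_am[OF p(1)]]]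
    by (intro expectation_sum2[symmetric])
  also have "\<dots> = expectation (\<lambda>w. g (Xs w) * F i (Xs w))"
    by (simp add: F_def sum_distrib_left mult_ac)
  finally show ?thesis .
qed

abbreviation (input) "D \<equiv> real (card J)"

lemma D_ge: "1 \<le> D"
  using finite_J J_ne by (simp add: Suc_le_eq card_gt_0_iff)
lemma D_le: "D \<le> 4 * real n"
proof -
  have "real (card J) \<le> real (4 * n)" using card_J by (simp only: of_nat_le_iff)
  then show ?thesis by simp
qed
lemma n_ge: "1 \<le> real n" using n_pos by simp

lemma expectation_sq: "i < n \<Longrightarrow> expectation (\<lambda>w. sq (X i w)) = v"
  unfolding sq_def v_def
  by (subst Bochner_Integration.integral_sum)
    (auto simp: power2_eq_square cov intro!: sum.cong all_moments_integrable all_moments_mult x_moments)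

lemma expectation_sq_pow: "i < n \<Longrightarrow> p \<le> 4 \<Longrightarrow> expectation (\<lambda>w. sq (X i w) ^ p) \<le> b * D ^ p"
  unfolding sq_def using norm_bound by simp

lemma sq_nonneg: "0 \<le> sq c" by (simp add: sq_def sum_nonneg)
lemma A_nonneg: "0 \<le> A i \<nu>" by (simp add: A_def sum_nonneg)

lemma v_nonneg: "0 \<le> v"
  using expectation_sq[OF n_pos] Bochner_Integration.integral_nonneg[of M "\<lambda>w. sq (X 0 w)"] sq_nonneg by simp

lemma v_le: "v \<le> b * D"
  using expectation_sq[OF n_pos] expectation_sq_pow[OF n_pos, of 1] by simp

lemma A_Suc: "A (Suc i) \<nu> = A i \<nu> + 2 * ip i \<nu> (\<nu> i) + sq (\<nu> i)"
  by (simp add: A_def T_def ip_def sq_def power2_sum sum.distrib sum_distrib_left algebra_simps)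

lemma Q_Suc: "Q (Suc i) \<nu> = Q i \<nu> + eta i \<nu> (\<nu> i)"
  by (simp add: Q_def eta_def A_Suc algebra_simps)

lemma am_T: "i \<le> n \<Longrightarrow> j \<in> J \<Longrightarrow> all_moments M (\<lambda>w. T i (Xs w) j)"
  using past_am[OF past_T] .
lemma am_A: "i \<le> n \<Longrightarrow> all_moments M (\<lambda>w. A i (Xs w))" using past_am[OF past_A] .
lemma am_F: "i \<le> n \<Longrightarrow> all_moments M (\<lambda>w. F i (Xs w))" using past_am[OF past_F] .
lemma am_Q: "i \<le> n \<Longrightarrow> all_moments M (\<lambda>w. Q i (Xs w))" using past_am[OF past_Q] .
lemma am_sq: "i < n \<Longrightarrow> all_moments M (\<lambda>w. sq (X i w))" using present_am[OF present_sq] .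
lemma am_eta: "i < n \<Longrightarrow> all_moments M (\<lambda>w. eta i (Xs w) (X i w))"
  unfolding eta_def by (intro all_moments_add all_moments_mult all_moments_diff all_moments_const am_ip am_sq)

lemmas am_rules = all_moments_integrable all_moments_add all_moments_mult all_moments_power
  all_moments_diff all_moments_const am_A am_F am_Q am_sq am_ip am_eta

lemma expectation_TT:
  assumes "i \<le> n" "j \<in> J" "l \<in> J"
  shows "expectation (\<lambda>w. T i (Xs w) j * T i (Xs w) l) = real i * Sig j l"
  using assms
proof (induction i)
  case 0 then show ?case by (simp add: T_def)
next
  case (Suc i)
  have i: "i < n" "i \<le> n" using Suc by auto
  note jl = Suc.prems(2,3)
  have am: "all_moments M (\<lambda>w. T i (Xs w) j)" "all_moments M (\<lambda>w. T i (Xs w) l)"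
     "all_moments M (\<lambda>w. x j (X i w))" "all_moments M (\<lambda>w. x l (X i w))"
    using am_T[OF i(2)] x_moments[OF i(1)] jl by auto
  note int = all_moments_integrable[OF all_moments_mult]
  have "expectation (\<lambda>w. T (Suc i) (Xs w) j * T (Suc i) (Xs w) l) =
     expectation (\<lambda>w. (T i (Xs w) j * T i (Xs w) l + x j (X i w) * x l (X i w)) +
        (T i (Xs w) j * x l (X i w) + T i (Xs w) l * x j (X i w)))"
    by (simp add: T_def algebra_simps)
  also have "\<dots> = (real i * Sig j l + Sig j l) +
     (expectation (\<lambda>w. T i (Xs w) j * x l (X i w)) + expectation (\<lambda>w. T i (Xs w) l * x j (X i w)))"
    using Suc.IH jl i cov[OF i(1) jl]
    by (simp add: int[OF am(1,2)] int[OF am(3,4)] int[OF am(1,4)] int[OF am(2,3)])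
  also have "expectation (\<lambda>w. T i (Xs w) j * x l (X i w)) = 0"
    using expectation_past_present[OF i(1) past_T[OF i(2) jl(1)] present_x[OF i(1) jl(2)]] centred[OF i(1) jl(2)] by simp
  also have "expectation (\<lambda>w. T i (Xs w) l * x j (X i w)) = 0"
    using expectation_past_present[OF i(1) past_T[OF i(2) jl(2)] present_x[OF i(1) jl(1)]] centred[OF i(1) jl(1)] by simp
  finally show ?case by (simp add: algebra_simps)
qed

lemma expectation_A:
  assumes "i \<le> n" shows "expectation (\<lambda>w. A i (Xs w)) = real i * v"
  unfolding A_def v_def using assms expectation_TT[OF assms] am_T
  by (subst Bochner_Integration.integral_sum)
    (auto simp: power2_eq_square sum_distrib_left intro!: sum.cong all_moments_integrable all_moments_mult)

lemma expectation_F_le: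
  assumes "i \<le> n" shows "expectation (\<lambda>w. F i (Xs w)) \<le> real n * b * D"
proof -
  have "expectation (\<lambda>w. F i (Xs w)) = (\<Sum>j\<in>J. \<Sum>l\<in>J. expectation (\<lambda>w. Sig j l * (T i (Xs w) j * T i (Xs w) l)))"
    unfolding F_def using am_T[OF assms]
    by (intro expectation_sum2 all_moments_integrable all_moments_mult all_moments_const)
  also have "\<dots> = real i * (\<Sum>j\<in>J. \<Sum>l\<in>J. (Sig j l)\<^sup>2)"
    using expectation_TT[OF assms] by (simp add: sum_distrib_left power2_eq_square mult_ac)
  also have "\<dots> \<le> real n * (b * D)"
    using Sig_bound assms by (intro mult_mono sum_nonneg) auto
  finally show ?thesis by (simp add: mult_ac)
qed

lemma F_nonneg: assumes "i \<le> n" shows "0 \<le> F i \<nu>"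
proof -
  have "F i \<nu> = (\<Sum>j\<in>J. \<Sum>l\<in>J. expectation (\<lambda>w. (T i \<nu> j * T i \<nu> l) * (x j (X 0 w) * x l (X 0 w))))"
    unfolding F_def using cov[OF n_pos] by (intro sum.cong refl) simp
  also have "\<dots> = expectation (\<lambda>w. \<Sum>j\<in>J. \<Sum>l\<in>J. (T i \<nu> j * T i \<nu> l) * (x j (X 0 w) * x l (X 0 w)))"
    using x_moments[OF n_pos]
    by (intro expectation_sum2[symmetric] all_moments_integrable all_moments_mult all_moments_const)
  also have "\<dots> = expectation (\<lambda>w. (\<Sum>j\<in>J. T i \<nu> j * x j (X 0 w))\<^sup>2)"
    by (simp add: power2_eq_square sum_product mult_ac)
  finally show ?thesis by simp
qed

text \<open>The operator norm of the covariance matrix is at most its Hilbert-Schmidt norm.\<close>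

lemma F_sq_le: "(F i \<nu>)\<^sup>2 \<le> b * D * (A i \<nu>)\<^sup>2"
proof -
  have "F i \<nu> = (\<Sum>(j,l)\<in>J \<times> J. Sig j l * (T i \<nu> j * T i \<nu> l))"
    by (simp add: F_def sum.cartesian_product)
  then have "(F i \<nu>)\<^sup>2 \<le> (\<Sum>p\<in>J \<times> J. (case p of (j,l) \<Rightarrow> Sig j l)\<^sup>2) *
      (\<Sum>p\<in>J \<times> J. (case p of (j,l) \<Rightarrow> T i \<nu> j * T i \<nu> l)\<^sup>2)"
    using Cauchy_Schwarz_ineq_sum[of "\<lambda>p. case p of (j,l) \<Rightarrow> Sig j l"
      "\<lambda>p. case p of (j,l) \<Rightarrow> T i \<nu> j * T i \<nu> l" "J \<times> J"] by (simp add: case_prod_unfold)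
  also have "(\<Sum>p\<in>J \<times> J. (case p of (j,l) \<Rightarrow> Sig j l)\<^sup>2) = (\<Sum>j\<in>J. \<Sum>l\<in>J. (Sig j l)\<^sup>2)"
    by (simp add: sum.cartesian_product case_prod_unfold)
  also have "(\<Sum>p\<in>J \<times> J. (case p of (j,l) \<Rightarrow> T i \<nu> j * T i \<nu> l)\<^sup>2) = (A i \<nu>)\<^sup>2"
    unfolding A_def power2_eq_square[of "sum _ _"] sum_product
    by (simp add: sum.cartesian_product case_prod_unfold power_mult_distrib)
  also have "(\<Sum>j\<in>J. \<Sum>l\<in>J. (Sig j l)\<^sup>2) * (A i \<nu>)\<^sup>2 \<le> b * D * (A i \<nu>)\<^sup>2"
    using Sig_bound by (intro mult_right_mono) auto
  finally show ?thesis .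
qed

lemma F_le: assumes "i \<le> n" shows "F i \<nu> \<le> sqrt (b * D) * A i \<nu>"
proof -
  have "F i \<nu> \<le> sqrt (b * D * (A i \<nu>)\<^sup>2)" using F_sq_le by (rule real_le_rsqrt)
  then show ?thesis using A_nonneg by (simp add: real_sqrt_mult)
qed

lemma ip_sq_le: "(ip i \<nu> c)\<^sup>2 \<le> A i \<nu> * sq c"
  unfolding ip_def A_def sq_def by (rule Cauchy_Schwarz_ineq_sum)

lemma expectation_dev2:
  assumes i: "i < n" shows "expectation (\<lambda>w. (sq (X i w) - v)\<^sup>2) \<le> b * D\<^sup>2"
proof -
  have "expectation (\<lambda>w. (sq (X i w) - v)\<^sup>2) = expectation (\<lambda>w. (sq (X i w))\<^sup>2 - (2 * v * sq (X i w) - v\<^sup>2))"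
    by (simp add: power2_diff algebra_simps)
  also have "\<dots> = expectation (\<lambda>w. (sq (X i w))\<^sup>2) - (2 * v * expectation (\<lambda>w. sq (X i w)) - v\<^sup>2)"
    using am_sq[OF i] by (simp add: am_rules prob_space)
  also have "\<dots> \<le> expectation (\<lambda>w. (sq (X i w))\<^sup>2)"
    using expectation_sq[OF i] by (simp add: power2_eq_square)
  also have "\<dots> \<le> b * D\<^sup>2" using expectation_sq_pow[OF i, of 2] by simp
  finally show ?thesis .
qed

text \<open>The increments of \<open>Q\<close> are orthogonal, and each has a second moment of order \<open>n * D\<close>: the linear part
  contributes the mean of \<open>F\<close>, the quadratic part at most \<open>D\<^sup>2 \<le> 4 * n * D\<close>.\<close>

lemma expectation_Q2:
  assumes "i \<le> n" shows "expectation (\<lambda>w. (Q i (Xs w))\<^sup>2) \<le> real i * (16 * b * real n * D)"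
  using assms
proof (induction i)
  case 0 then show ?case by (simp add: Q_def A_def T_def)
next
  case (Suc i)
  have i: "i < n" "i \<le> n" using Suc by auto
  note am = am_Q[OF i(2)] am_eta[OF i(1)] am_ip[OF i(1)] am_sq[OF i(1)]
  have "expectation (\<lambda>w. Q i (Xs w) * eta i (Xs w) (X i w)) =
      2 * expectation (\<lambda>w. Q i (Xs w) * ip i (Xs w) (X i w)) + expectation (\<lambda>w. Q i (Xs w) * (sq (X i w) - v))"
    using am by (simp add: eta_def ring_distribs am_rules mult.left_commute[of _ 2])
  also have "\<dots> = 0"
    using expectation_ip[OF i(1) past_Q[OF i(2)]]
      expectation_past_present[OF i(1) past_Q[OF i(2)] present_diff[OF present_sq[OF i(1)] present_const[of i v]]]
      expectation_sq[OF i(1)] am(4) by (simp add: am_rules prob_space)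
  finally have cross: "expectation (\<lambda>w. Q i (Xs w) * eta i (Xs w) (X i w)) = 0" .
  have "expectation (\<lambda>w. (eta i (Xs w) (X i w))\<^sup>2) \<le>
      expectation (\<lambda>w. 8 * (ip i (Xs w) (X i w))\<^sup>2 + 2 * (sq (X i w) - v)\<^sup>2)"
  proof (rule integral_mono)
    fix w
    show "(eta i (Xs w) (X i w))\<^sup>2 \<le> 8 * (ip i (Xs w) (X i w))\<^sup>2 + 2 * (sq (X i w) - v)\<^sup>2"
      using sum_squares_bound[of "2 * ip i (Xs w) (X i w)" "sq (X i w) - v"]
      by (simp add: eta_def power2_eq_square algebra_simps)
  qed (intro am_rules am)+
  also have "\<dots> = 8 * expectation (\<lambda>w. (ip i (Xs w) (X i w))\<^sup>2) + 2 * expectation (\<lambda>w. (sq (X i w) - v)\<^sup>2)"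
    using am by (simp add: am_rules)
  also have "expectation (\<lambda>w. (ip i (Xs w) (X i w))\<^sup>2) = expectation (\<lambda>w. F i (Xs w))"
    using expectation_ip2[OF i(1) past_const[of i 1]] by simp
  also have "8 * expectation (\<lambda>w. F i (Xs w)) + 2 * expectation (\<lambda>w. (sq (X i w) - v)\<^sup>2)
      \<le> 8 * (real n * b * D) + 2 * (b * D\<^sup>2)"
    using expectation_F_le[OF i(2)] expectation_dev2[OF i(1)] by linarith
  also have "\<dots> \<le> 16 * b * real n * D"
  proof -
    have "b * D * D \<le> b * D * (4 * real n)" using D_le D_ge b_ge by (intro mult_left_mono) auto
    then show ?thesis by (simp add: power2_eq_square mult_ac)
  qed
  finally have eta: "expectation (\<lambda>w. (eta i (Xs w) (X i w))\<^sup>2) \<le> 16 * b * real n * D" .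
  have "expectation (\<lambda>w. (Q (Suc i) (Xs w))\<^sup>2) =
      expectation (\<lambda>w. (Q i (Xs w))\<^sup>2 + 2 * (Q i (Xs w) * eta i (Xs w) (X i w)) + (eta i (Xs w) (X i w))\<^sup>2)"
    by (simp add: Q_Suc power2_sum algebra_simps)
  also have "\<dots> = expectation (\<lambda>w. (Q i (Xs w))\<^sup>2) + expectation (\<lambda>w. (eta i (Xs w) (X i w))\<^sup>2)"
    using am cross by (simp add: am_rules)
  finally show ?case using Suc.IH i eta by (simp add: algebra_simps)
qed

lemma expectation_Q2_le:
  assumes "i \<le> n" shows "expectation (\<lambda>w. (Q i (Xs w))\<^sup>2) \<le> 16 * b * (real n)\<^sup>2 * D"
proof -
  have "real i * (16 * b * real n * D) \<le> real n * (16 * b * real n * D)"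
    using assms b_ge by (intro mult_right_mono) auto
  then show ?thesis using expectation_Q2[OF assms] by (simp add: power2_eq_square mult_ac)
qed

lemma expectation_A2:
  assumes "i \<le> n" shows "expectation (\<lambda>w. (A i (Xs w))\<^sup>2) \<le> 34 * b\<^sup>2 * (real n)\<^sup>2 * D\<^sup>2"
proof -
  have "expectation (\<lambda>w. (A i (Xs w))\<^sup>2) \<le> expectation (\<lambda>w. 2 * (Q i (Xs w))\<^sup>2 + 2 * (real i * v)\<^sup>2)"
  proof (rule integral_mono)
    fix w show "(A i (Xs w))\<^sup>2 \<le> 2 * (Q i (Xs w))\<^sup>2 + 2 * (real i * v)\<^sup>2"
      using sum_squares_bound[of "Q i (Xs w)" "real i * v"]
      by (simp add: Q_def power2_eq_square algebra_simps)
  qed (intro am_rules assms)+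
  also have "\<dots> = 2 * expectation (\<lambda>w. (Q i (Xs w))\<^sup>2) + 2 * (real i * v)\<^sup>2"
    using am_Q[OF assms] by (simp add: am_rules prob_space)
  also have "\<dots> \<le> 2 * (16 * b * (real n)\<^sup>2 * D) + 2 * (real n * (b * D))\<^sup>2"
    using expectation_Q2_le[OF assms] v_le v_nonneg assms
    by (intro add_mono mult_left_mono power_mono mult_mono) auto
  also have "\<dots> \<le> 2 * (16 * (b * b) * (real n)\<^sup>2 * (D * D)) + 2 * (real n * (b * D))\<^sup>2"
  proof -
    have "b * D \<le> (b * b) * (D * D)" using b_ge D_ge by (intro mult_mono) auto
    then have "16 * (real n)\<^sup>2 * (b * D) \<le> 16 * (real n)\<^sup>2 * ((b * b) * (D * D))" by (intro mult_left_mono) auto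
    then show ?thesis by (simp add: mult_ac)
  qed
  also have "\<dots> = 34 * b\<^sup>2 * (real n)\<^sup>2 * D\<^sup>2" by (simp add: power2_eq_square algebra_simps)
  finally show ?thesis .
qed

lemma sqrt_bD: "sqrt (b * D) \<le> b * sqrt D" "0 < sqrt (b * D)" "1 \<le> sqrt D" "sqrt D \<le> D"
proof -
  have "b * 1 \<le> b * b" using b_ge by (intro mult_left_mono) auto
  then have "sqrt b \<le> b" using b_ge by (intro real_le_lsqrt) (auto simp: power2_eq_square)
  then show "sqrt (b * D) \<le> b * sqrt D" by (simp add: real_sqrt_mult mult_right_mono)
  show "0 < sqrt (b * D)" using b_ge D_ge by simp
  show "1 \<le> sqrt D" using D_ge by simp
  have "D \<le> D * D" using D_ge by simp
  then show "sqrt D \<le> D" using D_ge by (intro real_le_lsqrt) (auto simp: power2_eq_square)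
qed

text \<open>The bound \<open>F \<le> sqrt (b * D) * A\<close> alone would lose a factor \<open>sqrt D\<close>. Instead \<open>A\<close> is split into its mean,
  for which the trace of the squared covariance matrix is available, and the fluctuation \<open>Q\<close>, which
  is smaller by a factor \<open>sqrt D\<close>. The parameter \<open>t\<close> balances the two parts of the product \<open>F * Q\<close>, so
  that half of the left-hand side can be absorbed.\<close>

lemma expectation_FA:
  assumes i: "i \<le> n" shows "expectation (\<lambda>w. F i (Xs w) * A i (Xs w)) \<le> 18 * b\<^sup>2 * (real n)\<^sup>2 * D\<^sup>2"
proof -
  define t where "t = sqrt (b * D)"
  have t: "0 < t" using sqrt_bD by (simp add: t_def)
  have "expectation (\<lambda>w. F i (Xs w) * A i (Xs w)) \<le>
      expectation (\<lambda>w. (1/2) * (F i (Xs w) * A i (Xs w)) + (t/2) * (Q i (Xs w))\<^sup>2 + real i * v * F i (Xs w))"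
  proof (rule integral_mono)
    fix w
    have "F i (Xs w) * A i (Xs w) = F i (Xs w) * Q i (Xs w) + real i * v * F i (Xs w)"
      by (simp add: Q_def algebra_simps)
    moreover have "F i (Xs w) * Q i (Xs w) \<le> (F i (Xs w))\<^sup>2 / (2 * t) + t / 2 * (Q i (Xs w))\<^sup>2"
      using sum_squares_bound[of "F i (Xs w)" "t * Q i (Xs w)"] t by (simp add: field_simps power2_eq_square)
    moreover have "(F i (Xs w))\<^sup>2 / (2 * t) \<le> (1/2) * (F i (Xs w) * A i (Xs w))"
    proof -
      have "F i (Xs w) * F i (Xs w) \<le> F i (Xs w) * (t * A i (Xs w))"
        using F_le[OF i] F_nonneg[OF i] unfolding t_def by (intro mult_left_mono) auto
      then show ?thesis using t by (simp add: field_simps power2_eq_square)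
    qed
    ultimately show "F i (Xs w) * A i (Xs w) \<le>
        (1/2) * (F i (Xs w) * A i (Xs w)) + (t/2) * (Q i (Xs w))\<^sup>2 + real i * v * F i (Xs w)" by linarith
  qed (intro am_rules i)+
  also have "\<dots> = (1/2) * expectation (\<lambda>w. F i (Xs w) * A i (Xs w)) + (t/2) * expectation (\<lambda>w. (Q i (Xs w))\<^sup>2)
      + real i * v * expectation (\<lambda>w. F i (Xs w))"
    using am_F[OF i] am_A[OF i] am_Q[OF i] by (simp add: am_rules)
  finally have "expectation (\<lambda>w. F i (Xs w) * A i (Xs w)) \<le>
      t * expectation (\<lambda>w. (Q i (Xs w))\<^sup>2) + 2 * (real i * v * expectation (\<lambda>w. F i (Xs w)))" by simp
  also have "\<dots> \<le> (b * D) * (16 * b * (real n)\<^sup>2 * D) + 2 * (real n * (b * D) * (real n * b * D))"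
  proof (intro add_mono mult_left_mono mult_mono)
    have "b * sqrt D \<le> b * D" using sqrt_bD(4) b_ge by (intro mult_left_mono) auto
    then show "t \<le> b * D" using sqrt_bD(1) unfolding t_def by linarith
  qed (use expectation_Q2_le[OF i] expectation_F_le[OF i] v_le v_nonneg i b_ge F_nonneg[OF i]
        in \<open>auto intro!: Bochner_Integration.integral_nonneg\<close>)
  also have "\<dots> = 18 * b\<^sup>2 * (real n)\<^sup>2 * D\<^sup>2" by (simp add: power2_eq_square algebra_simps)
  finally show ?thesis .
qed

lemma expectation_F2:
  assumes i: "i \<le> n" shows "expectation (\<lambda>w. (F i (Xs w))\<^sup>2) \<le> 18 * b ^ 3 * sqrt D * (real n)\<^sup>2 * D\<^sup>2"
proof -
  have "expectation (\<lambda>w. (F i (Xs w))\<^sup>2) \<le> expectation (\<lambda>w. (b * sqrt D) * (F i (Xs w) * A i (Xs w)))"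
  proof (rule integral_mono)
    fix w
    have "F i (Xs w) \<le> b * sqrt D * A i (Xs w)"
      using F_le[OF i, of "Xs w"] sqrt_bD(1) A_nonneg[of i "Xs w"] by (meson mult_right_mono order_trans)
    then have "F i (Xs w) * F i (Xs w) \<le> F i (Xs w) * (b * sqrt D * A i (Xs w))"
      using F_nonneg[OF i] by (intro mult_left_mono) auto
    then show "(F i (Xs w))\<^sup>2 \<le> (b * sqrt D) * (F i (Xs w) * A i (Xs w))" by (simp add: power2_eq_square mult_ac)
  qed (intro am_rules i)+
  also have "\<dots> = b * sqrt D * expectation (\<lambda>w. F i (Xs w) * A i (Xs w))"
    using am_F[OF i] am_A[OF i] by (simp add: am_rules)
  also have "\<dots> \<le> b * sqrt D * (18 * b\<^sup>2 * (real n)\<^sup>2 * D\<^sup>2)"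
    using expectation_FA[OF i] b_ge by (intro mult_left_mono) auto
  finally show ?thesis by (simp add: power2_eq_square power3_eq_cube mult_ac)
qed

text \<open>Two of the four factors are kept, because their conditional mean \<open>F\<close> is small, and the other two are
  bounded by the Cauchy-Schwarz inequality. The squared norm \<open>s\<close> of the new vector is replaced by
  \<open>t / 2 + s\<^sup>2 / (2 * t)\<close>; for \<open>t = D * sqrt D\<close> the contributions of the two terms have the same order.\<close>

lemma expectation_ip4:
  assumes i: "i < n"
  shows "expectation (\<lambda>w. (ip i (Xs w) (X i w)) ^ 4) \<le> 26 * b ^ 3 * sqrt D * (real n)\<^sup>2 * D ^ 3"
proof -
  have i': "i \<le> n" using i by simp
  define t where "t = sqrt D * D"
  have t: "0 < t" "t * t = D ^ 3" using D_ge by (auto simp: t_def power3_eq_cube)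
  have pA: "past i (A i)" using past_A i' .
  have pA2: "past i (\<lambda>\<nu>. (A i \<nu>)\<^sup>2)" using past_power pA .
  have ps3: "present i (\<lambda>c. sq c ^ 3)" using present_power present_sq i by blast
  have "expectation (\<lambda>w. (ip i (Xs w) (X i w)) ^ 4) \<le>
      expectation (\<lambda>w. t / 2 * (A i (Xs w) * (ip i (Xs w) (X i w))\<^sup>2) + 1 / (2 * t) * ((A i (Xs w))\<^sup>2 * sq (X i w) ^ 3))"
  proof (rule integral_mono)
    fix w
    define p a s where "p = (ip i (Xs w) (X i w))\<^sup>2" and "a = A i (Xs w)" and "s = sq (X i w)"
    have nn: "0 \<le> p" "0 \<le> a" "0 \<le> s" and le: "p \<le> a * s"
      using A_nonneg sq_nonneg ip_sq_le by (auto simp: p_def a_def s_def)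
    have "p * p \<le> p * (a * s)" using nn le by (intro mult_left_mono)
    also have "\<dots> = (p * a) * s" by simp
    also have "\<dots> \<le> (p * a) * (t / 2 + s\<^sup>2 / (2 * t))"
    proof (intro mult_left_mono)
      show "s \<le> t / 2 + s\<^sup>2 / (2 * t)"
        using sum_squares_bound[of s t] t by (simp add: field_simps power2_eq_square)
    qed (use nn in auto)
    also have "\<dots> = t / 2 * (a * p) + (p * (a * s\<^sup>2)) / (2 * t)" by (simp add: algebra_simps)
    also have "\<dots> \<le> t / 2 * (a * p) + ((a * s) * (a * s\<^sup>2)) / (2 * t)"
      using nn le t by (intro add_left_mono divide_right_mono mult_right_mono) auto
    finally show "(ip i (Xs w) (X i w)) ^ 4 \<le>
        t / 2 * (A i (Xs w) * (ip i (Xs w) (X i w))\<^sup>2) + 1 / (2 * t) * ((A i (Xs w))\<^sup>2 * sq (X i w) ^ 3)"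
      unfolding p_def[symmetric] a_def[symmetric] s_def[symmetric]
      by (simp add: p_def power2_eq_square power3_eq_cube power4_eq_xxxx mult_ac)
  qed (intro am_rules i i')+
  also have "\<dots> = t / 2 * expectation (\<lambda>w. A i (Xs w) * (ip i (Xs w) (X i w))\<^sup>2) +
      1 / (2 * t) * expectation (\<lambda>w. (A i (Xs w))\<^sup>2 * sq (X i w) ^ 3)"
    using am_A[OF i'] am_ip[OF i] am_sq[OF i] by (simp add: am_rules)
  also have "expectation (\<lambda>w. A i (Xs w) * (ip i (Xs w) (X i w))\<^sup>2) = expectation (\<lambda>w. F i (Xs w) * A i (Xs w))"
    using expectation_ip2[OF i pA] by (simp add: mult.commute)
  also have "expectation (\<lambda>w. (A i (Xs w))\<^sup>2 * sq (X i w) ^ 3) =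
      expectation (\<lambda>w. (A i (Xs w))\<^sup>2) * expectation (\<lambda>w. sq (X i w) ^ 3)"
    using expectation_past_present[OF i pA2 ps3] by simp
  also have "t / 2 * expectation (\<lambda>w. F i (Xs w) * A i (Xs w)) +
       1 / (2 * t) * (expectation (\<lambda>w. (A i (Xs w))\<^sup>2) * expectation (\<lambda>w. sq (X i w) ^ 3))
     \<le> t / 2 * (18 * b\<^sup>2 * (real n)\<^sup>2 * D\<^sup>2) + 1 / (2 * t) * ((34 * b\<^sup>2 * (real n)\<^sup>2 * D\<^sup>2) * (b * D ^ 3))"
    using expectation_FA[OF i'] expectation_A2[OF i'] expectation_sq_pow[OF i, of 3] t b_ge sq_nonneg
    by (intro add_mono mult_left_mono mult_mono) (auto intro!: Bochner_Integration.integral_nonneg)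
  also have "\<dots> = t * (9 * b\<^sup>2 * (real n)\<^sup>2 * D\<^sup>2) + t * (17 * b ^ 3 * (real n)\<^sup>2 * D\<^sup>2)"
    using t(1) unfolding t(2)[symmetric] by (simp add: field_simps power2_eq_square power3_eq_cube)
  also have "\<dots> \<le> t * (9 * b ^ 3 * (real n)\<^sup>2 * D\<^sup>2) + t * (17 * b ^ 3 * (real n)\<^sup>2 * D\<^sup>2)"
    using t(1) b_ge power_increasing[of 2 3 b] by (intro add_right_mono mult_left_mono mult_right_mono) auto
  also have "\<dots> = 26 * b ^ 3 * sqrt D * (real n)\<^sup>2 * D ^ 3"
    by (simp add: t_def power2_eq_square power3_eq_cube algebra_simps)
  finally show ?thesis .
qed

lemma expectation_eta4:
  assumes i: "i < n"
  shows "expectation (\<lambda>w. (eta i (Xs w) (X i w)) ^ 4) \<le> 13600 * b ^ 4 * sqrt D * (real n) ^ 3 * D\<^sup>2"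
proof -
  have le4: "(2 * p + (s - u)) ^ 4 \<le> 128 * p ^ 4 + 8 * (s ^ 4 + u ^ 4)" if "0 \<le> s" "0 \<le> u" for p s u :: real
  proof -
    have two: "(x + y) ^ 4 \<le> 8 * (x ^ 4 + y ^ 4)" for x y :: real
    proof -
      have "(x + y)\<^sup>2 \<le> 2 * (x\<^sup>2 + y\<^sup>2)" using sum_squares_bound[of x y] by (simp add: power2_sum)
      then have "((x + y)\<^sup>2)\<^sup>2 \<le> (2 * (x\<^sup>2 + y\<^sup>2))\<^sup>2" by (intro power_mono) auto
      also have "\<dots> \<le> 8 * ((x\<^sup>2)\<^sup>2 + (y\<^sup>2)\<^sup>2)"
        using sum_squares_bound[of "x\<^sup>2" "y\<^sup>2"] by (simp add: power2_sum power_mult_distrib)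
      finally show ?thesis by simp
    qed
    have "(s - u) ^ 4 \<le> s ^ 4 + u ^ 4"
    proof -
      have "\<bar>s - u\<bar> ^ 4 \<le> (max s u) ^ 4" using that by (intro power_mono) auto
      also have "\<dots> \<le> s ^ 4 + u ^ 4" by (auto simp: max_def)
      finally show ?thesis by (simp add: power_even_abs)
    qed
    then show ?thesis using two[of "2 * p" "s - u"] by (simp add: power_mult_distrib)
  qed
  have "expectation (\<lambda>w. (eta i (Xs w) (X i w)) ^ 4) \<le>
      expectation (\<lambda>w. 128 * (ip i (Xs w) (X i w)) ^ 4 + 8 * (sq (X i w) ^ 4 + v ^ 4))"
    unfolding eta_def
    by (rule integral_mono) (intro am_rules i | rule le4 sq_nonneg v_nonneg)+
  also have "\<dots> = 128 * expectation (\<lambda>w. (ip i (Xs w) (X i w)) ^ 4) + 8 * (expectation (\<lambda>w. sq (X i w) ^ 4) + v ^ 4)"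
    using am_ip[OF i] am_sq[OF i] by (simp add: am_rules prob_space)
  also have "\<dots> \<le> 128 * (26 * b ^ 3 * sqrt D * (real n)\<^sup>2 * D ^ 3) + 8 * (b * D ^ 4 + (b * D) ^ 4)"
    using expectation_ip4[OF i] expectation_sq_pow[OF i, of 4] v_le v_nonneg
    by (intro add_mono mult_left_mono power_mono) auto
  also have "\<dots> \<le> 128 * (26 * b ^ 4 * sqrt D * (real n)\<^sup>2 * (D\<^sup>2 * (4 * real n)))
      + 16 * (b ^ 4 * sqrt D * (D\<^sup>2 * (16 * (real n) ^ 3)))"
  proof (intro add_mono mult_left_mono)
    have "D ^ 3 \<le> D\<^sup>2 * (4 * real n)"
      using mult_left_mono[OF D_le, of "D\<^sup>2"] by (simp add: power2_eq_square power3_eq_cube)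
    then show "26 * b ^ 3 * sqrt D * (real n)\<^sup>2 * D ^ 3 \<le> 26 * b ^ 4 * sqrt D * (real n)\<^sup>2 * (D\<^sup>2 * (4 * real n))"
      using b_ge power_increasing[of 3 4 b] by (intro mult_mono) auto
    have "8 * (b * D ^ 4 + (b * D) ^ 4) \<le> 8 * (b ^ 4 * D ^ 4 + (b * D) ^ 4)"
      using b_ge power_increasing[of 1 4 b] by (intro mult_left_mono add_mono mult_right_mono) auto
    also have "\<dots> = 16 * (b ^ 4 * (D\<^sup>2 * D\<^sup>2))" by (simp add: power_mult_distrib flip: power_add)
    also have "\<dots> \<le> 16 * (b ^ 4 * (D\<^sup>2 * (4 * real n)\<^sup>2))"
      using D_le b_ge by (intro mult_left_mono power_mono) auto
    also have "\<dots> \<le> 16 * ((b ^ 4 * sqrt D) * (D\<^sup>2 * (16 * (real n) ^ 3)))"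
    proof (intro mult_left_mono mult_mono)
      show "b ^ 4 \<le> b ^ 4 * sqrt D" using sqrt_bD(3) b_ge by simp
      show "(4 * real n)\<^sup>2 \<le> 16 * real n ^ 3"
        using n_ge power_increasing[of 2 3 "real n"] by (simp add: power_mult_distrib)
    qed (use b_ge in auto)
    finally show "8 * (b * D ^ 4 + (b * D) ^ 4) \<le> 16 * (b ^ 4 * sqrt D * (D\<^sup>2 * (16 * real n ^ 3)))" .
  qed auto
  also have "\<dots> = 13568 * (b ^ 4 * sqrt D * (real n) ^ 3 * D\<^sup>2)"
    by (simp add: power2_eq_square power3_eq_cube)
  also have "\<dots> \<le> 13600 * (b ^ 4 * sqrt D * (real n) ^ 3 * D\<^sup>2)"
    using b_ge by (intro mult_right_mono) auto
  finally show ?thesis by (simp add: mult_ac)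
qed

text \<open>The weight \<open>32 * n\<close> in the arithmetic-geometric inequality makes the coefficient of the fourth
  moment of \<open>Q\<close> equal to \<open>1 / n\<close>; over \<open>n\<close> steps this costs only a constant factor.\<close>

lemma expectation_Q2_eta2:
  assumes i: "i < n"
  shows "8 * expectation (\<lambda>w. (Q i (Xs w))\<^sup>2 * (eta i (Xs w) (X i w))\<^sup>2) \<le>
     expectation (\<lambda>w. (Q i (Xs w)) ^ 4) / real n + 20000 * b ^ 4 * sqrt D * (real n) ^ 3 * D\<^sup>2"
proof -
  have i': "i \<le> n" using i by simp
  note am = am_Q[OF i'] am_F[OF i'] am_ip[OF i] am_sq[OF i]
  have p: "past i (\<lambda>\<nu>. (Q i \<nu>)\<^sup>2)" "present i (\<lambda>c. (sq c - v)\<^sup>2)"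
    using past_power[OF past_Q[OF i']] present_power[OF present_diff[OF present_sq[OF i] present_const]] by auto
  have "expectation (\<lambda>w. (Q i (Xs w))\<^sup>2 * (eta i (Xs w) (X i w))\<^sup>2) \<le>
     expectation (\<lambda>w. 8 * ((Q i (Xs w))\<^sup>2 * (ip i (Xs w) (X i w))\<^sup>2) + 2 * ((Q i (Xs w))\<^sup>2 * (sq (X i w) - v)\<^sup>2))"
  proof (rule integral_mono)
    fix w
    have "(eta i (Xs w) (X i w))\<^sup>2 \<le> 8 * (ip i (Xs w) (X i w))\<^sup>2 + 2 * (sq (X i w) - v)\<^sup>2"
      using sum_squares_bound[of "2 * ip i (Xs w) (X i w)" "sq (X i w) - v"]
      by (simp add: eta_def power2_eq_square algebra_simps)
    then have "(Q i (Xs w))\<^sup>2 * (eta i (Xs w) (X i w))\<^sup>2 \<le>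
        (Q i (Xs w))\<^sup>2 * (8 * (ip i (Xs w) (X i w))\<^sup>2 + 2 * (sq (X i w) - v)\<^sup>2)"
      by (rule mult_left_mono) simp
    then show "(Q i (Xs w))\<^sup>2 * (eta i (Xs w) (X i w))\<^sup>2 \<le>
        8 * ((Q i (Xs w))\<^sup>2 * (ip i (Xs w) (X i w))\<^sup>2) + 2 * ((Q i (Xs w))\<^sup>2 * (sq (X i w) - v)\<^sup>2)"
      by (simp add: ring_distribs mult.left_commute)
  qed (intro am_rules i i')+
  also have "\<dots> = 8 * expectation (\<lambda>w. (Q i (Xs w))\<^sup>2 * (ip i (Xs w) (X i w))\<^sup>2) +
      2 * expectation (\<lambda>w. (Q i (Xs w))\<^sup>2 * (sq (X i w) - v)\<^sup>2)"
    using am by (simp add: am_rules)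
  also have "expectation (\<lambda>w. (Q i (Xs w))\<^sup>2 * (ip i (Xs w) (X i w))\<^sup>2) = expectation (\<lambda>w. (Q i (Xs w))\<^sup>2 * F i (Xs w))"
    using expectation_ip2[OF i p(1)] by simp
  also have "expectation (\<lambda>w. (Q i (Xs w))\<^sup>2 * (sq (X i w) - v)\<^sup>2) =
      expectation (\<lambda>w. (Q i (Xs w))\<^sup>2) * expectation (\<lambda>w. (sq (X i w) - v)\<^sup>2)"
    using expectation_past_present[OF i p] by simp
  finally have one: "expectation (\<lambda>w. (Q i (Xs w))\<^sup>2 * (eta i (Xs w) (X i w))\<^sup>2) \<le>
     8 * expectation (\<lambda>w. (Q i (Xs w))\<^sup>2 * F i (Xs w)) +
     2 * (expectation (\<lambda>w. (Q i (Xs w))\<^sup>2) * expectation (\<lambda>w. (sq (X i w) - v)\<^sup>2))" .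
  have "64 * expectation (\<lambda>w. (Q i (Xs w))\<^sup>2 * F i (Xs w)) = expectation (\<lambda>w. 64 * ((Q i (Xs w))\<^sup>2 * F i (Xs w)))"
    by simp
  also have "\<dots> \<le> expectation (\<lambda>w. 1 / real n * (Q i (Xs w)) ^ 4 + 1024 * real n * (F i (Xs w))\<^sup>2)"
  proof (rule integral_mono)
    fix w
    show "64 * ((Q i (Xs w))\<^sup>2 * F i (Xs w)) \<le> 1 / real n * (Q i (Xs w)) ^ 4 + 1024 * real n * (F i (Xs w))\<^sup>2"
      using sum_squares_bound[of "(Q i (Xs w))\<^sup>2" "32 * real n * F i (Xs w)"] n_ge
      by (simp add: field_simps power2_eq_square power4_eq_xxxx)
  qed (intro am_rules i i')+
  also have "\<dots> = 1 / real n * expectation (\<lambda>w. (Q i (Xs w)) ^ 4) + 1024 * real n * expectation (\<lambda>w. (F i (Xs w))\<^sup>2)"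
    using am by (simp add: am_rules)
  finally have two: "64 * expectation (\<lambda>w. (Q i (Xs w))\<^sup>2 * F i (Xs w)) \<le>
     1 / real n * expectation (\<lambda>w. (Q i (Xs w)) ^ 4) + 1024 * real n * expectation (\<lambda>w. (F i (Xs w))\<^sup>2)" .
  define R where "R = b ^ 4 * sqrt D * (real n) ^ 3 * D\<^sup>2"
  have three: "real n * expectation (\<lambda>w. (F i (Xs w))\<^sup>2) \<le> 18 * R"
  proof -
    have "real n * expectation (\<lambda>w. (F i (Xs w))\<^sup>2) \<le> real n * (18 * b ^ 3 * sqrt D * (real n)\<^sup>2 * D\<^sup>2)"
      using expectation_F2[OF i'] by (intro mult_left_mono) auto
    also have "\<dots> = 18 * (b ^ 3 * (sqrt D * (real n) ^ 3 * D\<^sup>2))" by (simp add: power2_eq_square power3_eq_cube)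
    also have "\<dots> \<le> 18 * (b ^ 4 * (sqrt D * (real n) ^ 3 * D\<^sup>2))"
      using b_ge power_increasing[of 3 4 b] by (intro mult_left_mono mult_right_mono) auto
    finally show ?thesis by (simp add: R_def mult_ac)
  qed
  have four: "expectation (\<lambda>w. (Q i (Xs w))\<^sup>2) * expectation (\<lambda>w. (sq (X i w) - v)\<^sup>2) \<le> 64 * R"
  proof -
    have "expectation (\<lambda>w. (Q i (Xs w))\<^sup>2) * expectation (\<lambda>w. (sq (X i w) - v)\<^sup>2) \<le>
        (16 * b * (real n)\<^sup>2 * D) * (b * D\<^sup>2)"
      using expectation_Q2_le[OF i'] expectation_dev2[OF i] b_ge
      by (intro mult_mono) (auto intro!: Bochner_Integration.integral_nonneg)
    also have "\<dots> = 16 * (b\<^sup>2 * (real n)\<^sup>2 * D\<^sup>2 * D)" by (simp add: power2_eq_square)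
    also have "\<dots> \<le> 16 * ((b ^ 4 * sqrt D) * (real n)\<^sup>2 * D\<^sup>2 * (4 * real n))"
    proof (intro mult_left_mono mult_mono)
      have "b\<^sup>2 * 1 \<le> b ^ 4 * sqrt D"
        using b_ge power_increasing[of 2 4 b] sqrt_bD(3) by (intro mult_mono) auto
      then show "b\<^sup>2 \<le> b ^ 4 * sqrt D" by simp
    qed (use D_le b_ge in auto)
    also have "\<dots> = 64 * R" by (simp add: R_def power2_eq_square power3_eq_cube)
    finally show ?thesis .
  qed
  have "0 \<le> R" using b_ge by (simp add: R_def)
  then show ?thesis using one two three four unfolding mult.assoc R_def[symmetric]
    by (simp add: R_def[symmetric] mult.assoc[symmetric]) 
qed

text \<open>In the expansion of the fourth power, the cubic term in \<open>Q\<close> vanishes by the martingale property and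
  the term with the cube of the increment is split between its two neighbours.\<close>

lemma expectation_Q4_step:
  assumes i: "i < n"
  shows "expectation (\<lambda>w. (Q (Suc i) (Xs w)) ^ 4) \<le>
    (1 + 1 / real n) * expectation (\<lambda>w. (Q i (Xs w)) ^ 4) + 60800 * b ^ 4 * sqrt D * (real n) ^ 3 * D\<^sup>2"
proof -
  have i': "i \<le> n" using i by simp
  note am = am_Q[OF i'] am_ip[OF i] am_sq[OF i] am_eta[OF i]
  have p: "past i (\<lambda>\<nu>. (Q i \<nu>) ^ 3)" using past_power[OF past_Q[OF i']] .
  have "expectation (\<lambda>w. (Q i (Xs w)) ^ 3 * eta i (Xs w) (X i w)) =
      2 * expectation (\<lambda>w. (Q i (Xs w)) ^ 3 * ip i (Xs w) (X i w)) + expectation (\<lambda>w. (Q i (Xs w)) ^ 3 * (sq (X i w) - v))"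
    using am by (simp add: eta_def ring_distribs am_rules mult.left_commute[of _ 2])
  also have "\<dots> = 0"
    using expectation_ip[OF i p]
      expectation_past_present[OF i p present_diff[OF present_sq[OF i] present_const[of i v]]]
      expectation_sq[OF i] am(3) by (simp add: am_rules prob_space)
  finally have cross: "expectation (\<lambda>w. (Q i (Xs w)) ^ 3 * eta i (Xs w) (X i w)) = 0" .
  have "expectation (\<lambda>w. (Q (Suc i) (Xs w)) ^ 4) \<le>
     expectation (\<lambda>w. (Q i (Xs w)) ^ 4 + 4 * ((Q i (Xs w)) ^ 3 * eta i (Xs w) (X i w))
       + 8 * ((Q i (Xs w))\<^sup>2 * (eta i (Xs w) (X i w))\<^sup>2) + 3 * (eta i (Xs w) (X i w)) ^ 4)"
  proof (rule integral_mono)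
    fix w
    have "(q + h) ^ 4 \<le> q ^ 4 + 4 * (q ^ 3 * h) + 8 * (q\<^sup>2 * h\<^sup>2) + 3 * h ^ 4" for q h :: real
    proof -
      have "2 * ((q * h) * h\<^sup>2) \<le> (q * h)\<^sup>2 + (h\<^sup>2)\<^sup>2"
        using sum_squares_bound[of "q * h" "h\<^sup>2"] by (simp add: mult.assoc)
      then show ?thesis
        by (simp add: power2_eq_square power3_eq_cube power4_eq_xxxx algebra_simps)
    qed
    then show "(Q (Suc i) (Xs w)) ^ 4 \<le> (Q i (Xs w)) ^ 4 + 4 * ((Q i (Xs w)) ^ 3 * eta i (Xs w) (X i w))
       + 8 * ((Q i (Xs w))\<^sup>2 * (eta i (Xs w) (X i w))\<^sup>2) + 3 * (eta i (Xs w) (X i w)) ^ 4"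
      by (simp add: Q_Suc)
  qed (use i in \<open>intro am_rules; simp\<close>)+
  also have "\<dots> = expectation (\<lambda>w. (Q i (Xs w)) ^ 4) + 8 * expectation (\<lambda>w. (Q i (Xs w))\<^sup>2 * (eta i (Xs w) (X i w))\<^sup>2)
       + 3 * expectation (\<lambda>w. (eta i (Xs w) (X i w)) ^ 4)"
    using am cross by (simp add: am_rules)
  finally show ?thesis
    using expectation_eta4[OF i] expectation_Q2_eta2[OF i] by (simp add: ring_distribs)
qed

text \<open>Iterating the step \<open>n\<close> times multiplies the accumulated error by at most \<open>(1 + 1 / n) ^ n \<le> 3\<close>.\<close>

theorem expectation_Q4:
  "expectation (\<lambda>w. (Q n (Xs w)) ^ 4) \<le> 182400 * b ^ 4 * sqrt D * (real n) ^ 4 * D\<^sup>2"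
proof -
  define R where "R = 60800 * b ^ 4 * sqrt D * (real n) ^ 3 * D\<^sup>2"
  have R: "0 \<le> R" using b_ge by (simp add: R_def)
  define q where "q = 1 + 1 / real n"
  have q: "1 \<le> q" by (simp add: q_def)
  have ind: "expectation (\<lambda>w. (Q i (Xs w)) ^ 4) \<le> real i * (R * q ^ i)" if "i \<le> n" for i
    using that
  proof (induction i)
    case 0 then show ?case by (simp add: Q_def A_def T_def)
  next
    case (Suc i)
    then have i: "i < n" by simp
    have "expectation (\<lambda>w. (Q (Suc i) (Xs w)) ^ 4) \<le> q * expectation (\<lambda>w. (Q i (Xs w)) ^ 4) + R"
      using expectation_Q4_step[OF i] by (simp add: q_def R_def)
    also have "\<dots> \<le> q * (real i * (R * q ^ i)) + R * q ^ Suc i"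
      using Suc.IH i q R one_le_power[OF q, of "Suc i"] mult_left_mono[of 1 "q ^ Suc i" R]
      by (intro add_mono mult_left_mono) auto
    also have "\<dots> = real (Suc i) * (R * q ^ Suc i)" by (simp add: algebra_simps)
    finally show ?case .
  qed
  have "q ^ n \<le> exp (1 / real n) ^ n"
    unfolding q_def by (intro power_mono exp_ge_add_one_self) (simp add: add_nonneg_nonneg)
  also have "\<dots> = exp 1" using n_pos by (simp flip: exp_of_nat_mult)
  also have "\<dots> \<le> 3" by (rule exp_le)
  finally have "q ^ n \<le> 3" .
  then have "real n * (R * q ^ n) \<le> real n * (R * 3)" using R by (intro mult_left_mono) auto
  then show ?thesis using ind[of n]
    by (simp add: R_def power3_eq_cube power4_eq_xxxx mult_ac)
qed

end

section \<open>Point configurations\<close>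

lemma space_config_space [simp]: "space config_space = configs"
  unfolding config_space_def by (rule space_measure_of) auto

lemma emeasure_config_measurable [measurable]:
  assumes A: "A \<in> sets unit_leb" shows "(\<lambda>\<mu>. emeasure \<mu> A) \<in> borel_measurable config_space"
proof (rule measurableI)
  fix B :: "ennreal set" assume "B \<in> sets borel"
  then have "{\<mu> \<in> configs. emeasure \<mu> A \<in> B} \<in> sets config_space"
    using A unfolding config_space_def by (subst sets_measure_of) (auto intro!: sigma_sets.Basic)
  moreover have "(\<lambda>\<mu>. emeasure \<mu> A) -` B \<inter> space config_space = {\<mu> \<in> configs. emeasure \<mu> A \<in> B}" by auto
  ultimately show "(\<lambda>\<mu>. emeasure \<mu> A) -` B \<inter> space config_space \<in> sets config_space" by simp
qed simp

lemma measure_config_measurable [measurable]: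
  "A \<in> sets unit_leb \<Longrightarrow> (\<lambda>\<mu>. measure \<mu> A) \<in> borel_measurable config_space"
  unfolding measure_def by measurable

lemma config_sets: "\<mu> \<in> configs \<Longrightarrow> sets \<mu> = sets unit_leb"
  by (simp add: configs_def)

lemma config_space_eq: "\<mu> \<in> configs \<Longrightarrow> space \<mu> = {0..1}"
  using sets_eq_imp_space_eq[OF config_sets] by simp

lemma config_finite: assumes "\<mu> \<in> configs" shows "finite_measure \<mu>"
proof (rule finite_measureI)
  have "{0..1} \<in> sets unit_leb" using sets.top[of unit_leb] by simp
  then obtain k :: nat where "emeasure \<mu> {0..1} = of_nat k" using assms unfolding configs_def by blast
  then show "emeasure \<mu> (space \<mu>) \<noteq> \<infinity>" using assms by (simp add: config_space_eq)
qed

text \<open>The measure of a set under a configuration is a natural number; rounding down recovers it as an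
  element of \<open>nat\<close>.\<close>

definition points_in :: "real set \<Rightarrow> real measure \<Rightarrow> nat" where "points_in A \<mu> = nat \<lfloor>measure \<mu> A\<rfloor>"

lemma
  assumes "\<mu> \<in> configs" "A \<in> sets unit_leb"
  shows emeasure_count: "emeasure \<mu> A = of_nat (points_in A \<mu>)" and measure_count: "measure \<mu> A = real (points_in A \<mu>)"
proof -
  obtain k :: nat where k: "emeasure \<mu> A = of_nat k" using assms unfolding configs_def by blast
  then have "measure \<mu> A = real k" by (simp add: measure_def)
  with k show "emeasure \<mu> A = of_nat (points_in A \<mu>)" "measure \<mu> A = real (points_in A \<mu>)" by (simp_all add: points_in_def)
qed

lemma count_measurable [measurable]:
  "A \<in> sets unit_leb \<Longrightarrow> points_in A \<in> measurable config_space (count_space UNIV)"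
  unfolding points_in_def[abs_def] by measurable

lemma config_integrable:
  assumes \<mu>: "\<mu> \<in> configs" and f: "f \<in> borel_measurable unit_leb" "\<And>x. x \<in> {0..1} \<Longrightarrow> \<bar>f x\<bar> \<le> (B::real)"
  shows "integrable \<mu> f"
proof -
  interpret finite_measure \<mu> by (rule config_finite[OF \<mu>])
  have "f \<in> borel_measurable \<mu>" using f(1) config_sets[OF \<mu>] measurable_cong_sets by blast
  then show ?thesis
    by (intro integrable_const_bound[where B = B]) (use f(2) config_space_eq[OF \<mu>] in auto)
qed

lemma config_integral_bound:
  assumes \<mu>: "\<mu> \<in> configs" and f: "f \<in> borel_measurable unit_leb" "\<And>x. x \<in> {0..1} \<Longrightarrow> \<bar>f x\<bar> \<le> (B::real)"
  shows "\<bar>LINT t|\<mu>. f t\<bar> \<le> B * measure \<mu> {0..1}"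
proof -
  interpret finite_measure \<mu> by (rule config_finite[OF \<mu>])
  have i: "integrable \<mu> f" by (rule config_integrable[OF assms])
  have "\<bar>LINT t|\<mu>. f t\<bar> \<le> (LINT t|\<mu>. \<bar>f t\<bar>)" using integral_norm_bound[of \<mu> f] by simp
  also have "\<dots> \<le> (LINT t|\<mu>. B)"
    by (rule integral_mono) (use i f(2) config_space_eq[OF \<mu>] in auto)
  finally show ?thesis using config_space_eq[OF \<mu>] by (simp add: mult.commute)
qed

text \<open>The level sets are indexed by natural numbers because independence of the counts is stated for
  families of sets that are indexed in this way.\<close>

lemma simple_function_enumerate:
  fixes F :: "real \<Rightarrow> real"
  assumes F: "simple_function unit_leb F"
  obtains r :: nat and h A where "\<And>i. i < r \<Longrightarrow> A i \<in> sets unit_leb" "disjoint_family_on A {..<r}"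
    "\<And>t. t \<in> {0..1} \<Longrightarrow> F t = (\<Sum>i<r. h i * indicator (A i) t)"
    "\<And>t. t \<in> {0..1} \<Longrightarrow> (F t)\<^sup>2 = (\<Sum>i<r. (h i)\<^sup>2 * indicator (A i) t)"
proof -
  have fin: "finite (F ` {0..1})" using simple_functionD(1)[OF F] by simp
  obtain h where h: "bij_betw h {0..<card (F ` {0..1})} (F ` {0..1})"
    using ex_bij_betw_nat_finite[OF fin] by blast
  define r where "r = card (F ` {0..1})"
  define A where "A i = F -` {h i} \<inter> {0..1}" for i
  have h: "bij_betw h {..<r} (F ` {0..1})" using h by (simp add: r_def atLeast0LessThan)
  then have inj: "inj_on h {..<r}" by (rule bij_betw_imp_inj_on)
  have A: "A i \<in> sets unit_leb" for i using simple_functionD(2)[OF F, of "{h i}"] by (simp add: A_def)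
  have dis: "disjoint_family_on A {..<r}"
    using inj by (auto simp: disjoint_family_on_def A_def inj_on_def)
  have G: "g (F t) = (\<Sum>i<r. g (h i) * indicator (A i) t)" if t: "t \<in> {0..1}" for t and g :: "real \<Rightarrow> real"
  proof -
    obtain k where k: "k < r" "F t = h k" using h t unfolding bij_betw_def by (metis imageE image_eqI lessThan_iff)
    have "(\<Sum>i<r. g (h i) * indicator (A i) t) = (\<Sum>i<r. if i = k then g (h i) else 0)"
      using k t inj by (intro sum.cong) (auto simp: A_def indicator_def inj_on_def)
    then show ?thesis using k by simp
  qed
  from A dis G[of _ "\<lambda>y. y"] G[of _ "\<lambda>y. y\<^sup>2"] show ?thesis by (rule that) auto
qed

lemma config_integral_simple:
  assumes \<mu>: "\<mu> \<in> configs" and A: "\<And>i. i < r \<Longrightarrow> A i \<in> sets unit_leb"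
    and F: "\<And>t. t \<in> {0..1} \<Longrightarrow> F t = (\<Sum>i<(r::nat). h i * indicator (A i) t)"
  shows "(LINT t|\<mu>. F t) = (\<Sum>i<r. h i * measure \<mu> (A i))"
proof -
  interpret finite_measure \<mu> by (rule config_finite[OF \<mu>])
  have A': "A i \<in> sets \<mu>" if "i < r" for i using A[OF that] config_sets[OF \<mu>] by simp
  have "(LINT t|\<mu>. F t) = (LINT t|\<mu>. (\<Sum>i<r. h i * indicator (A i) t))"
    by (rule Bochner_Integration.integral_cong) (use F config_space_eq[OF \<mu>] in auto)
  also have "\<dots> = (\<Sum>i<r. (LINT t|\<mu>. h i * indicator (A i) t))"
    by (rule Bochner_Integration.integral_sum) (use A' in \<open>auto simp: emeasure_eq_measure\<close>)
  also have "\<dots> = (\<Sum>i<r. h i * measure \<mu> (A i))"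
    using A' sets.sets_into_space by (intro sum.cong) (auto simp: Int_absorb2)
  finally show ?thesis .
qed

lemma bounded_simple_sequence:
  assumes f: "f \<in> borel_measurable unit_leb" "\<And>x. x \<in> {0..1} \<Longrightarrow> \<bar>f x\<bar> \<le> (B::real)"
  obtains F where "\<And>i::nat. simple_function unit_leb (F i)" "\<And>x. x \<in> {0..1} \<Longrightarrow> (\<lambda>i. F i x) \<longlonglongrightarrow> f x"
    "\<And>i x. x \<in> {0..1} \<Longrightarrow> \<bar>F i x\<bar> \<le> 2 * B"
proof -
  obtain F where F: "\<And>i. simple_function unit_leb (F i)" "\<And>x. x \<in> space unit_leb \<Longrightarrow> (\<lambda>i. F i x) \<longlonglongrightarrow> f x"
    "\<And>i x. x \<in> space unit_leb \<Longrightarrow> dist (F i x) 0 \<le> 2 * dist (f x) 0"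
    using borel_measurable_implies_sequence_metric[OF f(1), of 0] by metis
  have "\<bar>F i x\<bar> \<le> 2 * B" if "x \<in> {0..1}" for i x using F(3)[of x i] f(2)[of x] that by simp
  then show ?thesis using F(1,2) by (intro that[of F]) auto
qed

lemma config_integral_limit:
  assumes \<mu>: "\<mu> \<in> configs" and f: "f \<in> borel_measurable unit_leb"
    and F: "\<And>i::nat. simple_function unit_leb (F i)" "\<And>x. x \<in> {0..1} \<Longrightarrow> (\<lambda>i. F i x) \<longlonglongrightarrow> f x"
    "\<And>i x. x \<in> {0..1} \<Longrightarrow> \<bar>F i x\<bar> \<le> (B::real)"
  shows "(\<lambda>i. LINT t|\<mu>. F i t) \<longlonglongrightarrow> (LINT t|\<mu>. f t)"
proof (rule integral_dominated_convergence[where w = "\<lambda>_. B"])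
  interpret finite_measure \<mu> by (rule config_finite[OF \<mu>])
  show "integrable \<mu> (\<lambda>_. B)" by simp
  show "f \<in> borel_measurable \<mu>" "\<And>i. F i \<in> borel_measurable \<mu>"
    using f borel_measurable_simple_function[OF F(1)] config_sets[OF \<mu>] measurable_cong_sets by blast+
qed (use F config_space_eq[OF \<mu>] in auto)

lemma config_integral_measurable:
  assumes f: "f \<in> borel_measurable unit_leb" "\<And>x. x \<in> {0..1} \<Longrightarrow> \<bar>f x\<bar> \<le> (B::real)"
  shows "(\<lambda>\<mu>. LINT t|\<mu>. f t) \<in> borel_measurable config_space"
proof -
  obtain F where F: "\<And>i::nat. simple_function unit_leb (F i)" "\<And>x. x \<in> {0..1} \<Longrightarrow> (\<lambda>i. F i x) \<longlonglongrightarrow> f x"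
    "\<And>i x. x \<in> {0..1} \<Longrightarrow> \<bar>F i x\<bar> \<le> 2 * B"
    using bounded_simple_sequence[OF f] by blast
  show ?thesis
  proof (rule borel_measurable_LIMSEQ_real)
    show "(\<lambda>i. LINT t|\<mu>. F i t) \<longlonglongrightarrow> (LINT t|\<mu>. f t)" if "\<mu> \<in> space config_space" for \<mu>
      using config_integral_limit[OF _ f(1) F] that by simp
    show "(\<lambda>\<mu>. LINT t|\<mu>. F i t) \<in> borel_measurable config_space" for i
    proof -
      obtain r h A where rhA: "\<And>i. i < r \<Longrightarrow> A i \<in> sets unit_leb" "disjoint_family_on A {..<r::nat}"
        "\<And>t. t \<in> {0..1} \<Longrightarrow> F i t = (\<Sum>i<r. h i * indicator (A i) t)"
        "\<And>t. t \<in> {0..1} \<Longrightarrow> (F i t)\<^sup>2 = (\<Sum>i<r. (h i)\<^sup>2 * indicator (A i) t)"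
        by (rule simple_function_enumerate[OF F(1)[of i]]) (rule that; assumption)
      have m: "(\<lambda>\<mu>. \<Sum>i<r. h i * measure \<mu> (A i)) \<in> borel_measurable config_space"
        using rhA(1) by (intro borel_measurable_sum borel_measurable_times measure_config_measurable) auto
      have eq: "(LINT t|\<mu>. F i t) = (\<Sum>i<r. h i * measure \<mu> (A i))" if "\<mu> \<in> space config_space" for \<mu>
        by (rule config_integral_simple) (use that rhA(1,3) in auto)
      show ?thesis by (rule iffD2[OF measurable_cong[OF eq] m])
    qed
  qed
qed

section \<open>Moments of a Poisson process\<close>

text \<open>A single term of the exponential series. Applied to the number of points, it derives all moments
  from one exponential moment.\<close>

lemma power_le_fact_exp: "0 \<le> x \<Longrightarrow> x ^ p \<le> fact p * exp (x::real)"
proof -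
  assume x: "0 \<le> x"
  have s: "(\<lambda>k. x ^ k /\<^sub>R fact k) sums exp x" by (rule exp_converges)
  have "(\<Sum>k\<in>{p}. x ^ k /\<^sub>R fact k) \<le> (\<Sum>k. x ^ k /\<^sub>R fact k)"
    by (rule sum_le_suminf) (use s x in \<open>auto simp: sums_iff\<close>)
  then show ?thesis using s by (simp add: sums_iff field_simps)
qed

lemma poisson_sums:
  fixes a :: real
  defines "p \<equiv> \<lambda>k. a ^ k / fact k * exp (- a)"
  shows "(\<lambda>k. exp (real k) * p k) sums exp (a * (exp 1 - 1))"
    "(\<lambda>k. real k * p k) sums a" "(\<lambda>k. (real k)\<^sup>2 * p k) sums (a + a\<^sup>2)"
proof -
  have base: "(\<lambda>k. c ^ k / fact k * exp (- a)) sums (exp c * exp (- a))" for c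
    using sums_mult2[OF exp_converges[of c], of "exp (-a)"] by (simp add: field_simps)
  have "(\<lambda>k. (exp 1 * a) ^ k / fact k * exp (- a)) sums (exp (exp 1 * a) * exp (- a))" by (rule base)
  moreover have "exp (exp 1 * a) * exp (- a) = exp (a * (exp 1 - 1))"
    by (simp add: exp_add[symmetric] algebra_simps)
  moreover have "(exp 1 * a) ^ k / fact k * exp (- a) = exp (real k) * p k" for k
    by (simp add: p_def power_mult_distrib exp_of_nat_mult[symmetric])
  ultimately show "(\<lambda>k. exp (real k) * p k) sums exp (a * (exp 1 - 1))" by simp
  have p: "p sums 1" using base[of a] by (simp add: p_def exp_minus field_simps)
  have Suc: "real (Suc k) * p (Suc k) = a * p k" for k
    by (simp add: p_def field_simps del: of_nat_Suc)
  have "(\<lambda>k. real (Suc k) * p (Suc k)) sums (a * 1)"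
    unfolding Suc by (intro sums_mult p)
  then show one: "(\<lambda>k. real k * p k) sums a" using sums_Suc_iff[of "\<lambda>k. real k * p k" a] by simp
  have "(\<lambda>k. a * (real k * p k) + a * p k) sums (a * a + a * 1)"
    by (intro sums_add sums_mult one p)
  moreover have "a * (real k * p k) + a * p k = (real (Suc k))\<^sup>2 * p (Suc k)" for k
  proof -
    have "(real (Suc k))\<^sup>2 * p (Suc k) = real (Suc k) * (a * p k)"
      unfolding Suc[symmetric] by (simp add: power2_eq_square)
    then show ?thesis by (simp add: algebra_simps)
  qed
  ultimately show "(\<lambda>k. (real k)\<^sup>2 * p k) sums (a + a\<^sup>2)"
    using sums_Suc_iff[of "\<lambda>k. (real k)\<^sup>2 * p k" "a + a\<^sup>2"] by (simp add: power2_eq_square add.commute)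
qed

locale poisson_point_process = prob_space M for M :: "'w measure" +
  fixes X :: "'w \<Rightarrow> real measure" and lam :: "real \<Rightarrow> real"
  assumes process: "poisson_process M X lam" and lam_L2: "lam \<in> L2_fun" and lam_nonneg: "AE x in unit_leb. 0 \<le> lam x"
begin

lemma X_measurable [measurable]: "X \<in> measurable M config_space"
  using process by (simp add: poisson_process_def)

lemma X_config: "w \<in> space M \<Longrightarrow> X w \<in> configs"
  using measurable_space[OF X_measurable] by simp

lemma lam_integrable: "integrable unit_leb lam"
  using L2_fun_mult_integrable[OF lam_L2 L2_fun_const[of 1]] by simp

lemma bounded_lam_integrable:
  assumes f: "f \<in> borel_measurable unit_leb" "\<And>x. x \<in> {0..1} \<Longrightarrow> \<bar>f x\<bar> \<le> (B::real)"
  shows "integrable unit_leb (\<lambda>x. f x * lam x)"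
  using L2_fun_mult_integrable[OF L2_fun_bounded[OF f] lam_L2] .

definition mean :: "real set \<Rightarrow> real" where "mean A = (LINT x:A|unit_leb. lam x)"

lemma mean_alt: "mean A = (LINT x|unit_leb. indicator A x * lam x)"
  by (simp add: mean_def set_lebesgue_integral_def)

lemma mean_nonneg: "0 \<le> mean A"
  unfolding mean_alt by (rule integral_nonneg_AE) (use lam_nonneg in \<open>auto simp: indicator_def\<close>)

lemma prob_count:
  assumes A: "A \<in> sets unit_leb"
  shows "prob {w \<in> space M. points_in A (X w) = k} = mean A ^ k / fact k * exp (- mean A)"
proof -
  have "{w \<in> space M. points_in A (X w) = k} = {w \<in> space M. emeasure (X w) A = of_nat k}"
    using emeasure_count[OF X_config A] by auto
  then show ?thesis using process A by (auto simp: poisson_process_def mean_def)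
qed

lemma expectation_count:
  assumes A: "A \<in> sets unit_leb" and g: "\<And>k. 0 \<le> g k"
    and s: "(\<lambda>k. g k * (mean A ^ k / fact k * exp (- mean A))) sums s"
  shows "integrable M (\<lambda>w. g (points_in A (X w)))" "expectation (\<lambda>w. g (points_in A (X w))) = s"
proof -
  let ?E = "\<lambda>k. {w \<in> space M. points_in A (X w) = k}"
  have cm [measurable]: "(\<lambda>w. points_in A (X w)) \<in> measurable M (count_space UNIV)"
    by (rule measurable_compose[OF X_measurable count_measurable[OF A]])
  have Em [measurable]: "?E k \<in> sets M" for k by measurable
  have "(\<integral>\<^sup>+w. ennreal (g (points_in A (X w))) \<partial>M) = (\<integral>\<^sup>+w. (\<Sum>k. ennreal (g k) * indicator (?E k) w) \<partial>M)"
  proof (rule nn_integral_cong)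
    fix w assume w: "w \<in> space M"
    have "(\<Sum>k. ennreal (g k) * indicator (?E k) w) = (\<Sum>k\<in>{points_in A (X w)}. ennreal (g k) * indicator (?E k) w)"
      by (rule suminf_finite) (auto simp: indicator_def)
    then show "ennreal (g (points_in A (X w))) = (\<Sum>k. ennreal (g k) * indicator (?E k) w)"
      using w by (simp add: indicator_def)
  qed
  also have "\<dots> = (\<Sum>k. \<integral>\<^sup>+w. ennreal (g k) * indicator (?E k) w \<partial>M)"
    by (rule nn_integral_suminf) measurable
  also have "\<dots> = (\<Sum>k. ennreal (g k * (mean A ^ k / fact k * exp (- mean A))))"
  proof (rule suminf_cong)
    fix k
    have "0 \<le> mean A ^ k / fact k * exp (- mean A)" using mean_nonneg by simp
    then show "(\<integral>\<^sup>+w. ennreal (g k) * indicator (?E k) w \<partial>M) = ennreal (g k * (mean A ^ k / fact k * exp (- mean A)))"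
      unfolding nn_integral_cmult_indicator[OF Em] emeasure_eq_measure prob_count[OF A]
      by (rule ennreal_mult[OF g, symmetric])
  qed
  also have "\<dots> = ennreal s"
    using s g mean_nonneg by (subst suminf_ennreal2) (auto simp: sums_iff)
  finally have nn: "(\<integral>\<^sup>+w. ennreal (g (points_in A (X w))) \<partial>M) = ennreal s" .
  show i: "integrable M (\<lambda>w. g (points_in A (X w)))"
    by (rule integrableI_nonneg) (use g nn in \<open>auto intro: measurable_compose[OF cm]\<close>)
  have "0 \<le> s" using s g mean_nonneg by (intro sums_le[OF _ sums_zero s]) auto
  then show "expectation (\<lambda>w. g (points_in A (X w))) = s"
    using nn_integral_eq_integral[OF i] g nn by (simp add: Bochner_Integration.integral_nonneg)
qed

lemma expectation_measure:
  assumes A: "A \<in> sets unit_leb"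
  shows "integrable M (\<lambda>w. exp (measure (X w) A))" "expectation (\<lambda>w. exp (measure (X w) A)) = exp (mean A * (exp 1 - 1))"
    "expectation (\<lambda>w. measure (X w) A) = mean A" "expectation (\<lambda>w. (measure (X w) A)\<^sup>2) = mean A + (mean A)\<^sup>2"
  using expectation_count[OF A _ poisson_sums(1)] expectation_count[OF A _ poisson_sums(2)]
    expectation_count[OF A _ poisson_sums(3)] measure_count[OF X_config A]
  by (simp_all cong: Bochner_Integration.integrable_cong Bochner_Integration.integral_cong)

lemma all_moments_measure:
  assumes A: "A \<in> sets unit_leb" shows "all_moments M (\<lambda>w. measure (X w) A)"
  unfolding all_moments_def
proof (intro conjI allI)
  show m: "(\<lambda>w. measure (X w) A) \<in> borel_measurable M"
    by (rule measurable_compose[OF X_measurable measure_config_measurable[OF A]])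
  fix p
  show "integrable M (\<lambda>w. \<bar>measure (X w) A\<bar> ^ p)"
  proof (rule Bochner_Integration.integrable_bound)
    show "integrable M (\<lambda>w. fact p * exp (measure (X w) A))" using expectation_measure(1)[OF A] by simp
  qed (use m power_le_fact_exp[of "measure _ A" p] in \<open>auto intro!: AE_I2\<close>)
qed

lemma indep_measure:
  assumes "finite I" "A ` I \<subseteq> sets unit_leb" "disjoint_family_on A (I :: nat set)"
  shows "indep_vars (\<lambda>_. borel) (\<lambda>i w. measure (X w) (A i)) I"
proof -
  have "indep_vars (\<lambda>_. borel) (\<lambda>i w. emeasure (X w) (A i)) I"
    using process assms by (auto simp: poisson_process_def)
  then have "indep_vars (\<lambda>_. borel) (\<lambda>i w. enn2real (emeasure (X w) (A i))) I"
    by (rule indep_vars_compose2) simp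
  then show ?thesis by (simp add: measure_def)
qed

text \<open>Campbell's formulas for step functions: counts of disjoint sets are uncorrelated, with variance equal to
  the mean.\<close>

lemma simple_moments:
  fixes A :: "nat \<Rightarrow> real set" and h :: "nat \<Rightarrow> real"
  assumes A: "\<And>i. i < r \<Longrightarrow> A i \<in> sets unit_leb" and dis: "disjoint_family_on A {..<r}"
  defines "Y \<equiv> \<lambda>w. \<Sum>i<r. h i * measure (X w) (A i)"
  shows "expectation Y = (\<Sum>i<r. h i * mean (A i))"
    "expectation (\<lambda>w. (Y w - (\<Sum>i<r. h i * mean (A i)))\<^sup>2) = (\<Sum>i<r. (h i)\<^sup>2 * mean (A i))"
proof -
  have am: "all_moments M (\<lambda>w. measure (X w) (A i))" if "i < r" for i
    using all_moments_measure[OF A[OF that]] .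
  have int: "integrable M (\<lambda>w. measure (X w) (A i))" if "i < r" for i
    using all_moments_integrable[OF am[OF that]] .
  show "expectation Y = (\<Sum>i<r. h i * mean (A i))"
    unfolding Y_def using int expectation_measure(3)[OF A] by (subst Bochner_Integration.integral_sum) auto
  let ?c = "\<lambda>i w. measure (X w) (A i) - mean (A i)"
  have amc: "all_moments M (?c i)" if "i < r" for i using am[OF that] by (intro all_moments_diff all_moments_const)
  have c2: "expectation (\<lambda>w. ?c i w * ?c j w) = (if i = j then mean (A i) else 0)" if ij: "i < r" "j < r" for i j
  proof (cases "i = j")
    case True
    have "expectation (\<lambda>w. ?c i w * ?c i w) =
        expectation (\<lambda>w. (measure (X w) (A i))\<^sup>2 - (2 * mean (A i) * measure (X w) (A i) - (mean (A i))\<^sup>2))"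
      by (simp add: power2_eq_square algebra_simps)
    also have "\<dots> = expectation (\<lambda>w. (measure (X w) (A i))\<^sup>2) - (2 * mean (A i) * expectation (\<lambda>w. measure (X w) (A i)) - (mean (A i))\<^sup>2)"
      using all_moments_integrable[OF all_moments_power[OF am[OF ij(1)], of 2]] int[OF ij(1)] by (simp add: prob_space)
    also have "\<dots> = mean (A i)"
      using expectation_measure(3,4)[OF A[OF ij(1)]] by (simp add: power2_eq_square)
    finally show ?thesis using True by simp
  next
    case False
    have "indep_vars (\<lambda>_. borel) (\<lambda>i w. measure (X w) (A i)) {..<r}"
      using A dis by (intro indep_measure) auto
    then have "indep_var (PiM {i} (\<lambda>_. borel)) (\<lambda>w. restrict (\<lambda>i. measure (X w) (A i)) {i})
        (PiM {j} (\<lambda>_. borel)) (\<lambda>w. restrict (\<lambda>i. measure (X w) (A i)) {j})"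
      by (rule indep_var_restrict) (use False ij in auto)
    then have "indep_var borel ((\<lambda>y. y i - mean (A i)) \<circ> (\<lambda>w. restrict (\<lambda>i. measure (X w) (A i)) {i}))
        borel ((\<lambda>y. y j - mean (A j)) \<circ> (\<lambda>w. restrict (\<lambda>i. measure (X w) (A i)) {j}))"
      by (rule indep_var_compose) (intro borel_measurable_diff measurable_component_singleton borel_measurable_const; simp)+
    then have "indep_var borel (?c i) borel (?c j)" by (simp add: comp_def)
    then have "expectation (\<lambda>w. ?c i w * ?c j w) = expectation (?c i) * expectation (?c j)"
      by (rule indep_var_lebesgue_integral) (use amc ij all_moments_integrable in auto)
    moreover have "expectation (?c i) = 0"
      using int[OF ij(1)] expectation_measure(3)[OF A[OF ij(1)]] by (simp add: prob_space)
    ultimately show ?thesis using False by simp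
  qed
  have "expectation (\<lambda>w. (Y w - (\<Sum>i<r. h i * mean (A i)))\<^sup>2) =
     expectation (\<lambda>w. \<Sum>i<r. \<Sum>j<r. (h i * h j) * (?c i w * ?c j w))"
    unfolding Y_def sum_subtractf[symmetric] power2_eq_square sum_product
    by (simp add: right_diff_distrib[symmetric] mult_ac)
  also have "\<dots> = (\<Sum>i<r. expectation (\<lambda>w. \<Sum>j<r. (h i * h j) * (?c i w * ?c j w)))"
    using amc by (intro Bochner_Integration.integral_sum Bochner_Integration.integrable_sum integrable_mult_right
       all_moments_integrable all_moments_mult) auto
  also have "\<dots> = (\<Sum>i<r. \<Sum>j<r. expectation (\<lambda>w. (h i * h j) * (?c i w * ?c j w)))"
    using amc by (intro sum.cong refl Bochner_Integration.integral_sum integrable_mult_right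
       all_moments_integrable all_moments_mult) auto
  also have "\<dots> = (\<Sum>i<r. \<Sum>j<r. if i = j then (h i * h j) * mean (A i) else 0)"
    using c2 by (intro sum.cong refl) auto
  also have "\<dots> = (\<Sum>i<r. (h i)\<^sup>2 * mean (A i))" by (simp add: power2_eq_square)
  finally show "expectation (\<lambda>w. (Y w - (\<Sum>i<r. h i * mean (A i)))\<^sup>2) = (\<Sum>i<r. (h i)\<^sup>2 * mean (A i))" .
qed

context
  fixes f :: "real \<Rightarrow> real" and B :: real
  assumes f: "f \<in> borel_measurable unit_leb" "\<And>x. x \<in> {0..1} \<Longrightarrow> \<bar>f x\<bar> \<le> B"
begin

lemma Y_measurable: "(\<lambda>w. LINT t|X w. f t) \<in> borel_measurable M"
  by (rule measurable_compose[OF X_measurable config_integral_measurable[OF f]])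

lemma unit_sets [simp]: "{0..1} \<in> sets unit_leb" by (simp add: sets_unit_leb)

lemma Y_all_moments: "all_moments M (\<lambda>w. LINT t|X w. f t)"
proof (rule all_moments_dominated)
  show "all_moments M (\<lambda>w. B * measure (X w) {0..1})"
    by (intro all_moments_mult all_moments_const all_moments_measure) simp
qed (use Y_measurable config_integral_bound[OF X_config f] in auto)

text \<open>Campbell's formulas pass from step functions to bounded functions by dominated convergence, where
  the dominating variable is a quadratic polynomial in the total number of points.\<close>

lemma
  shows expectation_Y: "expectation (\<lambda>w. LINT t|X w. f t) = L2_inner f lam"
    and variance_Y: "expectation (\<lambda>w. ((LINT t|X w. f t) - L2_inner f lam)\<^sup>2) = L2_inner (\<lambda>t. (f t)\<^sup>2) lam"
proof -
  obtain F where F: "\<And>i::nat. simple_function unit_leb (F i)" "\<And>x. x \<in> {0..1} \<Longrightarrow> (\<lambda>i. F i x) \<longlonglongrightarrow> f x"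
    "\<And>i x. x \<in> {0..1} \<Longrightarrow> \<bar>F i x\<bar> \<le> 2 * B"
    using bounded_simple_sequence[OF f] by blast
  have B: "0 \<le> B" using f(2)[of 0] by simp
  have Fm: "F i \<in> borel_measurable unit_leb" for i using borel_measurable_simple_function[OF F(1)] .
  let ?N = "\<lambda>w. measure (X w) {0..1}"
  have amN: "all_moments M ?N" by (rule all_moments_measure) simp
  have FY: "(\<lambda>i. LINT t|X w. F i t) \<longlonglongrightarrow> (LINT t|X w. f t)" if "w \<in> space M" for w
    using config_integral_limit[OF X_config[OF that] f(1) F] .
  have FYm: "(\<lambda>w. LINT t|X w. F i t) \<in> borel_measurable M" for i
    by (rule measurable_compose[OF X_measurable config_integral_measurable[OF Fm F(3)]])
  have FYb: "\<bar>LINT t|X w. F i t\<bar> \<le> 2 * B * ?N w" if "w \<in> space M" for w i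
    using config_integral_bound[OF X_config[OF that] Fm F(3)] .
  have Flim: "(\<lambda>i. L2_inner (F i) lam) \<longlonglongrightarrow> L2_inner f lam"
    unfolding L2_inner_def
  proof (rule integral_dominated_convergence[where w = "\<lambda>x. 2 * B * \<bar>lam x\<bar>"])
    show "AE x in unit_leb. (\<lambda>i. F i x * lam x) \<longlonglongrightarrow> f x * lam x"
      using F(2) by (intro AE_I2) (auto intro!: tendsto_intros)
    show "AE x in unit_leb. norm (F i x * lam x) \<le> 2 * B * \<bar>lam x\<bar>" for i
      using F(3) by (intro AE_I2) (auto simp: abs_mult intro!: mult_right_mono)
  qed (use lam_integrable f(1) Fm L2_funD[OF lam_L2] in auto)
  have F2lim: "(\<lambda>i. L2_inner (\<lambda>t. (F i t)\<^sup>2) lam) \<longlonglongrightarrow> L2_inner (\<lambda>t. (f t)\<^sup>2) lam"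
    unfolding L2_inner_def
  proof (rule integral_dominated_convergence[where w = "\<lambda>x. (2 * B)\<^sup>2 * \<bar>lam x\<bar>"])
    show "AE x in unit_leb. (\<lambda>i. (F i x)\<^sup>2 * lam x) \<longlonglongrightarrow> (f x)\<^sup>2 * lam x"
      using F(2) by (intro AE_I2) (auto intro!: tendsto_intros)
    show "AE x in unit_leb. norm ((F i x)\<^sup>2 * lam x) \<le> (2 * B)\<^sup>2 * \<bar>lam x\<bar>" for i
    proof (rule AE_I2)
      fix x assume "x \<in> space unit_leb"
      then have "\<bar>F i x\<bar>\<^sup>2 \<le> (2 * B)\<^sup>2" using F(3) by (intro power_mono) auto
      then show "norm ((F i x)\<^sup>2 * lam x) \<le> (2 * B)\<^sup>2 * \<bar>lam x\<bar>"
        by (simp add: abs_mult mult_right_mono)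
    qed
  qed (use lam_integrable f(1) Fm L2_funD[OF lam_L2] in auto)
  have simple: "expectation (\<lambda>w. LINT t|X w. F i t) = L2_inner (F i) lam \<and>
      expectation (\<lambda>w. ((LINT t|X w. F i t) - L2_inner (F i) lam)\<^sup>2) = L2_inner (\<lambda>t. (F i t)\<^sup>2) lam" for i
  proof -
    obtain r h A where A: "\<And>i. i < r \<Longrightarrow> A i \<in> sets unit_leb" "disjoint_family_on A {..<r::nat}"
      and F1: "\<And>t. t \<in> {0..1} \<Longrightarrow> F i t = (\<Sum>i<r. h i * indicator (A i) t)"
      and F2: "\<And>t. t \<in> {0..1} \<Longrightarrow> (F i t)\<^sup>2 = (\<Sum>i<r. (h i)\<^sup>2 * indicator (A i) t)"
      by (rule simple_function_enumerate[OF F(1)[of i]]) (rule that; assumption)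
    have lin: "L2_inner G lam = (\<Sum>i<r. c i * mean (A i))"
      if G: "\<And>t. t \<in> {0..1} \<Longrightarrow> G t = (\<Sum>i<r. c i * indicator (A i) t)" for G c
    proof -
      have "L2_inner G lam = (LINT t|unit_leb. (\<Sum>i<r. c i * (indicator (A i) t * lam t)))"
        unfolding L2_inner_def
      proof (rule Bochner_Integration.integral_cong[OF refl])
        fix t assume "t \<in> space unit_leb"
        then show "G t * lam t = (\<Sum>i<r. c i * (indicator (A i) t * lam t))"
          using G[of t] by (simp only: space_unit_leb sum_distrib_right mult.assoc)
      qed
      also have "\<dots> = (\<Sum>i<r. LINT t|unit_leb. c i * (indicator (A i) t * lam t))"
        using A(1) by (intro Bochner_Integration.integral_sum integrable_mult_right bounded_lam_integrable[where B = 1])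
           (auto simp: indicator_def)
      finally show ?thesis by (simp add: mean_alt)
    qed
    have Y: "(LINT t|X w. F i t) = (\<Sum>i<r. h i * measure (X w) (A i))" if "w \<in> space M" for w
      by (rule config_integral_simple[OF X_config[OF that] A(1) F1])
    have l1: "L2_inner (F i) lam = (\<Sum>i<r. h i * mean (A i))" by (rule lin) (rule F1)
    have l2: "L2_inner (\<lambda>t. (F i t)\<^sup>2) lam = (\<Sum>i<r. (h i)\<^sup>2 * mean (A i))" by (rule lin) (rule F2)
    show ?thesis
      unfolding l1 l2 using simple_moments[OF A, of h] Y by (simp cong: Bochner_Integration.integral_cong)
  qed
  have "(\<lambda>i. expectation (\<lambda>w. LINT t|X w. F i t)) \<longlonglongrightarrow> expectation (\<lambda>w. LINT t|X w. f t)"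
  proof (rule integral_dominated_convergence[where w = "\<lambda>w. 2 * B * ?N w"])
    show "integrable M (\<lambda>w. 2 * B * ?N w)" using all_moments_integrable[OF amN] by simp
  qed (use FY FYb FYm Y_measurable in auto)
  then show E: "expectation (\<lambda>w. LINT t|X w. f t) = L2_inner f lam"
    using Flim simple LIMSEQ_unique by auto
  define b where "b = 2 * B * (LINT x|unit_leb. \<bar>lam x\<bar>)"
  have Lb: "\<bar>L2_inner (F i) lam\<bar> \<le> b" for i
  proof -
    have "\<bar>L2_inner (F i) lam\<bar> \<le> (LINT x|unit_leb. \<bar>F i x * lam x\<bar>)"
      unfolding L2_inner_def using integral_norm_bound[of unit_leb "\<lambda>x. F i x * lam x"] by simp
    also have "\<dots> \<le> (LINT x|unit_leb. 2 * B * \<bar>lam x\<bar>)"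
    proof (rule integral_mono)
      show "integrable unit_leb (\<lambda>x. \<bar>F i x * lam x\<bar>)" using bounded_lam_integrable[OF Fm F(3)] by simp
    qed (use lam_integrable F(3) in \<open>auto simp: abs_mult intro!: mult_right_mono\<close>)
    finally show ?thesis by (simp add: b_def)
  qed
  have "(\<lambda>i. expectation (\<lambda>w. ((LINT t|X w. F i t) - L2_inner (F i) lam)\<^sup>2)) \<longlonglongrightarrow>
      expectation (\<lambda>w. ((LINT t|X w. f t) - L2_inner f lam)\<^sup>2)"
  proof (rule integral_dominated_convergence[where w = "\<lambda>w. (2 * B * ?N w + b)\<^sup>2"])
    show "integrable M (\<lambda>w. (2 * B * ?N w + b)\<^sup>2)"
      by (intro all_moments_integrable all_moments_power all_moments_add all_moments_mult all_moments_const amN)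
    show "AE w in M. (\<lambda>i. ((LINT t|X w. F i t) - L2_inner (F i) lam)\<^sup>2) \<longlonglongrightarrow> ((LINT t|X w. f t) - L2_inner f lam)\<^sup>2"
      using FY Flim by (intro AE_I2 tendsto_intros)
    show "AE w in M. norm (((LINT t|X w. F i t) - L2_inner (F i) lam)\<^sup>2) \<le> (2 * B * ?N w + b)\<^sup>2" for i
    proof (rule AE_I2)
      fix w assume "w \<in> space M"
      then have "\<bar>(LINT t|X w. F i t) - L2_inner (F i) lam\<bar> \<le> 2 * B * ?N w + b"
        using FYb[of w i] Lb[of i] by linarith
      then have "\<bar>(LINT t|X w. F i t) - L2_inner (F i) lam\<bar>\<^sup>2 \<le> (2 * B * ?N w + b)\<^sup>2"
        by (intro power_mono) auto
      then show "norm (((LINT t|X w. F i t) - L2_inner (F i) lam)\<^sup>2) \<le> (2 * B * ?N w + b)\<^sup>2" by simp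
    qed
  qed (use FYm Y_measurable in measurable)
  then show "expectation (\<lambda>w. ((LINT t|X w. f t) - L2_inner f lam)\<^sup>2) = L2_inner (\<lambda>t. (f t)\<^sup>2) lam"
    using F2lim simple LIMSEQ_unique by auto
qed

end

text \<open>Polarization of the variance formula.\<close>

lemma covariance_Y:
  assumes f: "f \<in> borel_measurable unit_leb" "\<And>x. x \<in> {0..1} \<Longrightarrow> \<bar>f x\<bar> \<le> (B::real)"
    and g: "g \<in> borel_measurable unit_leb" "\<And>x. x \<in> {0..1} \<Longrightarrow> \<bar>g x\<bar> \<le> B"
  shows "expectation (\<lambda>w. ((LINT t|X w. f t) - L2_inner f lam) * ((LINT t|X w. g t) - L2_inner g lam)) =
    L2_inner (\<lambda>t. f t * g t) lam"
proof -
  let ?U = "\<lambda>w. (LINT t|X w. f t) - L2_inner f lam" and ?V = "\<lambda>w. (LINT t|X w. g t) - L2_inner g lam"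
  let ?h = "\<lambda>t. f t + g t"
  have h: "?h \<in> borel_measurable unit_leb" "\<And>x. x \<in> {0..1} \<Longrightarrow> \<bar>?h x\<bar> \<le> 2 * B"
  proof -
    show "?h \<in> borel_measurable unit_leb" using f g by measurable
    show "\<bar>?h x\<bar> \<le> 2 * B" if "x \<in> {0..1}" for x
      using f(2)[OF that] g(2)[OF that] abs_triangle_ineq[of "f x" "g x"] by linarith
  qed
  have amU: "all_moments M ?U"
    by (intro all_moments_diff all_moments_const Y_all_moments[OF f])
  have amV: "all_moments M ?V"
    by (intro all_moments_diff all_moments_const Y_all_moments[OF g])
  have L: "f \<in> L2_fun" "g \<in> L2_fun" "(\<lambda>t. f t * f t) \<in> L2_fun" "(\<lambda>t. g t * g t) \<in> L2_fun" "(\<lambda>t. f t * g t) \<in> L2_fun"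
  proof -
    show "f \<in> L2_fun" "g \<in> L2_fun" using L2_fun_bounded f g by auto
    have *: "(\<lambda>t. p t * q t) \<in> L2_fun" if "p \<in> borel_measurable unit_leb" "\<And>x. x \<in> {0..1} \<Longrightarrow> \<bar>p x\<bar> \<le> B"
      "q \<in> borel_measurable unit_leb" "\<And>x. x \<in> {0..1} \<Longrightarrow> \<bar>q x\<bar> \<le> B" for p q
    proof (rule L2_fun_bounded)
      show "(\<lambda>t. p t * q t) \<in> borel_measurable unit_leb" using that by measurable
      show "\<bar>p x * q x\<bar> \<le> B * B" if "x \<in> {0..1}" for x
        unfolding abs_mult using \<open>\<And>x. x \<in> {0..1} \<Longrightarrow> \<bar>p x\<bar> \<le> B\<close>[OF that] \<open>\<And>x. x \<in> {0..1} \<Longrightarrow> \<bar>q x\<bar> \<le> B\<close>[OF that]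
        by (intro mult_mono) auto
    qed
    show "(\<lambda>t. f t * f t) \<in> L2_fun" "(\<lambda>t. g t * g t) \<in> L2_fun" "(\<lambda>t. f t * g t) \<in> L2_fun"
      using * f g by auto
  qed
  have sum: "(LINT t|X w. ?h t) - L2_inner ?h lam = ?U w + ?V w" if "w \<in> space M" for w
    using config_integrable[OF X_config[OF that] f] config_integrable[OF X_config[OF that] g]
    by (simp add: L2_inner_add[OF L(1,2) lam_L2])
  have "L2_inner (\<lambda>t. (?h t)\<^sup>2) lam = expectation (\<lambda>w. ((LINT t|X w. ?h t) - L2_inner ?h lam)\<^sup>2)"
    by (rule variance_Y[OF h, symmetric])
  also have "\<dots> = expectation (\<lambda>w. (?U w + ?V w)\<^sup>2)"
    by (intro Bochner_Integration.integral_cong refl) (simp only: sum)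
  also have "\<dots> = expectation (\<lambda>w. (?U w)\<^sup>2 + (2 * (?U w * ?V w) + (?V w)\<^sup>2))"
  proof -
    have "(u + v)\<^sup>2 = u\<^sup>2 + (2 * (u * v) + v\<^sup>2)" for u v :: real by (simp add: power2_sum)
    then show ?thesis by (simp only:)
  qed
  also have "\<dots> = expectation (\<lambda>w. (?U w)\<^sup>2) + (2 * expectation (\<lambda>w. ?U w * ?V w) + expectation (\<lambda>w. (?V w)\<^sup>2))"
    using all_moments_integrable[OF all_moments_power[OF amU, of 2]] all_moments_integrable[OF all_moments_mult[OF amU amV]]
      all_moments_integrable[OF all_moments_power[OF amV, of 2]] by simp
  also have "\<dots> = L2_inner (\<lambda>t. (f t)\<^sup>2) lam + (2 * expectation (\<lambda>w. ?U w * ?V w) + L2_inner (\<lambda>t. (g t)\<^sup>2) lam)"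
    using variance_Y[OF f] variance_Y[OF g] by simp
  finally have one: "L2_inner (\<lambda>t. (?h t)\<^sup>2) lam = \<dots>" .
  have "L2_inner (\<lambda>t. (?h t)\<^sup>2) lam = L2_inner (\<lambda>t. f t * f t + (2 * (f t * g t) + g t * g t)) lam"
    by (simp add: power2_eq_square algebra_simps)
  also have "\<dots> = L2_inner (\<lambda>t. f t * f t) lam + (2 * L2_inner (\<lambda>t. f t * g t) lam + L2_inner (\<lambda>t. g t * g t) lam)"
    using L lam_L2 by (simp add: L2_inner_add L2_fun_add L2_fun_scale L2_inner_scale)
  finally show ?thesis using one by (simp add: power2_eq_square)
qed

end

section \<open>Risk of the data-driven estimator\<close>

text \<open>The case of a selected dimension above the reference dimension: \<open>zm\<close>, \<open>pm\<close> and \<open>tm\<close> are noise, penalty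
  and squared bias there, \<open>pk\<close> and \<open>tk\<close> belong to the reference dimension, and \<open>excess\<close> is the part of the
  noise that the penalty does not cover. Twice the noise uses up only five sixths of the penalty, so
  the penalty at the selected dimension can be solved for.\<close>

lemma oracle_case:
  fixes excess pk tm zm pm tk :: real
  assumes "0 \<le> excess" "0 \<le> pk" "0 \<le> tm"
    and zm: "zm \<le> 5/12 * pm + excess"
    and tm_le: "tm \<le> tk" and inc: "pm - pk \<le> 2 * zm + 2 * tk"
  shows "zm + tm \<le> 6 * tk + 6 * pk + 6 * excess"
proof -
  have "pm - pk \<le> 5/6 * pm + 2 * excess + 2 * tk" using zm inc by linarith
  then have "pm \<le> 6 * pk + 12 * excess + 12 * tk" by simp
  then show ?thesis using assms by simp
qed

lemma power2_between: "1 \<le> m \<Longrightarrow> \<exists>l. m < (2::nat) ^ l \<and> 2 ^ l \<le> 2 * m"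
proof (induction m)
  case (Suc m)
  show ?case
  proof (cases "m = 0")
    case True then show ?thesis by (intro exI[of _ 1]) auto
  next
    case False
    then obtain l where l: "m < 2 ^ l" "2 ^ l \<le> 2 * m" using Suc by auto
    show ?thesis
    proof (cases "Suc m < 2 ^ l")
      case True then show ?thesis using l by (intro exI[of _ l]) auto
    next
      case False then have "Suc m = 2 ^ l" using l by simp
      then show ?thesis by (intro exI[of _ "Suc l"]) auto
    qed
  qed
qed simp

context weights
begin

text \<open>A common bound for the moments of the coefficient vectors. With \<open>s\<close> the number of points plus \<open>L\<close>,
  the \<open>p\<close>-th power of the squared norm per coordinate is at most \<open>2 ^ p * s ^ (2 * p)\<close>; for \<open>p \<le> 4\<close> this is at most
  \<open>16 * fact 8 * exp s\<close>, and \<open>exp s\<close> has mean at most \<open>exp (3 * L)\<close>.\<close>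

definition b :: real where "b = 16 * fact 8 * exp (3 * L)"

definition risk_const :: real where
  "risk_const = 18 * L\<^sup>2 + 144 * (L + 1 + b) + 192 * (182400 * b ^ 4) + L\<^sup>2 * b + 170 * b\<^sup>2"

end

locale poisson_sample_setting = weights \<gamma> L for \<gamma> :: "int \<Rightarrow> real" and L :: real +
  fixes M :: "'w measure" and N :: "nat \<Rightarrow> 'w \<Rightarrow> real measure" and n :: nat and lam :: "real \<Rightarrow> real"
  assumes n1: "1 \<le> n" and lam: "lam \<in> intensity_class \<gamma> L" and sample: "poisson_sample n M N lam"
begin

sublocale prob_space M using sample by (simp add: poisson_sample_def)

lemma lam_L2: "lam \<in> L2_fun" by (rule class_L2[OF lam])

lemma pp: "i < n \<Longrightarrow> poisson_point_process M (N i) lam"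
  using sample lam by unfold_locales (auto simp: poisson_sample_def intensity_class_def)

definition \<beta> :: "int \<Rightarrow> real" where "\<beta> j = L2_inner lam (trig_basis j)"
definition x :: "int \<Rightarrow> real measure \<Rightarrow> real" where "x j c = (LINT t|c. trig_basis j t) - \<beta> j"
definition Sig :: "int \<Rightarrow> int \<Rightarrow> real" where "Sig j l = L2_inner (\<lambda>t. trig_basis j t * trig_basis l t) lam"

lemma trig_unit: "trig_basis j \<in> borel_measurable unit_leb" by (rule L2_funD) simp

lemma trig_zero: "trig_basis 0 = (\<lambda>_. 1)" by (simp add: trig_basis_def fun_eq_iff)

lemma lam_integrable: "integrable unit_leb lam"
  using L2_fun_mult_integrable[OF lam_L2 L2_fun_const[of 1]] by simp

lemma beta0: "0 \<le> \<beta> 0" "\<beta> 0 = (LINT t|unit_leb. lam t)"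
proof -
  show eq: "\<beta> 0 = (LINT t|unit_leb. lam t)" by (simp add: \<beta>_def L2_inner_def trig_zero)
  show "0 \<le> \<beta> 0" unfolding eq using lam by (intro integral_nonneg_AE) (auto simp: intensity_class_def)
qed

lemma beta_bound: "\<bar>\<beta> j\<bar> \<le> L"
proof -
  have "(\<beta> j)\<^sup>2 \<le> sqn lam" using Bessel[OF lam_L2, of "{j}"] by (simp add: \<beta>_def)
  then have "(\<beta> j)\<^sup>2 \<le> L\<^sup>2" using class_sqn_le[OF lam] by simp
  then show ?thesis using L_pos by (simp add: abs_le_square_iff[symmetric])
qed

lemma Sig_diag: "Sig j j \<le> 2 * \<beta> 0"
proof -
  have "Sig j j \<le> (LINT t|unit_leb. 2 * lam t)"
    unfolding Sig_def L2_inner_def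
  proof (rule integral_mono_AE)
    show "integrable unit_leb (\<lambda>t. trig_basis j t * trig_basis j t * lam t)"
      by (rule L2_fun_mult_integrable[OF L2_fun_bounded[where B = 2] lam_L2])
        (use trig_unit trig_basis_sq_bound[of j] in \<open>auto simp: power2_eq_square\<close>)
    show "AE t in unit_leb. trig_basis j t * trig_basis j t * lam t \<le> 2 * lam t"
      using lam trig_basis_sq_bound[of j] unfolding intensity_class_def power2_eq_square
      by (auto elim!: eventually_mono intro!: mult_right_mono)
  qed (use lam_integrable in simp)
  then show ?thesis by (simp add: beta0)
qed

text \<open>A row of the covariance matrix consists of Fourier coefficients of \<open>trig_basis j * lam\<close>, a
  square-integrable function, so Bessel's inequality applies even though \<open>lam\<close> may be unbounded.\<close>

lemma Sig_row: "finite J \<Longrightarrow> (\<Sum>l\<in>J. (Sig j l)\<^sup>2) \<le> 2 * L\<^sup>2"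
proof -
  assume J: "finite J"
  let ?h = "\<lambda>t. trig_basis j t * lam t"
  have hm: "?h \<in> borel_measurable unit_leb" using trig_unit L2_funD[OF lam_L2] by measurable
  have le: "?h t * ?h t \<le> 2 * (lam t * lam t)" for t
    using mult_right_mono[OF trig_basis_sq_bound[of j t], of "lam t * lam t"] by (simp add: power2_eq_square mult_ac)
  have sqi: "integrable unit_leb (\<lambda>t. ?h t * ?h t)"
  proof (rule Bochner_Integration.integrable_bound)
    show "integrable unit_leb (\<lambda>t. 2 * (lam t * lam t))" using L2_fun_sq_integrable[OF lam_L2] by simp
    show "AE t in unit_leb. norm (?h t * ?h t) \<le> norm (2 * (lam t * lam t))"
      using le by (intro AE_I2) (simp only: real_norm_def abs_mult_self_eq abs_of_nonneg zero_le_square mult_nonneg_nonneg zero_le_numeral)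
  qed (use hm in measurable)
  have h: "?h \<in> L2_fun" using hm sqi by (simp add: L2_fun_def power2_eq_square)
  have "(\<Sum>l\<in>J. (Sig j l)\<^sup>2) = (\<Sum>l\<in>J. (L2_inner ?h (trig_basis l))\<^sup>2)"
    by (simp add: Sig_def L2_inner_def mult_ac)
  also have "\<dots> \<le> sqn ?h" by (rule Bessel[OF h J])
  also have "\<dots> \<le> (LINT t|unit_leb. 2 * (lam t * lam t))"
    unfolding L2_inner_def by (rule integral_mono[OF sqi _ le]) (use L2_fun_sq_integrable[OF lam_L2] in simp)
  also have "\<dots> = 2 * sqn lam" by (simp add: L2_inner_def)
  also have "\<dots> \<le> 2 * L\<^sup>2" using class_sqn_le[OF lam] by simp
  finally show ?thesis .
qed

lemma b_ge1: "1 \<le> b" and L2_le_b: "2 * L\<^sup>2 \<le> b"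
proof -
  have e: "1 \<le> exp (3 * L)" "exp L \<le> exp (3 * L)" using L_pos by auto
  have f: "(1::real) \<le> fact 8" by (rule fact_ge_1)
  have "16 * 1 * 1 \<le> b" unfolding b_def using e f by (intro mult_mono) auto
  then show "1 \<le> b" by simp
  have "2 * L\<^sup>2 \<le> 4 * exp L" using power_le_fact_exp[of L 2] L_pos by (simp add: fact_numeral)
  also have "\<dots> \<le> 16 * fact 8 * exp (3 * L)"
  proof (intro mult_mono)
    show "(4::real) \<le> 16 * fact 8" using f by linarith
  qed (use e in auto)
  finally show "2 * L\<^sup>2 \<le> b" by (simp add: b_def)
qed

lemma x_measurable: "x j \<in> borel_measurable config_space"
  unfolding x_def
  by (intro borel_measurable_diff borel_measurable_const config_integral_measurable[where B = "sqrt 2"])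
    (use trig_unit trig_basis_bound in auto)

lemma x_bound: assumes "c \<in> configs" shows "(x j c)\<^sup>2 \<le> 2 * (measure c {0..1} + L)\<^sup>2"
proof -
  have "\<bar>LINT t|c. trig_basis j t\<bar> \<le> sqrt 2 * measure c {0..1}"
    by (rule config_integral_bound[OF assms trig_unit]) (use trig_basis_bound in auto)
  then have "\<bar>x j c\<bar> \<le> sqrt 2 * measure c {0..1} + L" unfolding x_def using beta_bound[of j] by linarith
  also have "\<dots> \<le> sqrt 2 * measure c {0..1} + sqrt 2 * L" using L_pos by simp
  finally have "\<bar>x j c\<bar> \<le> sqrt 2 * (measure c {0..1} + L)" by (simp add: algebra_simps)
  from power_mono[OF this, of 2] show ?thesis by (simp add: power_mult_distrib)
qed

lemma independent_vectors:
  assumes m: "2 * m + 1 \<le> 4 * n"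
  shows "independent_vectors M config_space N n x {- int m..int m} Sig b"
proof (unfold_locales)
  have D: "real (card {- int m..int m}) = 2 * real m + 1" by simp
  show "indep_vars (\<lambda>_. config_space) N {..<n}" using sample by (simp add: poisson_sample_def)
  show "0 < n" using n1 by simp
  show "x j \<in> borel_measurable config_space" for j by (rule x_measurable)
  fix i assume i: "i < n"
  interpret P: poisson_point_process M "N i" lam by (rule pp[OF i])
  have trig: "trig_basis j \<in> borel_measurable unit_leb" "\<And>t. t \<in> {0..1} \<Longrightarrow> \<bar>trig_basis j t\<bar> \<le> sqrt 2" for j
    using trig_unit trig_basis_bound by auto
  show am: "all_moments M (\<lambda>w. x j (N i w))" for j
    unfolding x_def
    by (intro all_moments_diff all_moments_const P.Y_all_moments[where B = "sqrt 2"]) (use trig in auto)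
  have \<beta>: "\<beta> j = L2_inner (trig_basis j) lam" for j by (simp add: \<beta>_def L2_inner_commute)
  show "expectation (\<lambda>w. x j (N i w)) = 0" for j
    using P.expectation_Y[OF trig] all_moments_integrable[OF P.Y_all_moments[OF trig]]
    by (simp add: x_def \<beta> prob_space)
  show "expectation (\<lambda>w. x j (N i w) * x l (N i w)) = Sig j l" for j l
    using P.covariance_Y[OF trig trig] by (simp add: x_def \<beta> Sig_def)
  fix p :: nat assume p: "p \<le> 4"
  let ?J = "{- int m..int m}" and ?c = "\<lambda>w. measure (N i w) {0..1}"
  have u: "{0..1} \<in> sets unit_leb" by (simp add: sets_unit_leb)
  have "expectation (\<lambda>w. (\<Sum>j\<in>?J. (x j (N i w))\<^sup>2) ^ p) \<le>
      expectation (\<lambda>w. real (card ?J) ^ p * (16 * fact 8 * exp L) * exp (?c w))"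
  proof (rule integral_mono)
    show "integrable M (\<lambda>w. (\<Sum>j\<in>?J. (x j (N i w))\<^sup>2) ^ p)"
      by (intro all_moments_integrable all_moments_power all_moments_sum am)
    show "integrable M (\<lambda>w. real (card ?J) ^ p * (16 * fact 8 * exp L) * exp (?c w))"
      using P.expectation_measure(1)[OF u] by simp
    fix w assume w: "w \<in> space M"
    let ?s = "?c w + L"
    have s: "0 \<le> ?s" using L_pos by simp
    have "(\<Sum>j\<in>?J. (x j (N i w))\<^sup>2) \<le> real (card ?J) * (2 * ?s\<^sup>2)"
      using x_bound[OF P.X_config[OF w]] by (intro sum_bounded_above) auto
    then have "(\<Sum>j\<in>?J. (x j (N i w))\<^sup>2) ^ p \<le> (real (card ?J) * (2 * ?s\<^sup>2)) ^ p"
      by (intro power_mono sum_nonneg) auto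
    also have "\<dots> = real (card ?J) ^ p * (2 ^ p * ?s ^ (2 * p))"
      by (simp add: power_mult_distrib power_mult del: of_nat_add)
    also have "\<dots> \<le> real (card ?J) ^ p * (16 * (fact 8 * exp ?s))"
    proof (intro mult_left_mono mult_mono)
      show "(2::real) ^ p \<le> 16" using power_increasing[OF p, of "2::real"] by simp
      have "?s ^ (2 * p) \<le> fact (2 * p) * exp ?s" by (rule power_le_fact_exp[OF s])
      also have "\<dots> \<le> fact 8 * exp ?s" using p by (intro mult_right_mono fact_mono) auto
      finally show "?s ^ (2 * p) \<le> fact 8 * exp ?s" .
    qed (use s in auto)
    also have "\<dots> = real (card ?J) ^ p * (16 * fact 8 * exp L) * exp (?c w)" by (simp add: exp_add)
    finally show "(\<Sum>j\<in>?J. (x j (N i w))\<^sup>2) ^ p \<le> real (card ?J) ^ p * (16 * fact 8 * exp L) * exp (?c w)" .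
  qed
  also have "\<dots> = real (card ?J) ^ p * (16 * fact 8 * exp L) * exp (P.mean {0..1} * (exp 1 - 1))"
    using P.expectation_measure(2)[OF u] by simp
  also have "\<dots> \<le> real (card ?J) ^ p * (16 * fact 8 * exp L) * exp (2 * L)"
  proof (intro mult_left_mono)
    have "P.mean {0..1} = \<beta> 0"
      unfolding P.mean_alt beta0 by (intro Bochner_Integration.integral_cong) auto
    then have "P.mean {0..1} * (exp 1 - 1) \<le> L * 2"
      using beta_bound[of 0] beta0 exp_le by (intro mult_mono) auto
    then show "exp (P.mean {0..1} * (exp 1 - 1)) \<le> exp (2 * L)" by simp
  qed auto
  also have "\<dots> = b * real (card ?J) ^ p"
  proof -
    have "exp L * exp (2 * L) = exp (3 * L)" by (simp add: exp_add[symmetric])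
    then show ?thesis by (simp add: b_def mult.assoc mult.left_commute)
  qed
  finally show "expectation (\<lambda>w. (\<Sum>j\<in>?J. (x j (N i w))\<^sup>2) ^ p) \<le> b * real (card ?J) ^ p" .
next
  have "(\<Sum>j\<in>{- int m..int m}. \<Sum>l\<in>{- int m..int m}. (Sig j l)\<^sup>2) \<le> (\<Sum>j\<in>{- int m..int m}. 2 * L\<^sup>2)"
    by (intro sum_mono Sig_row) simp
  also have "\<dots> = 2 * L\<^sup>2 * real (card {- int m..int m})" by simp
  also have "\<dots> \<le> b * real (card {- int m..int m})" using L2_le_b by (intro mult_right_mono) auto
  finally show "(\<Sum>j\<in>{- int m..int m}. \<Sum>l\<in>{- int m..int m}. (Sig j l)\<^sup>2) \<le> b * real (card {- int m..int m})" .
qed (use m b_ge1 in auto)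

abbreviation "\<nu> \<equiv> \<lambda>w. \<lambda>i\<in>{..<n}. N i w"
abbreviation "coef \<equiv> \<lambda>w. coeff_est n (\<nu> w)"

text \<open>The squared norm of the error of the estimated coefficients up to degree \<open>m\<close>; it is
  \<open>noise_trace m / n\<close> on average.\<close>

definition noise :: "nat \<Rightarrow> 'w \<Rightarrow> real" where
  "noise m w = (\<Sum>j\<in>{- int m..int m}. (coef w j - \<beta> j)\<^sup>2)"
definition noise_trace :: "nat \<Rightarrow> real" where "noise_trace m = (\<Sum>j\<in>{- int m..int m}. Sig j j)"

lemma coef_eq: "coef w j - \<beta> j = (\<Sum>i<n. x j (N i w)) / real n"
proof -
  have "(\<Sum>i<n. x j (N i w)) = (\<Sum>i<n. (LINT t|N i w. trig_basis j t)) - real n * \<beta> j"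
    by (simp add: x_def sum_subtractf)
  then show ?thesis using n1 by (simp add: coeff_est_def field_simps)
qed

lemma noise_mono: "m \<le> k \<Longrightarrow> noise m w \<le> noise k w"
  unfolding noise_def by (intro sum_mono2) auto

lemma noise_nonneg: "0 \<le> noise m w" unfolding noise_def by (intro sum_nonneg) auto

lemma noise_trace_le: "noise_trace m \<le> 2 * \<beta> 0 * (2 * real m + 1)"
  using sum_bounded_above[of "{- int m..int m}" "\<lambda>j. Sig j j" "2 * \<beta> 0"] Sig_diag
  by (simp add: noise_trace_def mult_ac)

text \<open>The coefficient errors are sums of independent centred vectors, divided by \<open>n\<close>.\<close>

lemma noise_moments:
  assumes m: "2 * m + 1 \<le> 4 * n"
  defines "D \<equiv> 2 * real m + 1"
  shows "all_moments M (noise m)"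
    "expectation (\<lambda>w. (noise m w - noise_trace m / real n) ^ 4) \<le> 182400 * b ^ 4 * sqrt D * D\<^sup>2 / real n ^ 4"
    "expectation (\<lambda>w. (noise m w)\<^sup>2) \<le> 34 * b\<^sup>2 * D\<^sup>2 / (real n)\<^sup>2"
    "expectation (noise m) \<le> b * D / real n"
proof -
  interpret V: independent_vectors M config_space N n x "{- int m..int m}" Sig b
    by (rule independent_vectors[OF m])
  have cD: "real (card {- int m..int m}) = D" by (simp add: D_def)
  have n: "0 < real n" using n1 by simp
  have ZA: "noise m w = V.A n (\<lambda>k. N k w) / (real n)\<^sup>2" for w
    unfolding noise_def coef_eq V.A_def V.T_def power_divide by (rule sum_divide_distrib[symmetric])
  have v: "V.v = noise_trace m" by (simp add: V.v_def noise_trace_def)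
  have ZQ: "noise m w - noise_trace m / real n = V.Q n (\<lambda>k. N k w) / (real n)\<^sup>2" for w
    using n by (simp add: ZA V.Q_def v field_simps power2_eq_square)
  show "all_moments M (noise m)"
  proof -
    have "all_moments M (\<lambda>w. V.A n (\<lambda>k. N k w) * (1 / (real n)\<^sup>2))"
      by (intro all_moments_mult all_moments_const V.am_A) simp
    moreover have "noise m = (\<lambda>w. V.A n (\<lambda>k. N k w) * (1 / (real n)\<^sup>2))" by (simp add: ZA fun_eq_iff)
    ultimately show ?thesis by simp
  qed
  have "expectation (\<lambda>w. (noise m w - noise_trace m / real n) ^ 4) = expectation (\<lambda>w. (V.Q n (\<lambda>k. N k w)) ^ 4) / real n ^ 8"
    unfolding ZQ by (simp add: power_divide power_mult[symmetric])
  also have "\<dots> \<le> (182400 * b ^ 4 * sqrt D * real n ^ 4 * D\<^sup>2) / real n ^ 8"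
    using V.expectation_Q4 unfolding cD by (intro divide_right_mono) auto
  also have "\<dots> = 182400 * b ^ 4 * sqrt D * D\<^sup>2 / real n ^ 4"
    using n by (simp add: field_simps power_add[symmetric])
  finally show "expectation (\<lambda>w. (noise m w - noise_trace m / real n) ^ 4) \<le> 182400 * b ^ 4 * sqrt D * D\<^sup>2 / real n ^ 4" .
  have "expectation (\<lambda>w. (noise m w)\<^sup>2) = expectation (\<lambda>w. (V.A n (\<lambda>k. N k w))\<^sup>2) / real n ^ 4"
    unfolding ZA by (simp add: power_divide power_mult[symmetric])
  also have "\<dots> \<le> (34 * b\<^sup>2 * (real n)\<^sup>2 * D\<^sup>2) / real n ^ 4"
    using V.expectation_A2[of n] unfolding cD by (intro divide_right_mono) auto
  also have "\<dots> = 34 * b\<^sup>2 * D\<^sup>2 / (real n)\<^sup>2"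
    using n by (simp add: field_simps power2_eq_square power4_eq_xxxx)
  finally show "expectation (\<lambda>w. (noise m w)\<^sup>2) \<le> 34 * b\<^sup>2 * D\<^sup>2 / (real n)\<^sup>2" .
  have "expectation (noise m) = real n * V.v / (real n)\<^sup>2"
    using V.expectation_A[of n] by (simp add: ZA[abs_def])
  also have "\<dots> \<le> b * D / real n"
    using V.v_le n unfolding cD by (simp add: field_simps power2_eq_square)
  finally show "expectation (noise m) \<le> b * D / real n" .
qed

text \<open>Dyadic degrees \<open>2 ^ l - 1\<close>, which start at zero. They reach beyond \<open>n\<close>, so that every degree up to \<open>n\<close>
  lies below one of them whose dimension is at most twice as large.\<close>

definition levels :: "nat set" where "levels = {l. l \<le> 2 * n \<and> 2 ^ l \<le> 2 * n}"
definition level :: "nat \<Rightarrow> nat" where "level l = 2 ^ l - 1"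
text \<open>With dimension \<open>D\<close> and \<open>s = noise - E noise\<close> at a level, \<open>s > D / (2 * n)\<close> implies
  \<open>s \<le> 8 * (n / D) ^ 3 * s ^ 4\<close>. Hence this sum dominates, at all levels simultaneously, the part of
  \<open>s\<close> that exceeds \<open>D / (2 * n)\<close>.\<close>

definition excess :: "'w \<Rightarrow> real" where
  "excess w = (\<Sum>l\<in>levels. 8 * (real n / (2 * real (level l) + 1)) ^ 3 * (noise (level l) w - noise_trace (level l) / real n) ^ 4)"

lemma finite_levels: "finite levels" by (simp add: levels_def)

lemma level_le: "l \<in> levels \<Longrightarrow> 2 * level l + 1 \<le> 4 * n"
proof -
  assume "l \<in> levels"
  then have "2 ^ l \<le> 2 * n" by (simp add: levels_def)
  moreover have "level l + 1 = 2 ^ l" by (simp add: level_def)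
  ultimately show ?thesis by linarith
qed

lemma excess_nonneg: "0 \<le> excess w" unfolding excess_def by (intro sum_nonneg) auto

lemma excess_all_moments: "all_moments M excess"
  unfolding excess_def[abs_def] using noise_moments(1) level_le
  by (intro all_moments_sum all_moments_mult all_moments_power all_moments_diff all_moments_const) auto

text \<open>The term of level \<open>l\<close> has mean of order \<open>1 / (n * sqrt D)\<close> with \<open>D \<ge> 2 ^ l\<close>, and \<open>sqrt 2 \<ge> 4 / 3\<close> leads to
  a geometric series.\<close>

lemma expectation_excess: "expectation excess \<le> 32 * (182400 * b ^ 4) / real n"
proof -
  let ?K = "182400 * b ^ 4"
  have n: "0 < real n" using n1 by simp
  have K: "0 \<le> ?K" using b_ge1 by simp
  have am: "all_moments M (noise (level l))" if "l \<in> levels" for l using noise_moments(1) level_le[OF that] .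
  have "expectation excess = (\<Sum>l\<in>levels. 8 * (real n / (2 * real (level l) + 1)) ^ 3 * expectation (\<lambda>w. (noise (level l) w - noise_trace (level l) / real n) ^ 4))"
    unfolding excess_def[abs_def] using am
    by (subst Bochner_Integration.integral_sum)
       (auto intro!: all_moments_integrable all_moments_mult all_moments_power all_moments_diff)
  also have "\<dots> \<le> (\<Sum>l\<in>levels. 8 * ?K / real n * (3/4) ^ l)"
  proof (rule sum_mono)
    fix l assume l: "l \<in> levels"
    define D where "D = 2 * real (level l) + 1"
    have D: "2 ^ l \<le> D"
    proof -
      have "real (level l) = 2 ^ l - 1" by (simp add: level_def of_nat_diff)
      then show ?thesis by (simp add: D_def)
    qed
    have D0: "0 < D" by (simp add: D_def add_nonneg_pos)
    have sD: "(4/3) ^ l \<le> sqrt D"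
    proof (rule real_le_rsqrt)
      have "((4/3::real) ^ l)\<^sup>2 = (16/9) ^ l" by (simp add: power_mult[symmetric] mult.commute power2_eq_square power_mult_distrib[symmetric])
      also have "\<dots> \<le> 2 ^ l" by (intro power_mono) auto
      finally show "((4/3::real) ^ l)\<^sup>2 \<le> D" using D by simp
    qed
    have "8 * (real n / D) ^ 3 * expectation (\<lambda>w. (noise (level l) w - noise_trace (level l) / real n) ^ 4) \<le>
        8 * (real n / D) ^ 3 * (?K * sqrt D * D\<^sup>2 / real n ^ 4)"
      using noise_moments(2)[OF level_le[OF l]] D0 n unfolding D_def by (intro mult_left_mono) auto
    also have "\<dots> = 8 * ?K / real n * (sqrt D / D)"
      using D0 n by (simp add: field_simps power2_eq_square power3_eq_cube power4_eq_xxxx)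
    also have "sqrt D / D = 1 / sqrt D" using D0 by (simp add: field_simps)
    also have "8 * ?K / real n * (1 / sqrt D) \<le> 8 * ?K / real n * (1 / (4/3) ^ l)"
      using sD K n D0 by (intro mult_left_mono divide_left_mono) auto
    also have "1 / (4/3) ^ l = (3/4::real) ^ l" by (simp add: power_divide)
    finally show "8 * (real n / (2 * real (level l) + 1)) ^ 3 * expectation (\<lambda>w. (noise (level l) w - noise_trace (level l) / real n) ^ 4)
       \<le> 8 * ?K / real n * (3/4) ^ l" by (simp add: D_def)
  qed
  also have "\<dots> = 8 * ?K / real n * (\<Sum>l\<in>levels. (3/4) ^ l)" by (simp add: sum_distrib_left)
  also have "\<dots> \<le> 8 * ?K / real n * 4"
  proof (intro mult_left_mono)
    have "(\<Sum>l\<in>levels. (3/4::real) ^ l) \<le> (\<Sum>l. (3/4::real) ^ l)"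
      by (rule sum_le_suminf) (auto simp: finite_levels)
    also have "\<dots> = 4" by (subst suminf_geometric) auto
    finally show "(\<Sum>l\<in>levels. (3/4::real) ^ l) \<le> 4" .
  qed (use K n in auto)
  finally show ?thesis by simp
qed

text \<open>The constant 5 is \<open>2 + 1/2\<close>, from twice the mean number of points and from the threshold in
  \<open>excess\<close>, doubled for the passage to a dyadic level.\<close>

lemma noise_le_excess:
  assumes "m \<le> n"
  shows "noise m w \<le> 5 * max (\<beta> 0) 1 * (2 * real m + 1) / real n + excess w"
proof -
  have n: "0 < real n" using n1 by simp
  obtain l where l: "l \<in> levels" "m \<le> level l" "2 * real (level l) + 1 \<le> 2 * (2 * real m + 1)"
  proof (cases "m = 0")
    case True
    then show ?thesis using n1 by (intro that[of 0]) (auto simp: levels_def level_def)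
  next
    case False
    then obtain l where l: "m < 2 ^ l" "2 ^ l \<le> 2 * m" using power2_between[of m] by auto
    have "l < 2 ^ l" by simp
    then have "l \<le> 2 * n" "2 ^ l \<le> 2 * n" using l assms by linarith+
    then have "l \<in> levels" by (simp add: levels_def)
    moreover have "m \<le> level l" using l by (simp add: level_def)
    moreover have "2 * real (level l) + 1 \<le> 2 * (2 * real m + 1)"
      using l by (simp add: level_def of_nat_diff flip: of_nat_le_iff[where 'a = real])
    ultimately show ?thesis by (rule that)
  qed
  define D where "D = 2 * real (level l) + 1"
  define s where "s = noise (level l) w - noise_trace (level l) / real n"
  define B where "B = max (\<beta> 0) 1"
  have D0: "0 < D" by (simp add: D_def add_nonneg_pos)
  have B: "1 \<le> B" "\<beta> 0 \<le> B" by (auto simp: B_def)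
  have "8 * (real n / D) ^ 3 * s ^ 4 \<le> excess w"
    unfolding excess_def D_def s_def by (rule member_le_sum) (use l finite_levels in auto)
  moreover have "s \<le> D / (2 * real n) + 8 * (real n / D) ^ 3 * s ^ 4"
  proof (cases "s \<le> D / (2 * real n)")
    case True
    moreover have "0 \<le> 8 * (real n / D) ^ 3 * s ^ 4" using n D0 by simp
    ultimately show ?thesis by linarith
  next
    case False
    then have "(D / (2 * real n)) ^ 3 \<le> s ^ 3" using D0 n by (intro power_mono) auto
    moreover have "0 < s" using False D0 n by (smt (verit) divide_pos_pos mult_pos_pos)
    ultimately have "s * (D / (2 * real n)) ^ 3 \<le> s * s ^ 3" by (intro mult_left_mono) auto
    then have "s \<le> 8 * (real n / D) ^ 3 * s ^ 4"
      using D0 n by (simp add: field_simps power3_eq_cube power4_eq_xxxx)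
    then show ?thesis using D0 n by (smt (verit) divide_pos_pos mult_pos_pos)
  qed
  ultimately have i1: "noise (level l) w \<le> noise_trace (level l) / real n + D / (2 * real n) + excess w" by (simp add: s_def)
  have i2: "noise_trace (level l) / real n \<le> 2 * B * D / real n"
  proof (intro divide_right_mono)
    have "2 * \<beta> 0 * D \<le> 2 * B * D" using B D0 by (intro mult_right_mono) auto
    then show "noise_trace (level l) \<le> 2 * B * D" using noise_trace_le[of "level l"] unfolding D_def by linarith
  qed (use n in auto)
  have i3: "2 * B * D / real n + D / (2 * real n) \<le> 5/2 * B * D / real n"
  proof -
    have "D \<le> B * D" using B D0 by simp
    then have "2 * B * D + D / 2 \<le> 5/2 * B * D" by simp
    then have "(2 * B * D + D / 2) / real n \<le> (5/2 * B * D) / real n" using n by (intro divide_right_mono) auto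
    then show ?thesis by (simp add: add_divide_distrib)
  qed
  have i4: "5/2 * B * D / real n \<le> 5/2 * B * (2 * (2 * real m + 1)) / real n"
    using l(3) B n unfolding D_def by (intro divide_right_mono mult_left_mono) auto
  have i5: "5/2 * B * (2 * (2 * real m + 1)) / real n = 5 * B * (2 * real m + 1) / real n"
    using n by (simp add: field_simps)
  have "noise (level l) w \<le> 5 * B * (2 * real m + 1) / real n + excess w" using i1 i2 i3 i4 i5 by linarith
  then show ?thesis using noise_mono[OF l(2), of w] by (simp add: B_def)
qed

lemma sqn_proj_diff:
  "sqn (\<lambda>t. proj_est n k (\<nu> w) t - lam t) = (sqn lam - (\<Sum>j\<in>{- int k..int k}. (\<beta> j)\<^sup>2)) + noise k w"
  unfolding proj_est_def noise_def \<beta>_def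
  by (subst sqn_diff_trig_sum[OF lam_L2]) auto

lemma contrast_eq:
  assumes "k \<le> n"
  shows "contrast n (\<nu> w) (proj_est n k (\<nu> w)) = - (\<Sum>j\<in>{- int k..int k}. (coef w j)\<^sup>2)"
proof -
  have e: "proj_est n k (\<nu> w) = (\<lambda>t. \<Sum>j\<in>{- int k..int k}. coef w j * trig_basis j t)" for k
    by (simp add: proj_est_def fun_eq_iff)
  have "L2_inner (proj_est n n (\<nu> w)) (proj_est n k (\<nu> w)) = (\<Sum>j\<in>{- int k..int k}. coef w j * coef w j)"
    unfolding e using assms
    by (subst L2_inner_trig_sum) (auto simp: L2_inner_trig_sum_basis intro!: sum.cong)
  moreover have "sqn (proj_est n k (\<nu> w)) = (\<Sum>j\<in>{- int k..int k}. (coef w j)\<^sup>2)"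
    unfolding e by (rule sqn_trig_sum) simp
  ultimately show ?thesis by (simp add: contrast_def L2_norm_sq flip: power2_eq_square)
qed

lemma selected_dim:
  shows "selected_dim n (\<nu> w) \<le> n"
    and "k \<le> n \<Longrightarrow> pen n (\<nu> w) (selected_dim n (\<nu> w)) - (\<Sum>j\<in>{- int (selected_dim n (\<nu> w))..int (selected_dim n (\<nu> w))}. (coef w j)\<^sup>2)
       \<le> pen n (\<nu> w) k - (\<Sum>j\<in>{- int k..int k}. (coef w j)\<^sup>2)"
proof -
  let ?f = "\<lambda>k. contrast n (\<nu> w) (proj_est n k (\<nu> w)) + pen n (\<nu> w) k"
  have s: "selected_dim n (\<nu> w) = arg_min_on ?f {0..n}" by (simp add: selected_dim_def)
  have a: "selected_dim n (\<nu> w) \<in> {0..n}" unfolding s by (rule arg_min_if_finite) auto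
  then show le: "selected_dim n (\<nu> w) \<le> n" by simp
  have "\<not> (\<exists>k\<in>{0..n}. ?f k < ?f (selected_dim n (\<nu> w)))" unfolding s by (rule arg_min_if_finite) auto
  then have "?f (selected_dim n (\<nu> w)) \<le> ?f k" if "k \<le> n" using that by force
  then show "pen n (\<nu> w) (selected_dim n (\<nu> w)) - (\<Sum>j\<in>{- int (selected_dim n (\<nu> w))..int (selected_dim n (\<nu> w))}. (coef w j)\<^sup>2)
       \<le> pen n (\<nu> w) k - (\<Sum>j\<in>{- int k..int k}. (coef w j)\<^sup>2)" if "k \<le> n"
    using that contrast_eq[OF le, of w] contrast_eq[OF that, of w] by simp
qed

lemma sum_sq_le: "(\<Sum>j\<in>J. (u j)\<^sup>2) \<le> 2 * (\<Sum>j\<in>J. (u j - v j)\<^sup>2) + 2 * (\<Sum>j\<in>J. (v j :: real)\<^sup>2)"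
proof -
  have "(a::real)\<^sup>2 \<le> 2 * (a - c)\<^sup>2 + 2 * c\<^sup>2" for a c
    using sum_squares_bound[of "a - c" c] by (simp add: power2_eq_square algebra_simps)
  then have "(\<Sum>j\<in>J. (u j)\<^sup>2) \<le> (\<Sum>j\<in>J. 2 * (u j - v j)\<^sup>2 + 2 * (v j)\<^sup>2)" by (intro sum_mono)
  then show ?thesis by (simp add: sum.distrib sum_distrib_left)
qed

definition bias :: "nat \<Rightarrow> real" where "bias k = sqn lam - (\<Sum>j\<in>{- int k..int k}. (\<beta> j)\<^sup>2)"

lemma bias_nonneg: "0 \<le> bias k"
  using Bessel[OF lam_L2, of "{- int k..int k}"] by (simp add: bias_def \<beta>_def)

lemma sum_split:
  assumes "m \<le> k"
  shows "(\<Sum>j\<in>{- int k..int k}. (u j :: real)) = (\<Sum>j\<in>{- int k..int k} - {- int m..int m}. u j) + (\<Sum>j\<in>{- int m..int m}. u j)"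
  using assms by (intro sum.subset_diff) auto

text \<open>If the estimated factor of the penalty is at least half of the true one, five twelfths of the
  penalty cover the noise up to \<open>excess\<close>, and the comparison of the criterion at the two dimensions
  applies. For a selected dimension below \<open>k\<close>, the additional bias consists of coefficients whose
  estimates were not worth their penalty.\<close>

lemma loss_good:
  assumes k: "k \<le> n" and good: "max (\<beta> 0) 1 \<le> 2 * max (coef w 0) 1"
  shows "sqn (\<lambda>t. adaptive_est n (\<nu> w) t - lam t) \<le> 6 * bias k + 6 * pen n (\<nu> w) k + 6 * excess w"
proof -
  define m where "m = selected_dim n (\<nu> w)"
  have mn: "m \<le> n" using selected_dim(1) by (simp add: m_def)
  have n: "0 < real n" using n1 by simp
  have loss: "sqn (\<lambda>t. adaptive_est n (\<nu> w) t - lam t) = bias m + noise m w"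
    unfolding adaptive_est_def m_def[symmetric] bias_def by (rule sqn_proj_diff)
  have zpen: "noise l w \<le> 5/12 * pen n (\<nu> w) l + excess w" if "l \<le> n" for l
  proof -
    have "5 * max (\<beta> 0) 1 * (2 * real l + 1) / real n \<le> 5 * (2 * max (coef w 0) 1) * (2 * real l + 1) / real n"
      using good n by (intro divide_right_mono mult_right_mono mult_left_mono) auto
    also have "\<dots> = 5/12 * pen n (\<nu> w) l" by (simp add: pen_def)
    finally show ?thesis using noise_le_excess[OF that, of w] by linarith
  qed
  have pos: "0 \<le> pen n (\<nu> w) l" for l unfolding pen_def by simp
  have sel: "pen n (\<nu> w) m - pen n (\<nu> w) k \<le> (\<Sum>j\<in>{- int m..int m}. (coef w j)\<^sup>2) - (\<Sum>j\<in>{- int k..int k}. (coef w j)\<^sup>2)"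
    using selected_dim(2)[OF k, of w] by (simp add: m_def)
  show ?thesis
  proof (cases "k \<le> m")
    case True
    let ?R = "{- int m..int m} - {- int k..int k}"
    have "(\<Sum>j\<in>?R. (coef w j)\<^sup>2) \<le> 2 * (\<Sum>j\<in>?R. (coef w j - \<beta> j)\<^sup>2) + 2 * (\<Sum>j\<in>?R. (\<beta> j)\<^sup>2)" by (rule sum_sq_le)
    moreover have "(\<Sum>j\<in>?R. (coef w j - \<beta> j)\<^sup>2) \<le> noise m w" unfolding noise_def by (intro sum_mono2) auto
    moreover have t: "bias m = bias k - (\<Sum>j\<in>?R. (\<beta> j)\<^sup>2)"
      using sum_split[OF True, of "\<lambda>j. (\<beta> j)\<^sup>2"] by (simp add: bias_def)
    ultimately have "pen n (\<nu> w) m - pen n (\<nu> w) k \<le> 2 * noise m w + 2 * bias k"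
      using sel sum_split[OF True, of "\<lambda>j. (coef w j)\<^sup>2"] bias_nonneg[of m] by linarith
    moreover have "bias m \<le> bias k" using t sum_nonneg[of ?R "\<lambda>j. (\<beta> j)\<^sup>2"] by simp
    ultimately have "noise m w + bias m \<le> 6 * bias k + 6 * pen n (\<nu> w) k + 6 * excess w"
      by (intro oracle_case[where pm = "pen n (\<nu> w) m"] excess_nonneg pos bias_nonneg zpen mn)
    then show ?thesis using loss by simp
  next
    case False
    then have mk: "m \<le> k" by simp
    let ?R = "{- int k..int k} - {- int m..int m}"
    have "(\<Sum>j\<in>?R. (\<beta> j)\<^sup>2) \<le> 2 * (\<Sum>j\<in>?R. (\<beta> j - coef w j)\<^sup>2) + 2 * (\<Sum>j\<in>?R. (coef w j)\<^sup>2)" by (rule sum_sq_le)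
    moreover have "(\<Sum>j\<in>?R. (\<beta> j - coef w j)\<^sup>2) \<le> noise k w"
      unfolding noise_def power2_commute[of "\<beta> _"] by (intro sum_mono2) auto
    moreover have "bias m = bias k + (\<Sum>j\<in>?R. (\<beta> j)\<^sup>2)"
      using sum_split[OF mk, of "\<lambda>j. (\<beta> j)\<^sup>2"] by (simp add: bias_def)
    moreover have "(\<Sum>j\<in>?R. (coef w j)\<^sup>2) \<le> pen n (\<nu> w) k"
      using sel sum_split[OF mk, of "\<lambda>j. (coef w j)\<^sup>2"] pos[of m] by linarith
    ultimately show ?thesis
      using loss zpen[OF k] noise_mono[OF mk, of w] bias_nonneg[of k] pos[of k] excess_nonneg[of w] by linarith
  qed
qed

lemma noise_zero: "noise 0 w = (coef w 0 - \<beta> 0)\<^sup>2" by (simp add: noise_def)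

definition loss_bound :: "nat \<Rightarrow> 'w \<Rightarrow> real" where
  "loss_bound k w = 6 * bias k + 144 * (L + 1 + noise 0 w) * (2 * real k + 1) / real n + 6 * excess w + (L\<^sup>2 + noise n w) * noise 0 w"

text \<open>If the factor of the penalty is underestimated by more than one half, then the error of the zeroth
  coefficient exceeds one, so multiplying by \<open>noise 0\<close> only increases the trivial bound
  \<open>L\<^sup>2 + noise n\<close> for the loss.\<close>

lemma loss_le_bound:
  assumes k: "k \<le> n"
  shows "sqn (\<lambda>t. adaptive_est n (\<nu> w) t - lam t) \<le> loss_bound k w"
proof -
  have n: "0 < real n" using n1 by simp
  have pen: "6 * pen n (\<nu> w) k \<le> 144 * (L + 1 + noise 0 w) * (2 * real k + 1) / real n"
  proof -
    have "a \<le> 1 + a\<^sup>2" for a :: real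
      using zero_le_square[of "a - 1/2"] by (simp add: power2_eq_square algebra_simps)
    from this[of "coef w 0 - \<beta> 0"] have "max (coef w 0) 1 \<le> L + 1 + noise 0 w"
      using beta0 beta_bound[of 0] noise_nonneg[of 0 w] L_pos unfolding noise_zero by auto
    then have "144 * max (coef w 0) 1 * (2 * real k + 1) / real n \<le> 144 * (L + 1 + noise 0 w) * (2 * real k + 1) / real n"
      using n by (intro divide_right_mono mult_right_mono mult_left_mono) auto
    then show ?thesis by (simp add: pen_def)
  qed
  have nn: "0 \<le> (L\<^sup>2 + noise n w) * noise 0 w" using noise_nonneg by simp
  show ?thesis
  proof (cases "max (\<beta> 0) 1 \<le> 2 * max (coef w 0) 1")
    case True
    then show ?thesis using loss_good[OF k True] pen nn by (simp add: loss_bound_def)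
  next
    case False
    then have "1 \<le> \<beta> 0 - coef w 0" by (auto simp: max_def split: if_splits)
    then have "1\<^sup>2 \<le> (\<beta> 0 - coef w 0)\<^sup>2" by (intro power_mono) auto
    then have one: "1 \<le> noise 0 w" by (simp add: noise_zero power2_commute)
    define m where "m = selected_dim n (\<nu> w)"
    have "sqn (\<lambda>t. adaptive_est n (\<nu> w) t - lam t) = bias m + noise m w"
      unfolding adaptive_est_def m_def[symmetric] bias_def by (rule sqn_proj_diff)
    also have "\<dots> \<le> L\<^sup>2 + noise n w"
    proof (rule add_mono)
      show "bias m \<le> L\<^sup>2" using class_sqn_le[OF lam] sum_nonneg[of "{- int m..int m}" "\<lambda>j. (\<beta> j)\<^sup>2"]
        unfolding bias_def by simp
      show "noise m w \<le> noise n w" by (rule noise_mono) (simp add: m_def selected_dim)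
    qed
    also have "\<dots> \<le> (L\<^sup>2 + noise n w) * noise 0 w"
      using mult_left_mono[OF one, of "L\<^sup>2 + noise n w"] noise_nonneg[of n w] by simp
    finally have "sqn (\<lambda>t. adaptive_est n (\<nu> w) t - lam t) \<le> (L\<^sup>2 + noise n w) * noise 0 w" .
    moreover have "0 \<le> 144 * (L + 1 + noise 0 w) * (2 * real k + 1) / real n"
      using L_pos noise_nonneg[of 0 w] by simp
    ultimately show ?thesis using bias_nonneg[of k] excess_nonneg[of w] by (simp add: loss_bound_def)
  qed
qed

text \<open>Both factors of \<open>noise n * noise 0\<close> have finite second moments, of order one and \<open>1 / n\<^sup>2\<close>, so the bad
  event costs \<open>O (1 / n)\<close>. The hypothesis on \<open>k\<close> bounds the squared bias by \<open>L\<^sup>2 * (2 * k + 3) / n\<close>.\<close>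

lemma expectation_loss_bound:
  assumes k: "k \<le> n" and rate: "real n < (\<gamma> (int (Suc k)))\<^sup>2 * (2 * real k + 3)"
  shows "integrable M (loss_bound k)"
    "expectation (loss_bound k) \<le> risk_const * (2 * real k + 1) / real n"
proof -
  have n: "0 < real n" using n1 by simp
  let ?r = "(2 * real k + 1) / real n"
  have am0: "all_moments M (noise 0)" and amn: "all_moments M (noise n)" using noise_moments(1) n1 by auto
  note am = am0 amn excess_all_moments
  have bound_eq: "loss_bound k = (\<lambda>w. (6 * bias k + 144 * (L + 1) * ?r) + (144 * ?r) * noise 0 w + 6 * excess w + L\<^sup>2 * noise 0 w + noise n w * noise 0 w)"
    by (simp add: loss_bound_def fun_eq_iff algebra_simps add_divide_distrib)
  have ints: "integrable M (noise 0)" "integrable M excess" "integrable M (\<lambda>w. noise n w * noise 0 w)"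
    "integrable M (\<lambda>w. (noise n w)\<^sup>2)" "integrable M (\<lambda>w. (noise 0 w)\<^sup>2)"
    using am by (auto intro!: all_moments_integrable)
  show "integrable M (loss_bound k)" unfolding bound_eq using ints by simp
  have E0: "expectation (noise 0) \<le> b / real n" using noise_moments(4)[of 0] n1 by simp
  have E00: "expectation (\<lambda>w. (noise 0 w)\<^sup>2) \<le> 34 * b\<^sup>2 / (real n)\<^sup>2" using noise_moments(3)[of 0] n1 by simp
  have Enn: "expectation (\<lambda>w. (noise n w)\<^sup>2) \<le> 306 * b\<^sup>2"
  proof -
    have "expectation (\<lambda>w. (noise n w)\<^sup>2) \<le> 34 * b\<^sup>2 * (2 * real n + 1)\<^sup>2 / (real n)\<^sup>2" using noise_moments(3)[of n] n1 by simp
    also have "\<dots> \<le> 34 * b\<^sup>2 * (3 * real n)\<^sup>2 / (real n)\<^sup>2"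
      using n1 by (intro divide_right_mono mult_left_mono power_mono) auto
    also have "\<dots> = 306 * b\<^sup>2" using n by (simp add: power_mult_distrib)
    finally show ?thesis .
  qed
  have Ex: "expectation (\<lambda>w. noise n w * noise 0 w) \<le> 170 * b\<^sup>2 / real n"
  proof -
    have "expectation (\<lambda>w. noise n w * noise 0 w) \<le> expectation (\<lambda>w. 1 / (2 * real n) * (noise n w)\<^sup>2 + real n / 2 * (noise 0 w)\<^sup>2)"
    proof (rule integral_mono)
      fix w
      show "noise n w * noise 0 w \<le> 1 / (2 * real n) * (noise n w)\<^sup>2 + real n / 2 * (noise 0 w)\<^sup>2"
        using sum_squares_bound[of "noise n w" "real n * noise 0 w"] n by (simp add: field_simps power2_eq_square)
    qed (use ints in auto)
    also have "\<dots> = 1 / (2 * real n) * expectation (\<lambda>w. (noise n w)\<^sup>2) + real n / 2 * expectation (\<lambda>w. (noise 0 w)\<^sup>2)"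
      using ints by simp
    also have "\<dots> \<le> 1 / (2 * real n) * (306 * b\<^sup>2) + real n / 2 * (34 * b\<^sup>2 / (real n)\<^sup>2)"
      using Enn E00 n by (intro add_mono mult_left_mono) auto
    also have "\<dots> = 170 * b\<^sup>2 / real n" using n by (simp add: field_simps power2_eq_square)
    finally show ?thesis .
  qed
  have r: "1 / real n \<le> ?r" using n by (intro divide_right_mono) auto
  have bias: "6 * bias k \<le> 18 * L\<^sup>2 * ?r"
  proof -
    have "(\<gamma> (int (Suc k)))\<^sup>2 * bias k \<le> L\<^sup>2" using class_tail_le[OF lam, of k] by (simp add: bias_def \<beta>_def)
    then have "(\<gamma> (int (Suc k)))\<^sup>2 * bias k * (2 * real k + 3) \<le> L\<^sup>2 * (2 * real k + 3)" by (intro mult_right_mono) auto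
    moreover have "real n * bias k \<le> (\<gamma> (int (Suc k)))\<^sup>2 * (2 * real k + 3) * bias k"
      using rate bias_nonneg[of k] by (intro mult_right_mono) auto
    moreover have "(\<gamma> (int (Suc k)))\<^sup>2 * (2 * real k + 3) * bias k = (\<gamma> (int (Suc k)))\<^sup>2 * bias k * (2 * real k + 3)"
      by (simp only: mult_ac)
    ultimately have "real n * bias k \<le> L\<^sup>2 * (2 * real k + 3)" by linarith
    also have "\<dots> \<le> L\<^sup>2 * (3 * (2 * real k + 1))" by (intro mult_left_mono) auto
    finally show ?thesis using n by (simp add: field_simps)
  qed
  have collect: "18 * L\<^sup>2 * s + 144 * (L + 1) * s + (144 * s) * b + 6 * (32 * (182400 * b ^ 4) * s) + L\<^sup>2 * (b * s) + 170 * b\<^sup>2 * s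
      = risk_const * s" for s
    by (simp add: risk_const_def algebra_simps)
  have "expectation (loss_bound k) = 6 * bias k + 144 * (L + 1) * ?r + (144 * ?r) * expectation (noise 0) + 6 * expectation excess
      + L\<^sup>2 * expectation (noise 0) + expectation (\<lambda>w. noise n w * noise 0 w)"
    unfolding bound_eq using ints by (simp add: prob_space)
  also have "\<dots> \<le> 18 * L\<^sup>2 * ?r + 144 * (L + 1) * ?r + (144 * ?r) * b + 6 * (32 * (182400 * b ^ 4) * ?r)
      + L\<^sup>2 * (b * ?r) + 170 * b\<^sup>2 * ?r"
  proof (intro add_mono mult_left_mono bias order_refl)
    have "b / real n \<le> b" using n1 b_ge1 by (simp add: field_simps)
    then show "expectation (noise 0) \<le> b" using E0 by linarith
    show "expectation excess \<le> 32 * (182400 * b ^ 4) * ?r"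
      using expectation_excess mult_left_mono[OF r, of "32 * (182400 * b ^ 4)"] b_ge1 by simp
    show "expectation (noise 0) \<le> b * ?r" using E0 mult_left_mono[OF r, of b] b_ge1 by simp
    show "expectation (\<lambda>w. noise n w * noise 0 w) \<le> 170 * b\<^sup>2 * ?r" using Ex mult_left_mono[OF r, of "170 * b\<^sup>2"] by simp
  qed (use n L_pos in auto)
  also have "\<dots> = risk_const * ?r"
    by (rule collect)
  finally show "expectation (loss_bound k) \<le> risk_const * (2 * real k + 1) / real n"
    by simp
qed

lemma risk_adaptive_le:
  assumes k: "k \<le> n" and rate: "real n < (\<gamma> (int (Suc k)))\<^sup>2 * (2 * real k + 3)"
  shows "risk n M N (adaptive_est n) lam \<le>
    ennreal (risk_const * (2 * real k + 1) / real n)"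
proof -
  have "risk n M N (adaptive_est n) lam \<le> (\<integral>\<^sup>+w. ennreal (loss_bound k w) \<partial>M)"
    unfolding risk_def L2_norm_sq using loss_le_bound[OF k] by (intro nn_integral_mono ennreal_leI)
  also have "\<dots> = ennreal (expectation (loss_bound k))"
    using expectation_loss_bound(1)[OF k rate] order_trans[OF sqn_nonneg loss_le_bound[OF k]]
    by (intro nn_integral_eq_integral AE_I2)
  also have "\<dots> \<le> ennreal (risk_const * (2 * real k + 1) / real n)"
    by (rule ennreal_leI[OF expectation_loss_bound(2)[OF k rate]])
  finally show ?thesis .
qed

end

section \<open>Approximation by a generating algebra\<close>

text \<open>Every set of the generated sigma-algebra is approximated by sets of the algebra, simultaneously for
  both measures.\<close>

lemma measure_le_from_algebra:
  fixes P Q :: "'a measure"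
  assumes P: "finite_measure P" and Q: "finite_measure Q" and sets_eq: "sets Q = sets P"
    and gen: "sets P = sigma_sets (space P) \<C>" and sub: "\<C> \<subseteq> Pow (space P)"
    and emp: "{} \<in> \<C>"
    and compl: "\<And>C. C \<in> \<C> \<Longrightarrow> space P - C \<in> \<C>"
    and un: "\<And>C D. C \<in> \<C> \<Longrightarrow> D \<in> \<C> \<Longrightarrow> C \<union> D \<in> \<C>"
    and le: "\<And>C. C \<in> \<C> \<Longrightarrow> measure Q C \<le> measure P C + \<delta>"
    and E: "E \<in> sets P"
  shows "measure Q E \<le> measure P E + \<delta>"
proof -
  interpret P: finite_measure P by fact
  interpret Q: finite_measure Q by fact
  have Cs: "C \<in> sets P" if "C \<in> \<C>" for C unfolding gen using that by (rule sigma_sets.Basic)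
  have fin_un: "(\<Union>i<N. C i) \<in> \<C>" if "\<And>i. C i \<in> \<C>" for C and N :: nat
  proof (induction N)
    case (Suc N) then show ?case using un[OF that[of N] Suc] by (simp add: lessThan_Suc)
  qed (simp add: emp)
  have "E \<in> sets P \<and> (\<forall>\<epsilon>>0. \<exists>C\<in>\<C>. measure P (sym_diff E C) < \<epsilon> \<and> measure Q (sym_diff E C) < \<epsilon>)"
    using E[unfolded gen]
  proof (induction rule: sigma_sets.induct)
    case (Basic a)
    then show ?case using Cs by (auto intro!: bexI[of _ a])
  next
    case Empty
    show ?case using emp by (auto intro!: bexI[of _ "{}"])
  next
    case (Compl a)
    have "\<exists>C\<in>\<C>. measure P (sym_diff (space P - a) C) < \<epsilon> \<and> measure Q (sym_diff (space P - a) C) < \<epsilon>" if \<epsilon>: "0 < \<epsilon>" for \<epsilon>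
    proof -
      obtain C where C: "C \<in> \<C>" "measure P (sym_diff a C) < \<epsilon>" "measure Q (sym_diff a C) < \<epsilon>" using Compl.IH \<epsilon> by blast
      have "a \<subseteq> space P" using Compl.IH sets.sets_into_space by blast
      then have "sym_diff (space P - a) (space P - C) = sym_diff a C" using sub C(1) by blast
      then show ?thesis using compl[OF C(1)] C by (intro bexI[of _ "space P - C"]) auto
    qed
    then show ?case using Compl.IH by auto
  next
    case (Union A)
    have As: "A i \<in> sets P" for i using Union.IH by blast
    have "\<exists>C\<in>\<C>. measure P (sym_diff (\<Union>i. A i) C) < \<epsilon> \<and> measure Q (sym_diff (\<Union>i. A i) C) < \<epsilon>" if \<epsilon>: "0 < \<epsilon>" for \<epsilon>
    proof -
      let ?B = "\<lambda>N. \<Union>i<N. A i" and ?E = "\<Union>i. A i"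
      have lim: "(\<lambda>N. measure R (?B N)) \<longlonglongrightarrow> measure R ?E" if "finite_measure R" "sets R = sets P" for R
      proof -
        interpret R: finite_measure R by fact
        have "(\<lambda>N. measure R (?B N)) \<longlonglongrightarrow> measure R (\<Union>N. ?B N)"
        proof (rule R.finite_Lim_measure_incseq)
          show "incseq ?B" by (rule incseq_SucI) (auto simp: lessThan_Suc)
        qed (use As that in auto)
        moreover have "(\<Union>N. ?B N) = ?E" by (auto intro: lessI)
        ultimately show ?thesis by simp
      qed
      have "eventually (\<lambda>N. measure P ?E - \<epsilon> / 2 < measure P (?B N)) sequentially"
        using lim[OF P] \<epsilon> by (intro order_tendstoD(1)) auto
      moreover have "eventually (\<lambda>N. measure Q ?E - \<epsilon> / 2 < measure Q (?B N)) sequentially"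
        using lim[OF Q sets_eq] \<epsilon> by (intro order_tendstoD(1)) auto
      ultimately obtain N where N: "measure P ?E - \<epsilon> / 2 < measure P (?B N)" "measure Q ?E - \<epsilon> / 2 < measure Q (?B N)"
        using eventually_happens'[OF sequentially_bot eventually_conj] by blast
      \<comment> \<open>the successor keeps the denominator positive when the finite union is empty\<close>
      define d where "d = \<epsilon> / (2 * real (Suc N))"
      have d: "0 < d" using \<epsilon> by (simp add: d_def)
      have "\<forall>i. \<exists>C\<in>\<C>. measure P (sym_diff (A i) C) < d \<and> measure Q (sym_diff (A i) C) < d"
        using Union.IH d by blast
      then obtain C where C: "\<And>i. C i \<in> \<C>" "\<And>i. measure P (sym_diff (A i) (C i)) < d" "\<And>i. measure Q (sym_diff (A i) (C i)) < d"
        by metis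
      have bound: "measure R (sym_diff ?E (\<Union>i<N. C i)) < \<epsilon>"
        if R: "finite_measure R" "sets R = sets P" and RN: "measure R ?E - \<epsilon> / 2 < measure R (?B N)"
          and RC: "\<And>i. measure R (sym_diff (A i) (C i)) < d" for R
      proof -
        interpret R: finite_measure R by fact
        have m: "A i \<in> sets R" "C i \<in> sets R" for i using As Cs[OF C(1)] R(2) by auto
        have mB: "?B N \<in> sets R" "?E \<in> sets R" "(\<Union>i<N. sym_diff (A i) (C i)) \<in> sets R" using m by auto
        have "measure R (sym_diff ?E (\<Union>i<N. C i)) \<le> measure R ((?E - ?B N) \<union> (\<Union>i<N. sym_diff (A i) (C i)))"
          using mB by (intro R.finite_measure_mono) auto
        also have "\<dots> \<le> measure R (?E - ?B N) + measure R (\<Union>i<N. sym_diff (A i) (C i))"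
          using mB by (intro measure_Un_le) auto
        also have "measure R (?E - ?B N) = measure R ?E - measure R (?B N)"
          using mB by (intro R.finite_measure_Diff) auto
        also have "measure R (\<Union>i<N. sym_diff (A i) (C i)) \<le> (\<Sum>i<N. measure R (sym_diff (A i) (C i)))"
          using m by (intro measure_UNION_le) auto
        also have "\<dots> \<le> real N * d" using RC sum_bounded_above[of "{..<N}" "\<lambda>i. measure R (sym_diff (A i) (C i))" d]
          by (simp add: less_imp_le)
        also have "real N * d \<le> \<epsilon> / 2" using \<epsilon> by (simp add: d_def field_simps)
        finally show ?thesis using RN by linarith
      qed
      show ?thesis
        using bound[OF P refl N(1) C(2)] bound[OF Q sets_eq N(2) C(3)] 
        by (intro bexI[of _ "\<Union>i<N. C i"] conjI fin_un C(1))
    qed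
    then show ?case using As by auto
  qed
  then have appr: "\<exists>C\<in>\<C>. measure P (sym_diff E C) < \<epsilon> \<and> measure Q (sym_diff E C) < \<epsilon>" if "0 < \<epsilon>" for \<epsilon> using that by blast
  show ?thesis
  proof (rule field_le_epsilon)
    fix \<epsilon> :: real assume "0 < \<epsilon>"
    then obtain C where C: "C \<in> \<C>" "measure P (sym_diff E C) < \<epsilon> / 2" "measure Q (sym_diff E C) < \<epsilon> / 2"
      using appr[of "\<epsilon> / 2"] by auto
    have sd: "C \<in> sets P" "sym_diff E C \<in> sets P" using E Cs[OF C(1)] by auto
    have "measure Q E \<le> measure Q (C \<union> sym_diff E C)" using sd E sets_eq by (intro Q.finite_measure_mono) auto
    also have "\<dots> \<le> measure Q C + measure Q (sym_diff E C)" using sd sets_eq by (intro measure_Un_le) auto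
    also have "measure P C \<le> measure P (E \<union> sym_diff E C)" using sd E by (intro P.finite_measure_mono) auto
    moreover have "\<dots> \<le> measure P E + measure P (sym_diff E C)" using sd E by (intro measure_Un_le) auto
    ultimately show "measure Q E \<le> measure P E + \<delta> + \<epsilon>" using le[OF C(1)] C by linarith
  qed
qed

section \<open>Counts on a finite partition\<close>

definition partition :: "(nat \<Rightarrow> real set) \<Rightarrow> nat \<Rightarrow> bool" where
  "partition A r \<longleftrightarrow> (\<forall>l<r. A l \<in> sets unit_leb) \<and> disjoint_family_on A {..<r} \<and> (\<Union>l<r. A l) = {0..1}"

text \<open>All counts are set to zero outside the index range, so that the possible values of the counts are
  the functions in \<open>supported\<close>, a countable set.\<close>

definition counts :: "nat \<Rightarrow> (nat \<Rightarrow> real set) \<Rightarrow> nat \<Rightarrow> sample \<Rightarrow> nat \<times> nat \<Rightarrow> nat" where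
  "counts n A r \<nu> = (\<lambda>(i, l). if i < n \<and> l < r then points_in (A l) (\<nu> i) else 0)"

abbreviation "samples n \<equiv> PiM {..<n} (\<lambda>_. config_space)"

lemma samples_component: "\<nu> \<in> space (samples n) \<Longrightarrow> i < n \<Longrightarrow> \<nu> i \<in> configs"
  by (auto simp: space_PiM PiE_def Pi_def)

lemma count_Union:
  assumes \<mu>: "\<mu> \<in> configs" and I: "finite I" "\<And>i. i \<in> I \<Longrightarrow> B i \<in> sets unit_leb" "disjoint_family_on B I"
  shows "points_in (\<Union>i\<in>I. B i) \<mu> = (\<Sum>i\<in>I. points_in (B i) \<mu>)"
proof -
  interpret finite_measure \<mu> by (rule config_finite[OF \<mu>])
  have "measure \<mu> (\<Union>i\<in>I. B i) = (\<Sum>i\<in>I. measure \<mu> (B i))"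
    using I config_sets[OF \<mu>] by (intro finite_measure_finite_Union) auto
  then have "real (points_in (\<Union>i\<in>I. B i) \<mu>) = (\<Sum>i\<in>I. real (points_in (B i) \<mu>))"
    using I measure_count[OF \<mu>] by (simp add: sets.finite_UN)
  then show ?thesis by (simp flip: of_nat_sum)
qed

text \<open>The common refinement consists of the intersections of cells, numbered by
  \<open>k \<mapsto> (k div s, k mod s)\<close>; the counts of the coarse cells are sums of its counts.\<close>

lemma partition_refine:
  assumes A: "partition A r" and B: "partition B s"
  obtains C t \<phi> \<psi> where "partition C t"
    "\<And>\<nu>. \<nu> \<in> space (samples n) \<Longrightarrow> counts n A r \<nu> = \<phi> (counts n C t \<nu>)"
    "\<And>\<nu>. \<nu> \<in> space (samples n) \<Longrightarrow> counts n B s \<nu> = \<psi> (counts n C t \<nu>)"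
proof -
  define C where "C k = A (k div s) \<inter> B (k mod s)" for k
  have s: "0 < s" using B by (cases s) (auto simp: partition_def)
  have idx: "l * s + l' < r * s" if "l < r" "l' < s" for l l'
  proof -
    have "l * s + l' < Suc l * s" using that by simp
    also have "\<dots> \<le> r * s" using that by (intro mult_right_mono) auto
    finally show ?thesis .
  qed
  have Cidx: "C (l * s + l') = A l \<inter> B l'" if "l' < s" for l l' using that by (simp add: C_def)
  have dm: "k div s < r" "k mod s < s" if "k < r * s" for k
    using that s by (auto simp: less_mult_imp_div_less)
  have meas: "C k \<in> sets unit_leb" if "k < r * s" for k
    using A B dm[OF that] by (auto simp: C_def partition_def)
  have dis: "disjoint_family_on C {..<r * s}"
    unfolding disjoint_family_on_def
  proof (intro ballI impI)
    fix k k' assume k: "k \<in> {..<r * s}" "k' \<in> {..<r * s}" "k \<noteq> k'"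
    then have "k div s \<noteq> k' div s \<or> k mod s \<noteq> k' mod s" by (metis div_mult_mod_eq)
    then show "C k \<inter> C k' = {}"
      using A B dm[of k] dm[of k'] k unfolding partition_def disjoint_family_on_def C_def by blast
  qed
  have cov: "(\<Union>k<r * s. C k) = {0..1}"
  proof
    show "(\<Union>k<r * s. C k) \<subseteq> {0..1}" by (intro UN_least) (use meas in \<open>auto simp: sets_unit_leb\<close>)
    show "{0..1} \<subseteq> (\<Union>k<r * s. C k)"
    proof
      fix x :: real assume "x \<in> {0..1}"
      then have "x \<in> (\<Union>l<r. A l)" "x \<in> (\<Union>l<s. B l)" using A B unfolding partition_def by simp_all
      then obtain l l' where ll: "l < r" "x \<in> A l" "l' < s" "x \<in> B l'" by blast
      then have "x \<in> C (l * s + l')" using Cidx[of l' l] by simp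
      then show "x \<in> (\<Union>k<r * s. C k)" using idx[OF ll(1,3)] by (intro UN_I[of "l * s + l'"]) auto
    qed
  qed
  have part: "partition C (r * s)" using meas dis cov by (auto simp: partition_def)
  have inj1: "inj_on (\<lambda>l'. l * s + l') {..<s}" for l by (auto simp: inj_on_def)
  have inj2: "inj_on (\<lambda>l. l * s + l') {..<r}" for l' using s by (auto simp: inj_on_def)
  have cA: "points_in (A l) \<mu> = (\<Sum>l'<s. points_in (C (l * s + l')) \<mu>)" if l: "l < r" and \<mu>: "\<mu> \<in> configs" for l \<mu>
  proof -
    have "A l \<in> sets unit_leb" using A l by (auto simp: partition_def)
    then have "A l \<subseteq> {0..1}" by (simp add: sets_unit_leb)
    then have "A l = A l \<inter> (\<Union>l'<s. B l')" using B unfolding partition_def by blast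
    also have "\<dots> = (\<Union>l'<s. C (l * s + l'))" using Cidx[of _ l] by simp
    finally have "A l = (\<Union>l'<s. C (l * s + l'))" .
    moreover have "disjoint_family_on (\<lambda>l'. C (l * s + l')) {..<s}"
      unfolding disjoint_family_on_def
    proof (intro ballI impI)
      fix m m' assume "m \<in> {..<s}" "m' \<in> {..<s}" "m \<noteq> m'"
      moreover from this have "B m \<inter> B m' = {}" using B unfolding partition_def disjoint_family_on_def by blast
      ultimately show "C (l * s + m) \<inter> C (l * s + m') = {}" using Cidx[of _ l] by auto
    qed
    ultimately show ?thesis
      using count_Union[OF \<mu>, of "{..<s}" "\<lambda>l'. C (l * s + l')"] meas idx l by simp
  qed
  have cB: "points_in (B l') \<mu> = (\<Sum>l<r. points_in (C (l * s + l')) \<mu>)" if l': "l' < s" and \<mu>: "\<mu> \<in> configs" for l' \<mu>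
  proof -
    have "B l' \<in> sets unit_leb" using B l' by (auto simp: partition_def)
    then have "B l' \<subseteq> {0..1}" by (simp add: sets_unit_leb)
    then have "B l' = (\<Union>l<r. A l) \<inter> B l'" using A unfolding partition_def by blast
    also have "\<dots> = (\<Union>l<r. C (l * s + l'))" using Cidx[OF l'] by simp
    finally have "B l' = (\<Union>l<r. C (l * s + l'))" .
    moreover have "disjoint_family_on (\<lambda>l. C (l * s + l')) {..<r}"
      unfolding disjoint_family_on_def
    proof (intro ballI impI)
      fix m m' assume "m \<in> {..<r}" "m' \<in> {..<r}" "m \<noteq> m'"
      moreover from this have "A m \<inter> A m' = {}" using A unfolding partition_def disjoint_family_on_def by blast
      ultimately show "C (m * s + l') \<inter> C (m' * s + l') = {}" using Cidx[OF l'] by auto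
    qed
    ultimately show ?thesis
      using count_Union[OF \<mu>, of "{..<r}" "\<lambda>l. C (l * s + l')"] meas idx l' by simp
  qed
  define \<phi> where "\<phi> \<kappa> = (\<lambda>(i, l). if i < n \<and> l < r then \<Sum>l'<s. \<kappa> (i, l * s + l') else 0)" for \<kappa> :: "nat \<times> nat \<Rightarrow> nat"
  define \<psi> where "\<psi> \<kappa> = (\<lambda>(i, l'). if i < n \<and> l' < s then \<Sum>l<r. \<kappa> (i, l * s + l') else 0)" for \<kappa> :: "nat \<times> nat \<Rightarrow> nat"
  show ?thesis
  proof (rule that[of C "r * s" \<phi> \<psi>])
    fix \<nu> assume \<nu>: "\<nu> \<in> space (samples n)"
    show "counts n A r \<nu> = \<phi> (counts n C (r * s) \<nu>)"
      using cA samples_component[OF \<nu>] idx by (auto simp: counts_def \<phi>_def fun_eq_iff intro!: sum.cong)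
    show "counts n B s \<nu> = \<psi> (counts n C (r * s) \<nu>)"
      using cB samples_component[OF \<nu>] idx by (auto simp: counts_def \<psi>_def fun_eq_iff intro!: sum.cong)
  qed (rule part)
qed

definition cylinders :: "nat \<Rightarrow> sample set set" where
  "cylinders n = {{\<nu> \<in> space (samples n). counts n A r \<nu> \<in> K} | A r K. partition A r}"

lemma partition_set:
  assumes "B \<in> sets unit_leb" shows "partition (\<lambda>l. if l = 0 then B else {0..1} - B) 2"
proof -
  have "{0..1} - B \<in> sets unit_leb" using sets.compl_sets[OF assms] by simp
  moreover have "B \<subseteq> {0..1}" using sets.sets_into_space[OF assms] by simp
  ultimately show ?thesis
    using assms by (auto simp: partition_def disjoint_family_on_def lessThan_Suc numeral_2_eq_2)
qed

lemma cylinders_closed: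
  shows "{} \<in> cylinders n" "C \<in> cylinders n \<Longrightarrow> space (samples n) - C \<in> cylinders n"
    "C \<in> cylinders n \<Longrightarrow> D \<in> cylinders n \<Longrightarrow> C \<union> D \<in> cylinders n"
proof -
  have "partition (\<lambda>l. if l = 0 then {} else {0..1} - {}) 2" by (rule partition_set) simp
  moreover have "{} = {\<nu> \<in> space (samples n). counts n (\<lambda>l. if l = 0 then {} else {0..1} - {}) 2 \<nu> \<in> {}}" by simp
  ultimately show "{} \<in> cylinders n" unfolding cylinders_def by blast
next
  assume "C \<in> cylinders n"
  then obtain A r K where C: "C = {\<nu> \<in> space (samples n). counts n A r \<nu> \<in> K}" "partition A r"
    by (auto simp: cylinders_def)
  then have "space (samples n) - C = {\<nu> \<in> space (samples n). counts n A r \<nu> \<in> - K}" by auto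
  then show "space (samples n) - C \<in> cylinders n" using C(2) unfolding cylinders_def by blast
next
  assume "C \<in> cylinders n" "D \<in> cylinders n"
  then obtain A r K B s K' where C: "C = {\<nu> \<in> space (samples n). counts n A r \<nu> \<in> K}" "partition A r"
    and D: "D = {\<nu> \<in> space (samples n). counts n B s \<nu> \<in> K'}" "partition B s"
    unfolding cylinders_def by blast
  obtain E t \<phi> \<psi> where E: "partition E t"
    "\<And>\<nu>. \<nu> \<in> space (samples n) \<Longrightarrow> counts n A r \<nu> = \<phi> (counts n E t \<nu>)"
    "\<And>\<nu>. \<nu> \<in> space (samples n) \<Longrightarrow> counts n B s \<nu> = \<psi> (counts n E t \<nu>)"
    by (rule partition_refine[OF C(2) D(2), where n = n]) (rule that; assumption)
  have "C \<union> D = {\<nu> \<in> space (samples n). counts n E t \<nu> \<in> {\<kappa>. \<phi> \<kappa> \<in> K \<or> \<psi> \<kappa> \<in> K'}}"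
    unfolding C(1) D(1) using E(2,3) by auto
  then show "C \<union> D \<in> cylinders n" using E(1) unfolding cylinders_def by blast
qed

lemma counts_measurable:
  assumes A: "partition A r"
  shows "{\<nu> \<in> space (samples n). counts n A r \<nu> = k} \<in> sets (samples n)"
proof (cases "\<forall>i l. \<not> (i < n \<and> l < r) \<longrightarrow> k (i, l) = 0")
  case True
  have "{\<nu> \<in> space (samples n). counts n A r \<nu> = k} =
     {\<nu> \<in> space (samples n). \<forall>i\<in>{..<n}. \<forall>l\<in>{..<r}. points_in (A l) (\<nu> i) = k (i, l)}"
    using True by (auto simp: counts_def fun_eq_iff)
  also have "\<dots> \<in> sets (samples n)"
  proof (rule sets.sets_Collect_finite_All, rule sets.sets_Collect_finite_All)
    fix i l assume il: "i \<in> {..<n}" "l \<in> {..<r}"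
    then have "A l \<in> sets unit_leb" using A by (auto simp: partition_def)
    then have "(\<lambda>\<nu>. points_in (A l) (\<nu> i)) \<in> measurable (samples n) (count_space UNIV)"
      using measurable_compose[OF measurable_component_singleton[OF il(1), of "\<lambda>_. config_space"]] count_measurable by blast
    then show "{\<nu> \<in> space (samples n). points_in (A l) (\<nu> i) = k (i, l)} \<in> sets (samples n)" by measurable
  qed auto
  finally show ?thesis .
next
  case False
  then have e: "{\<nu> \<in> space (samples n). counts n A r \<nu> = k} = {}" by (auto simp: counts_def)
  show ?thesis unfolding e by (rule sets.empty_sets)
qed

definition supported :: "nat \<Rightarrow> nat \<Rightarrow> (nat \<times> nat \<Rightarrow> nat) set" where
  "supported n r = {k. \<forall>p. p \<notin> {..<n} \<times> {..<r} \<longrightarrow> k p = 0}"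

lemma countable_supported: "countable (supported n r)"
proof -
  let ?I = "{..<n} \<times> {..<r}"
  have "supported n r \<subseteq> (\<lambda>g p. if p \<in> ?I then g p else 0) ` (PiE ?I (\<lambda>_. UNIV))"
  proof
    fix k assume k: "k \<in> supported n r"
    then have "k = (\<lambda>p. if p \<in> ?I then (restrict k ?I) p else 0)" by (auto simp: supported_def)
    moreover have "restrict k ?I \<in> PiE ?I (\<lambda>_. UNIV)" by auto
    ultimately show "k \<in> (\<lambda>g p. if p \<in> ?I then g p else 0) ` (PiE ?I (\<lambda>_. UNIV))" by blast
  qed
  moreover have "countable (PiE ?I (\<lambda>_. UNIV :: nat set))" by (rule countable_PiE) auto
  ultimately show ?thesis by (meson countable_image countable_subset)
qed

lemma counts_supported: "counts n A r \<nu> \<in> supported n r"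
  by (auto simp: counts_def supported_def)

lemma cylinder_decompose:
  "{\<nu> \<in> space (samples n). counts n A r \<nu> \<in> K} =
    (\<Union>k\<in>K \<inter> supported n r. {\<nu> \<in> space (samples n). counts n A r \<nu> = k})"
  using counts_supported by auto

lemma cylinders_sets: "cylinders n \<subseteq> sets (samples n)"
proof
  fix C assume "C \<in> cylinders n"
  then obtain A r K where C: "C = {\<nu> \<in> space (samples n). counts n A r \<nu> \<in> K}" "partition A r"
    by (auto simp: cylinders_def)
  show "C \<in> sets (samples n)"
    unfolding C(1) cylinder_decompose
    using counts_measurable[OF C(2)] countable_Int2[OF countable_supported]
    by (intro sets.countable_UN') auto
qed

lemma measurable_config_space:
  assumes "f \<in> space M \<rightarrow> configs"
    and "\<And>A B. A \<in> sets unit_leb \<Longrightarrow> B \<in> sets borel \<Longrightarrow> {w \<in> space M. emeasure (f w) A \<in> B} \<in> sets M"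
  shows "f \<in> measurable M config_space"
  unfolding config_space_def
proof (rule measurable_measure_of)
  fix Y assume "Y \<in> {{\<mu> \<in> configs. emeasure \<mu> A \<in> B} |A B. A \<in> sets unit_leb \<and> B \<in> sets borel}"
  then obtain A B where Y: "Y = {\<mu> \<in> configs. emeasure \<mu> A \<in> B}" "A \<in> sets unit_leb" "B \<in> sets borel" by blast
  have "f -` Y \<inter> space M = {w \<in> space M. emeasure (f w) A \<in> B}" using assms(1) by (auto simp: Y(1))
  then show "f -` Y \<inter> space M \<in> sets M" using assms(2)[OF Y(2,3)] by simp
qed (use assms(1) in auto)

lemma sets_samples: "sets (samples n) = sigma_sets (space (samples n)) (cylinders n)"
proof
  show "sigma_sets (space (samples n)) (cylinders n) \<subseteq> sets (samples n)"
    using cylinders_sets by (rule sets.sigma_sets_subset)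
  let ?\<Omega> = "space (samples n)"
  let ?S = "sigma ?\<Omega> (cylinders n)"
  have sub: "cylinders n \<subseteq> Pow ?\<Omega>" by (auto simp: cylinders_def)
  have "(\<lambda>\<nu>. \<nu>) \<in> measurable ?S (samples n)"
  proof (rule measurable_PiM_single')
    show "(\<lambda>\<nu>. \<nu>) \<in> space ?S \<rightarrow> ({..<n} \<rightarrow>\<^sub>E space config_space)"
      using sub by (auto simp: space_PiM space_measure_of)
    fix i assume i: "i \<in> {..<n}"
    show "(\<lambda>\<nu>. \<nu> i) \<in> measurable ?S config_space"
    proof (rule measurable_config_space)
      show "(\<lambda>\<nu>. \<nu> i) \<in> space ?S \<rightarrow> configs"
        using samples_component i sub by (auto simp: space_measure_of)
      fix A :: "real set" and B :: "ennreal set" assume Y: "A \<in> sets unit_leb"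
      let ?A = "\<lambda>l::nat. if l = 0 then A else {0..1} - A"
      have "{\<nu> \<in> space ?S. emeasure (\<nu> i) A \<in> B} = {\<nu> \<in> ?\<Omega>. counts n ?A 2 \<nu> \<in> {k. of_nat (k (i, 0)) \<in> B}}"
        using sub samples_component[of _ n i] i emeasure_count[OF _ Y]
        by (auto simp: counts_def space_measure_of)
      also have "\<dots> \<in> cylinders n" using partition_set[OF Y] unfolding cylinders_def by blast
      finally show "{\<nu> \<in> space ?S. emeasure (\<nu> i) A \<in> B} \<in> sets ?S" using sub by (simp add: sigma_sets.Basic)
    qed
  qed
  then show "sets (samples n) \<subseteq> sigma_sets ?\<Omega> (cylinders n)"
    using sub measurable_sets[of "\<lambda>\<nu>. \<nu>" ?S "samples n"] sets.sets_into_space[of _ "samples n"]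
    by (fastforce simp: space_measure_of Int_absorb2)
qed

section \<open>Comparison of two Poisson samples\<close>

text \<open>A cell on which the intensity has no mass has rate zero; its count is then the point mass at zero.\<close>

definition poisson0 :: "real \<Rightarrow> nat pmf" where
  "poisson0 a = (if 0 < a then poisson_pmf a else return_pmf 0)"

lemma pmf_poisson0: "0 \<le> a \<Longrightarrow> pmf (poisson0 a) k = a ^ k / fact k * exp (- a)"
  by (cases "a = 0") (auto simp: poisson0_def pmf_poisson power_0_left)

text \<open>The squared Poisson weight of rate \<open>c\<close>, divided by the weight of rate \<open>a\<close>, is a multiple of the Poisson
  weight of rate \<open>c\<^sup>2 / a\<close>. Identifying it with a probability distribution makes the chi-square divergence
  of a product of Poisson distributions computable without summing any series. For \<open>a = 0\<close> the
  quotients vanish by convention and both sides agree.\<close>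

lemma poisson_weight_sq:
  fixes a c :: real
  assumes a: "0 \<le> a" and c: "a = 0 \<Longrightarrow> c = 0" "0 \<le> c"
  shows "(c ^ k / fact k * exp (- c))\<^sup>2 = exp ((c - a)\<^sup>2 / a) * (a ^ k / fact k * exp (- a)) * pmf (poisson0 (c\<^sup>2 / a)) k"
proof (cases "a = 0")
  case True then show ?thesis using c by (cases k) (auto simp: pmf_poisson0)
next
  case False
  have "(c - a)\<^sup>2 / a - a - c\<^sup>2 / a = - (2 * c)" using False by (simp add: field_simps power2_eq_square)
  then have e: "exp ((c - a)\<^sup>2 / a) * exp (- a) * exp (- (c\<^sup>2 / a)) = exp (- (2 * c))"
    by (simp add: exp_add[symmetric] exp_diff[symmetric] flip: exp_minus)
  have "a ^ k * (c\<^sup>2 / a) ^ k = (c ^ k)\<^sup>2"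
    using False by (simp add: power_mult_distrib[symmetric] power_mult[symmetric] mult.commute power_even_eq[symmetric])
  moreover have "(exp (- c))\<^sup>2 = exp (- (2 * c))" by (simp add: exp_of_nat_mult[symmetric] power2_eq_square exp_add[symmetric])
  moreover have "exp ((c - a)\<^sup>2 / a) * (a ^ k / fact k * exp (- a)) * ((c\<^sup>2 / a) ^ k / fact k * exp (- (c\<^sup>2 / a))) =
     (exp ((c - a)\<^sup>2 / a) * exp (- a) * exp (- (c\<^sup>2 / a))) * (a ^ k * (c\<^sup>2 / a) ^ k) / (fact k)\<^sup>2"
    by (simp add: power2_eq_square)
  ultimately show ?thesis using a e by (simp add: pmf_poisson0 power_mult_distrib power_divide)
qed

lemma prob_counts:
  assumes ps: "poisson_sample n M N lam" and L2: "lam \<in> L2_fun" and nonneg: "AE x in unit_leb. 0 \<le> lam x"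
    and n: "0 < n" and A: "partition A r" and k: "k \<in> supported n r"
  shows "measure M {w \<in> space M. counts n A r (\<lambda>i\<in>{..<n}. N i w) = k} =
    (\<Prod>(i, l)\<in>{..<n} \<times> {..<r}. (LINT x:A l|unit_leb. lam x) ^ k (i, l) / fact (k (i, l)) * exp (- (LINT x:A l|unit_leb. lam x)))"
proof -
  interpret prob_space M using ps by (simp add: poisson_sample_def)
  have pp: "poisson_point_process M (N i) lam" if "i < n" for i
    using ps that L2 nonneg by unfold_locales (auto simp: poisson_sample_def)
  have r: "0 < r" using A by (cases r) (auto simp: partition_def)
  have Am: "A l \<in> sets unit_leb" if "l < r" for l using A that by (auto simp: partition_def)
  let ?R = "\<lambda>i. {\<mu> \<in> configs. \<forall>l\<in>{..<r}. points_in (A l) \<mu> = k (i, l)}"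
  have R: "?R i \<in> sets config_space" for i
  proof -
    have "{\<mu> \<in> space config_space. \<forall>l\<in>{..<r}. points_in (A l) \<mu> = k (i, l)} \<in> sets config_space"
    proof (rule sets.sets_Collect_finite_All)
      fix l assume "l \<in> {..<r}"
      then have "points_in (A l) \<in> measurable config_space (count_space UNIV)" using Am count_measurable by simp
      then show "{\<mu> \<in> space config_space. points_in (A l) \<mu> = k (i, l)} \<in> sets config_space" by measurable
    qed simp
    then show ?thesis by simp
  qed
  have one: "prob (N i -` ?R i \<inter> space M) = (\<Prod>l\<in>{..<r}. (LINT x:A l|unit_leb. lam x) ^ k (i, l) / fact (k (i, l)) * exp (- (LINT x:A l|unit_leb. lam x)))"
    if i: "i < n" for i
  proof -
    interpret P: poisson_point_process M "N i" lam by (rule pp[OF i])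
    have ind: "indep_vars (\<lambda>_. borel) (\<lambda>l w. measure (N i w) (A l)) {..<r}"
      using A by (intro P.indep_measure) (auto simp: partition_def)
    have cnt: "(\<lambda>w. measure (N i w) (A l)) -` {real (k (i, l))} \<inter> space M = {w \<in> space M. points_in (A l) (N i w) = k (i, l)}"
      if "l < r" for l using measure_count[OF P.X_config Am[OF that]] by auto
    have "N i -` ?R i \<inter> space M = (\<Inter>l\<in>{..<r}. (\<lambda>w. measure (N i w) (A l)) -` {real (k (i, l))} \<inter> space M)"
      using r cnt P.X_config by auto
    also have "prob \<dots> = (\<Prod>l\<in>{..<r}. prob ((\<lambda>w. measure (N i w) (A l)) -` {real (k (i, l))} \<inter> space M))"
      by (rule indep_varsD[OF ind]) (use r in auto)
    also have "\<dots> = (\<Prod>l\<in>{..<r}. (LINT x:A l|unit_leb. lam x) ^ k (i, l) / fact (k (i, l)) * exp (- (LINT x:A l|unit_leb. lam x)))"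
      using cnt P.prob_count[OF Am] by (intro prod.cong) (auto simp: P.mean_def)
    finally show ?thesis .
  qed
  have "{w \<in> space M. counts n A r (\<lambda>i\<in>{..<n}. N i w) = k} = (\<Inter>i\<in>{..<n}. N i -` ?R i \<inter> space M)"
  proof -
    have conf: "N i w \<in> configs" if "i < n" "w \<in> space M" for i w
      using poisson_point_process.X_config[OF pp[OF that(1)] that(2)] .
    have "counts n A r (\<lambda>i\<in>{..<n}. N i w) = k \<longleftrightarrow> (\<forall>i<n. \<forall>l<r. points_in (A l) (N i w) = k (i, l))" for w
      using k by (auto simp: counts_def supported_def fun_eq_iff)
    then show ?thesis using n conf by auto
  qed
  also have "prob \<dots> = (\<Prod>i\<in>{..<n}. prob (N i -` ?R i \<inter> space M))"
    by (rule indep_varsD[where I = "{..<n}" and M' = "\<lambda>_. config_space"]) (use ps n R in \<open>auto simp: poisson_sample_def\<close>)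
  also have "\<dots> = (\<Prod>i\<in>{..<n}. \<Prod>l\<in>{..<r}. (LINT x:A l|unit_leb. lam x) ^ k (i, l) / fact (k (i, l)) * exp (- (LINT x:A l|unit_leb. lam x)))"
    using one by (intro prod.cong) auto
  finally show ?thesis by (simp add: prod.cartesian_product)
qed

text \<open>The chi-square divergence is additive over the cells of a partition. In each cell the
  Cauchy-Schwarz inequality bounds the squared difference of the masses by the squared \<open>L2\<close> distance on the
  cell times its length, and the length is at most \<open>1 / c\<close> times the mass.\<close>

lemma chi_square_cells:
  assumes f: "f \<in> L2_fun" and g: "g \<in> L2_fun" and c: "0 < c" and ge: "\<And>x. x \<in> {0..1} \<Longrightarrow> c \<le> f x"
    and A: "partition A r"
  shows "(\<Sum>l<r. ((LINT x:A l|unit_leb. g x) - (LINT x:A l|unit_leb. f x))\<^sup>2 / (LINT x:A l|unit_leb. f x))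
     \<le> sqn (\<lambda>x. g x - f x) / c"
    and "\<And>l. l < r \<Longrightarrow> (LINT x:A l|unit_leb. f x) = 0 \<Longrightarrow> (LINT x:A l|unit_leb. g x) = 0"
proof -
  let ?h = "\<lambda>x. g x - f x"
  have h: "?h \<in> L2_fun" by (rule L2_fun_diff[OF g f])
  have ind: "indicator B \<in> L2_fun" if "B \<in> sets unit_leb" for B :: "real set"
    by (rule L2_fun_bounded[where B = 1]) (use that in \<open>auto simp: indicator_def\<close>)
  have Am: "A l \<in> sets unit_leb" if "l < r" for l using A that by (auto simp: partition_def)
  have inn: "(LINT x:B|unit_leb. u x) = L2_inner (indicator B) u" for B u
    by (simp add: L2_inner_def set_lebesgue_integral_def)
  let ?e = "\<lambda>l. LINT x|unit_leb. indicator (A l) x * (?h x * ?h x)"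
  have hB: "integrable unit_leb (\<lambda>x. indicator B x * (?h x * ?h x))" if "B \<in> sets unit_leb" for B :: "real set"
    by (rule Bochner_Integration.integrable_bound[OF L2_fun_sq_integrable[OF h]])
      (use that L2_funD[OF h] in \<open>auto simp: indicator_def intro!: borel_measurable_times borel_measurable_indicator\<close>)
  have cell: "((LINT x:A l|unit_leb. g x) - (LINT x:A l|unit_leb. f x))\<^sup>2 \<le> measure unit_leb (A l) * ?e l"
    and low: "c * measure unit_leb (A l) \<le> (LINT x:A l|unit_leb. f x)" if l: "l < r" for l
  proof -
    have ih: "(\<lambda>x. indicator (A l) x * ?h x) \<in> L2_fun"
    proof -
      have "(\<lambda>x. (indicator (A l) x * ?h x)\<^sup>2) = (\<lambda>x. indicator (A l) x * (?h x * ?h x))"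
        by (auto simp: indicator_def power2_eq_square)
      then have "integrable unit_leb (\<lambda>x. (indicator (A l) x * ?h x)\<^sup>2)"
        using hB[OF Am[OF l]] by (simp only:)
      then show ?thesis using L2_funD[OF h] Am[OF l] by (simp add: L2_fun_def)
    qed
    have e1: "sqn (\<lambda>x. indicator (A l) x * ?h x) = ?e l"
      unfolding L2_inner_def by (intro Bochner_Integration.integral_cong) (auto simp: indicator_def)
    have e2: "sqn (indicator (A l)) = measure unit_leb (A l)"
      unfolding L2_inner_def using Am[OF l] sets.sets_into_space[OF Am[OF l]]
      by (simp add: indicator_inter_arith[symmetric] Int_absorb2)
    have e3: "L2_inner (indicator (A l)) (\<lambda>x. indicator (A l) x * ?h x) = (LINT x:A l|unit_leb. g x) - (LINT x:A l|unit_leb. f x)"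
    proof -
      have "L2_inner (indicator (A l)) (\<lambda>x. indicator (A l) x * ?h x) = L2_inner (indicator (A l)) ?h"
        unfolding L2_inner_def by (intro Bochner_Integration.integral_cong) (auto simp: indicator_def)
      also have "\<dots> = L2_inner (indicator (A l)) g - L2_inner (indicator (A l)) f"
        using L2_inner_diff[OF g f ind[OF Am[OF l]]] by (simp add: L2_inner_commute)
      finally show ?thesis by (simp add: inn)
    qed
    show "((LINT x:A l|unit_leb. g x) - (LINT x:A l|unit_leb. f x))\<^sup>2 \<le> measure unit_leb (A l) * ?e l"
      using L2_Cauchy_Schwarz[OF ind[OF Am[OF l]] ih] unfolding e1 e2 e3 .
    have "(LINT x|unit_leb. indicator (A l) x * c) \<le> (LINT x|unit_leb. indicator (A l) x * f x)"
    proof (rule integral_mono)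
      show "integrable unit_leb (\<lambda>x. indicator (A l) x * c)" "integrable unit_leb (\<lambda>x. indicator (A l) x * f x)"
        using L2_fun_mult_integrable[OF ind[OF Am[OF l]] L2_fun_const[of c]]
          L2_fun_mult_integrable[OF ind[OF Am[OF l]] f] .
    qed (use ge in \<open>auto simp: indicator_def\<close>)
    then show "c * measure unit_leb (A l) \<le> (LINT x:A l|unit_leb. f x)"
      using Am[OF l] sets.sets_into_space[OF Am[OF l]]
      by (simp add: set_lebesgue_integral_def Int_absorb2 mult.commute)
  qed
  have e0: "0 \<le> ?e l" for l by (intro Bochner_Integration.integral_nonneg) auto
  have "((LINT x:A l|unit_leb. g x) - (LINT x:A l|unit_leb. f x))\<^sup>2 / (LINT x:A l|unit_leb. f x) \<le> ?e l / c" if l: "l < r" for l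
  proof (cases "(LINT x:A l|unit_leb. f x) = 0")
    case True then show ?thesis using e0[of l] c by simp
  next
    case False
    have "0 \<le> c * measure unit_leb (A l)" using c by simp
    then have pos: "0 < (LINT x:A l|unit_leb. f x)" using low[OF l] False by linarith
    have "c * ((LINT x:A l|unit_leb. g x) - (LINT x:A l|unit_leb. f x))\<^sup>2 \<le> c * (measure unit_leb (A l) * ?e l)"
      using cell[OF l] c by (intro mult_left_mono) auto
    also have "\<dots> \<le> (LINT x:A l|unit_leb. f x) * ?e l"
      using mult_right_mono[OF low[OF l] e0[of l]] by (simp add: mult.assoc)
    finally show ?thesis using pos c by (simp add: field_simps)
  qed
  then have "(\<Sum>l<r. ((LINT x:A l|unit_leb. g x) - (LINT x:A l|unit_leb. f x))\<^sup>2 / (LINT x:A l|unit_leb. f x)) \<le> (\<Sum>l<r. ?e l / c)"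
    by (intro sum_mono) auto
  also have "\<dots> = (\<Sum>l<r. ?e l) / c" by (simp add: sum_divide_distrib)
  also have "(\<Sum>l<r. ?e l) = sqn ?h"
  proof -
    have "(\<Sum>l<r. ?e l) = (LINT x|unit_leb. (\<Sum>l<r. indicator (A l) x * (?h x * ?h x)))"
      by (rule Bochner_Integration.integral_sum[symmetric]) (use hB Am in auto)
    also have "\<dots> = (LINT x|unit_leb. ?h x * ?h x)"
    proof (intro Bochner_Integration.integral_cong refl)
      fix x assume x: "x \<in> space unit_leb"
      have "(\<Sum>l<r. indicator (A l) x) = (indicator (\<Union>l<r. A l) x :: real)"
        using A by (intro indicator_UN_disjoint[symmetric]) (auto simp: partition_def)
      also have "\<dots> = 1" using A x by (simp add: partition_def)
      finally show "(\<Sum>l<r. indicator (A l) x * (?h x * ?h x)) = ?h x * ?h x"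
        unfolding sum_distrib_right[symmetric] by simp
    qed
    finally show ?thesis by (simp add: L2_inner_def)
  qed
  finally show "(\<Sum>l<r. ((LINT x:A l|unit_leb. g x) - (LINT x:A l|unit_leb. f x))\<^sup>2 / (LINT x:A l|unit_leb. f x))
     \<le> sqn (\<lambda>x. g x - f x) / c" .
  show "(LINT x:A l|unit_leb. g x) = 0" if l: "l < r" and z: "(LINT x:A l|unit_leb. f x) = 0" for l
  proof -
    have "measure unit_leb (A l) = 0" using low[OF l] z c by (smt (verit) measure_nonneg mult_pos_pos)
    then show ?thesis using cell[OF l] z by simp
  qed
qed

text \<open>On events that depend on the counts in a finite partition, write \<open>q\<close> and \<open>p\<close> for the weights under
  the two intensities. Then \<open>q\<^sup>2 = X * p * r\<close> with a probability weight \<open>r\<close> and \<open>X \<le> exp 1 \<le> 3\<close>, hence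
  \<open>q \<le> p + 3/4 * r\<close> by the inequality of the means, and summation gives the claim. Being an inequality between two
  measures, it extends by approximation to all events of the generated sigma-algebra.\<close>

theorem poisson_sample_comparison:
  assumes pf: "poisson_sample n M N f" and pg: "poisson_sample n M' N g" and n: "0 < n"
    and f: "f \<in> L2_fun" and g: "g \<in> L2_fun" and c: "0 < c"
    and fc: "\<And>x. x \<in> {0..1} \<Longrightarrow> c \<le> f x" and gc: "\<And>x. x \<in> {0..1} \<Longrightarrow> c \<le> g x"
    and close: "real n * sqn (\<lambda>x. g x - f x) \<le> c"
    and E: "E \<in> sets (samples n)"
  shows "measure M' {w \<in> space M'. (\<lambda>i\<in>{..<n}. N i w) \<in> E} \<le> measure M {w \<in> space M. (\<lambda>i\<in>{..<n}. N i w) \<in> E} + 3 / 4"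
proof -
  let ?\<nu> = "\<lambda>w. \<lambda>i\<in>{..<n}. N i w"
  interpret M: prob_space M using pf by (simp add: poisson_sample_def)
  interpret M': prob_space M' using pg by (simp add: poisson_sample_def)
  have Nm: "N i \<in> measurable M config_space" "N i \<in> measurable M' config_space" if "i < n" for i
    using pf pg that by (auto simp: poisson_sample_def poisson_process_def)
  have \<nu>m: "?\<nu> \<in> measurable M (samples n)" "?\<nu> \<in> measurable M' (samples n)"
    using Nm by (auto intro!: measurable_restrict)
  let ?P = "distr M (samples n) ?\<nu>" and ?Q = "distr M' (samples n) ?\<nu>"
  have P: "measure ?P B = measure M {w \<in> space M. ?\<nu> w \<in> B}" "measure ?Q B = measure M' {w \<in> space M'. ?\<nu> w \<in> B}"
    if "B \<in> sets (samples n)" for B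
    using that by (auto simp: measure_distr[OF \<nu>m(1)] measure_distr[OF \<nu>m(2)] intro!: arg_cong[where f = "measure _"])
  have "measure ?Q E \<le> measure ?P E + 3 / 4"
  proof (rule measure_le_from_algebra[where \<C> = "cylinders n"])
    show "finite_measure ?P" "finite_measure ?Q"
      using M.prob_space_distr[OF \<nu>m(1)] M'.prob_space_distr[OF \<nu>m(2)] by (auto simp: prob_space.finite_measure)
    show "sets ?P = sigma_sets (space ?P) (cylinders n)" by (simp add: sets_samples)
    show "cylinders n \<subseteq> Pow (space ?P)" by (auto simp: cylinders_def)
    show "{} \<in> cylinders n" by (rule cylinders_closed)
    show "space ?P - C \<in> cylinders n" if "C \<in> cylinders n" for C using cylinders_closed(2)[OF that] by simp
    show "C \<union> D \<in> cylinders n" if "C \<in> cylinders n" "D \<in> cylinders n" for C D using cylinders_closed(3)[OF that] .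
    show "E \<in> sets ?P" using E by simp
    fix C assume C: "C \<in> cylinders n"
    then obtain A r K where CK: "C = {\<nu> \<in> space (samples n). counts n A r \<nu> \<in> K}" and A: "partition A r"
      by (auto simp: cylinders_def)
    let ?I = "{..<n} \<times> {..<r}" and ?S = "K \<inter> supported n r"
    define a b where "a l = (LINT x:A l|unit_leb. f x)" and "b l = (LINT x:A l|unit_leb. g x)" for l
    define p where "p k = (\<Prod>(i, l)\<in>?I. a l ^ k (i, l) / fact (k (i, l)) * exp (- a l))" for k
    define q where "q k = (\<Prod>(i, l)\<in>?I. b l ^ k (i, l) / fact (k (i, l)) * exp (- b l))" for k
    define R where "R = Pi_pmf ?I 0 (\<lambda>(i, l). poisson0 ((b l)\<^sup>2 / a l))"
    have fg: "0 \<le> f x" "0 \<le> g x" if "x \<in> {0..1}" for x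
      using c fc[OF that] gc[OF that] by linarith+
    have a0: "0 \<le> a l" "0 \<le> b l" for l
      unfolding a_def b_def set_lebesgue_integral_def using fg
      by (auto intro!: integral_nonneg_AE AE_I2 simp: indicator_def)
    have p0: "0 \<le> p k" "0 \<le> q k" for k unfolding p_def q_def using a0 by (auto intro!: prod_nonneg)
    have pr: "emeasure ?P {\<nu> \<in> space (samples n). counts n A r \<nu> = k} = ennreal (p k)"
      "emeasure ?Q {\<nu> \<in> space (samples n). counts n A r \<nu> = k} = ennreal (q k)" if k: "k \<in> ?S" for k
    proof -
      have nn: "AE x in unit_leb. 0 \<le> f x" "AE x in unit_leb. 0 \<le> g x"
        using fg by (auto intro!: AE_I2)
      have sp: "{w \<in> space M. ?\<nu> w \<in> {\<nu> \<in> space (samples n). counts n A r \<nu> = k}} = {w \<in> space M. counts n A r (?\<nu> w) = k}"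
        "{w \<in> space M'. ?\<nu> w \<in> {\<nu> \<in> space (samples n). counts n A r \<nu> = k}} = {w \<in> space M'. counts n A r (?\<nu> w) = k}"
        using measurable_space[OF \<nu>m(1)] measurable_space[OF \<nu>m(2)] by auto
      have "measure ?P {\<nu> \<in> space (samples n). counts n A r \<nu> = k} = p k"
        "measure ?Q {\<nu> \<in> space (samples n). counts n A r \<nu> = k} = q k"
        unfolding P[OF counts_measurable[OF A]] sp p_def q_def a_def b_def
        using prob_counts[OF pf f nn(1) n A] prob_counts[OF pg g nn(2) n A] k by auto
      then show "emeasure ?P {\<nu> \<in> space (samples n). counts n A r \<nu> = k} = ennreal (p k)"
        "emeasure ?Q {\<nu> \<in> space (samples n). counts n A r \<nu> = k} = ennreal (q k)"
        using finite_measure.emeasure_eq_measure[of ?P] finite_measure.emeasure_eq_measure[of ?Q]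
          M.prob_space_distr[OF \<nu>m(1)] M'.prob_space_distr[OF \<nu>m(2)] by (auto simp: prob_space.finite_measure)
    qed
    have qle: "q k \<le> p k + 3 / 4 * pmf R k" if k: "k \<in> ?S" for k
    proof -
      have sq: "(q k)\<^sup>2 = (\<Prod>(i, l)\<in>?I. exp ((b l - a l)\<^sup>2 / a l)) * p k * pmf R k"
      proof -
        have "(q k)\<^sup>2 = (\<Prod>(i, l)\<in>?I. (b l ^ k (i, l) / fact (k (i, l)) * exp (- b l))\<^sup>2)"
          by (simp add: q_def prod_power_distrib case_prod_unfold)
        also have "\<dots> = (\<Prod>(i, l)\<in>?I. exp ((b l - a l)\<^sup>2 / a l) * (a l ^ k (i, l) / fact (k (i, l)) * exp (- a l)) * pmf (poisson0 ((b l)\<^sup>2 / a l)) (k (i, l)))"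
        proof (rule prod.cong[OF refl])
          fix z assume "z \<in> ?I"
          then obtain i l where z: "z = (i, l)" "l < r" by auto
          have "a l = 0 \<Longrightarrow> b l = 0" unfolding a_def b_def by (rule chi_square_cells(2)[OF f g c fc A z(2)])
          then show "(case z of (i, l) \<Rightarrow> (b l ^ k (i, l) / fact (k (i, l)) * exp (- b l))\<^sup>2) =
            (case z of (i, l) \<Rightarrow> exp ((b l - a l)\<^sup>2 / a l) * (a l ^ k (i, l) / fact (k (i, l)) * exp (- a l)) * pmf (poisson0 ((b l)\<^sup>2 / a l)) (k (i, l)))"
            unfolding z prod.case by (intro poisson_weight_sq a0)
        qed
        also have "\<dots> = (\<Prod>(i, l)\<in>?I. exp ((b l - a l)\<^sup>2 / a l)) * p k * (\<Prod>(i, l)\<in>?I. pmf (poisson0 ((b l)\<^sup>2 / a l)) (k (i, l)))"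
          unfolding p_def prod.distrib[symmetric] by (simp add: case_prod_unfold)
        also have "(\<Prod>(i, l)\<in>?I. pmf (poisson0 ((b l)\<^sup>2 / a l)) (k (i, l))) = pmf R k"
        proof -
          have "\<forall>z. z \<notin> ?I \<longrightarrow> k z = 0" using k by (auto simp: supported_def)
          then show ?thesis unfolding R_def by (subst pmf_Pi) (auto simp: case_prod_unfold)
        qed
        finally show ?thesis .
      qed
      have "(\<Prod>(i, l)\<in>?I. exp ((b l - a l)\<^sup>2 / a l)) = exp (\<Sum>(i, l)\<in>?I. (b l - a l)\<^sup>2 / a l)"
        by (simp add: exp_sum case_prod_unfold)
      also have "(\<Sum>(i, l)\<in>?I. (b l - a l)\<^sup>2 / a l) = real n * (\<Sum>l<r. (b l - a l)\<^sup>2 / a l)"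
        by (simp add: sum.cartesian_product[symmetric])
      also have "\<dots> \<le> real n * (sqn (\<lambda>x. g x - f x) / c)"
        using chi_square_cells(1)[OF f g c fc A] by (intro mult_left_mono) (auto simp: a_def b_def)
      also have "\<dots> \<le> 1" using close c by (simp add: field_simps)
      finally have X: "(\<Prod>(i, l)\<in>?I. exp ((b l - a l)\<^sup>2 / a l)) \<le> 3" using exp_le by (meson exp_le_cancel_iff order_trans)
      have "(q k)\<^sup>2 \<le> 3 * (p k * pmf R k)"
        unfolding sq mult.assoc by (intro mult_right_mono X) (use p0 in auto)
      also have "\<dots> \<le> (p k + 3 / 4 * pmf R k)\<^sup>2"
        using sum_squares_bound[of "p k" "3/4 * pmf R k"] by (simp add: power2_sum power2_eq_square algebra_simps)
      finally show ?thesis by (rule power2_le_imp_le) (use p0 in auto)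
    qed
    have cnt: "countable ?S" by (rule countable_Int2[OF countable_supported])
    have dis: "disjoint_family_on (\<lambda>k. {\<nu> \<in> space (samples n). counts n A r \<nu> = k}) ?S"
      by (auto simp: disjoint_family_on_def)
    have cm: "{\<nu> \<in> space (samples n). counts n A r \<nu> = k} \<in> sets (distr L (samples n) ?\<nu>)" for k L
      using counts_measurable[OF A] by simp
    have "emeasure ?Q C = (\<integral>\<^sup>+k. ennreal (q k) \<partial>count_space ?S)"
      unfolding CK cylinder_decompose
      by (subst emeasure_UN_countable[OF cm cnt dis]) (use pr in \<open>auto intro!: nn_integral_cong\<close>)
    also have "\<dots> \<le> (\<integral>\<^sup>+k. ennreal (p k) + ennreal (3 / 4) * ennreal (pmf R k) \<partial>count_space ?S)"
    proof (rule nn_integral_mono)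
      fix k assume "k \<in> space (count_space ?S)"
      then have "ennreal (q k) \<le> ennreal (p k + 3 / 4 * pmf R k)" using qle by (intro ennreal_leI) auto
      then show "ennreal (q k) \<le> ennreal (p k) + ennreal (3 / 4) * ennreal (pmf R k)"
        using ennreal_plus[OF p0(1)[of k], of "3 / 4 * pmf R k"] ennreal_mult[of "3 / 4" "pmf R k"]
        by (simp only: mult_nonneg_nonneg pmf_nonneg divide_nonneg_nonneg zero_le_numeral)
    qed
    also have "\<dots> = (\<integral>\<^sup>+k. ennreal (p k) \<partial>count_space ?S) + ennreal (3 / 4) * (\<integral>\<^sup>+k. ennreal (pmf R k) \<partial>count_space ?S)"
      by (simp add: nn_integral_add nn_integral_cmult)
    also have "(\<integral>\<^sup>+k. ennreal (p k) \<partial>count_space ?S) = emeasure ?P C"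
      unfolding CK cylinder_decompose
      by (subst emeasure_UN_countable[OF cm cnt dis]) (use pr in \<open>auto intro!: nn_integral_cong\<close>)
    finally have i1: "emeasure ?Q C \<le> emeasure ?P C + ennreal (3 / 4) * (\<integral>\<^sup>+k. ennreal (pmf R k) \<partial>count_space ?S)" .
    have "(\<integral>\<^sup>+k. ennreal (pmf R k) \<partial>count_space ?S) \<le> 1"
      unfolding nn_integral_pmf by (rule measure_pmf.emeasure_le_1)
    then have "emeasure ?P C + ennreal (3 / 4) * (\<integral>\<^sup>+k. ennreal (pmf R k) \<partial>count_space ?S) \<le> emeasure ?P C + ennreal (3 / 4) * 1"
      by (intro add_left_mono mult_left_mono) auto
    from order_trans[OF i1 this] have "emeasure ?Q C \<le> emeasure ?P C + ennreal (3 / 4)" by (simp only: mult_1_right)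
    then have "ennreal (measure ?Q C) \<le> ennreal (measure ?P C + 3 / 4)"
      using finite_measure.emeasure_eq_measure[of ?P] finite_measure.emeasure_eq_measure[of ?Q]
        M.prob_space_distr[OF \<nu>m(1)] M'.prob_space_distr[OF \<nu>m(2)] by (simp add: prob_space.finite_measure ennreal_plus)
    then show "measure ?Q C \<le> measure ?P C + 3 / 4" by (subst (asm) ennreal_le_iff) auto
  qed simp
  then show ?thesis using P[OF E] by simp
qed

section \<open>Fejer bumps\<close>

lemma sum_symmetric_int:
  "(\<Sum>j\<in>{- int k..int k}. F j) = F 0 + (\<Sum>j<k. F (int (Suc j)) + F (- int (Suc j)) :: real)"
proof (induction k)
  case (Suc k)
  have "{- int (Suc k)..int (Suc k)} = insert (- int (Suc k)) (insert (int (Suc k)) {- int k..int k})" by auto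
  then show ?case using Suc by simp
qed simp

lemma trig_pair:
  "trig_basis (int (Suc j)) x * trig_basis (int (Suc j)) y + trig_basis (- int (Suc j)) x * trig_basis (- int (Suc j)) y
     = 2 * cos (2 * pi * real (Suc j) * (x - y))"
proof -
  have "cos (2 * pi * real (Suc j) * (x - y)) = cos (2 * pi * real (Suc j) * x - 2 * pi * real (Suc j) * y)"
    by (simp only: right_diff_distrib)
  then show ?thesis
    unfolding cos_diff by (simp add: trig_basis_def sqrt2_mult del: of_nat_Suc)
qed

lemma trig_kernel:
  "(\<Sum>j\<in>{- int k..int k}. w (nat \<bar>j\<bar>) * (trig_basis j x * trig_basis j y)) =
    2 * (\<Sum>j<Suc k. w j * cos (2 * pi * real j * (x - y))) - w 0"
proof -
  have "(\<Sum>j\<in>{- int k..int k}. w (nat \<bar>j\<bar>) * (trig_basis j x * trig_basis j y)) =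
     w 0 + (\<Sum>j<k. w (Suc j) * (trig_basis (int (Suc j)) x * trig_basis (int (Suc j)) y
        + trig_basis (- int (Suc j)) x * trig_basis (- int (Suc j)) y))"
    unfolding sum_symmetric_int by (simp add: trig_zero_val ring_distribs nat_add_distrib del: of_nat_Suc)
  also have "\<dots> = w 0 + (\<Sum>j<k. w (Suc j) * (2 * cos (2 * pi * real (Suc j) * (x - y))))"
    unfolding trig_pair ..
  also have "\<dots> = 2 * (\<Sum>j<Suc k. w j * cos (2 * pi * real j * (x - y))) - w 0"
    unfolding sum.lessThan_Suc_shift by (simp add: sum_distrib_left mult_ac del: of_nat_Suc)
  finally show ?thesis .
qed

lemma fejer_identity:
  "(\<Sum>j<M. cos (real j * z))\<^sup>2 + (\<Sum>j<M. sin (real j * z))\<^sup>2 =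
     2 * (\<Sum>j<M. (real M - real j) * cos (real j * z)) - real M"
proof (induction M)
  case (Suc M)
  let ?K = "\<Sum>j<M. cos (real j * z)" and ?S = "\<Sum>j<M. sin (real j * z)"
  have "?K * cos (real M * z) + ?S * sin (real M * z) = (\<Sum>j<M. cos (real M * z - real j * z))"
  proof -
    have "(\<Sum>j<M. cos (real M * z - real j * z)) =
        (\<Sum>j<M. cos (real j * z) * cos (real M * z) + sin (real j * z) * sin (real M * z))"
      by (intro sum.cong refl) (simp add: cos_diff mult.commute)
    then show ?thesis by (simp only: sum.distrib sum_distrib_right)
  qed
  also have "\<dots> = (\<Sum>j<M. cos (real (Suc (M - Suc j)) * z))"
    by (intro sum.cong refl) (auto simp: of_nat_diff algebra_simps)
  also have "\<dots> = (\<Sum>j<M. cos (real (Suc j) * z))"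
    by (rule sum.nat_diff_reindex)
  finally have cross: "?K * cos (real M * z) + ?S * sin (real M * z) = (\<Sum>j<M. cos (real (Suc j) * z))" .
  have "(\<Sum>j<Suc M. cos (real j * z))\<^sup>2 + (\<Sum>j<Suc M. sin (real j * z))\<^sup>2 =
      (?K\<^sup>2 + ?S\<^sup>2) + 2 * (?K * cos (real M * z) + ?S * sin (real M * z)) + ((cos (real M * z))\<^sup>2 + (sin (real M * z))\<^sup>2)"
    by (simp add: power2_sum algebra_simps)
  also have "\<dots> = 2 * (\<Sum>j<M. (real M - real j) * cos (real j * z)) - real M + 2 * (\<Sum>j<M. cos (real (Suc j) * z)) + 1"
    unfolding cross Suc.IH by (simp add: sin_cos_squared_add2)
  also have "(\<Sum>j<M. cos (real (Suc j) * z)) = (\<Sum>j<Suc M. cos (real j * z)) - 1"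
    unfolding sum.lessThan_Suc_shift by simp
  also have "2 * (\<Sum>j<M. (real M - real j) * cos (real j * z)) - real M + 2 * ((\<Sum>j<Suc M. cos (real j * z)) - 1) + 1
     = 2 * ((\<Sum>j<Suc M. (real M - real j) * cos (real j * z)) + (\<Sum>j<Suc M. cos (real j * z))) - real (Suc M)"
    by simp
  also have "(\<Sum>j<Suc M. (real M - real j) * cos (real j * z)) + (\<Sum>j<Suc M. cos (real j * z)) =
     (\<Sum>j<Suc M. (real (Suc M) - real j) * cos (real j * z))"
    unfolding sum.distrib[symmetric] by (intro sum.cong refl) (simp add: algebra_simps)
  finally show ?case .
qed simp

lemma roots_of_unity_sum:
  assumes M: "0 < M" and d: "\<not> int M dvd d"
  shows "(\<Sum>j<M. cos (real j * (2 * pi * of_int d / real M))) = 0"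
    "(\<Sum>j<M. sin (real j * (2 * pi * of_int d / real M))) = 0"
proof -
  define z where "z = cis (2 * pi * of_int d / real M)"
  have "z ^ M = cis (real M * (2 * pi * of_int d / real M))" unfolding z_def by (rule Complex.DeMoivre)
  also have "\<dots> = cis (2 * pi * of_int d)" using M by simp
  also have "\<dots> = 1" by (simp add: complex_eq_iff cos_int_2pin sin_int_2pin)
  finally have zM: "z ^ M = 1" .
  have "z \<noteq> 1"
  proof
    assume "z = 1"
    then have "cos (2 * pi * of_int d / real M) = 1" by (simp add: z_def complex_eq_iff)
    then obtain n :: int where n: "2 * pi * of_int d / real M = of_int n * 2 * pi" unfolding cos_one_2pi_int by blast
    have "real_of_int d = of_int n * real M"
    proof -
      have "2 * pi * of_int d = 2 * pi * (of_int n * real M)" using n M by (simp add: field_simps)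
      then show ?thesis by simp
    qed
    then have "real_of_int d = real_of_int (n * int M)" by simp
    then have "d = n * int M" by (simp only: of_int_eq_iff)
    then show False using d by simp
  qed
  then have "(\<Sum>j<M. z ^ j) = 0" using zM by (simp add: geometric_sum)
  then have "(\<Sum>j<M. cis (real j * (2 * pi * of_int d / real M))) = 0" by (simp only: z_def Complex.DeMoivre)
  then have "Re (\<Sum>j<M. cis (real j * (2 * pi * of_int d / real M))) = 0" "Im (\<Sum>j<M. cis (real j * (2 * pi * of_int d / real M))) = 0"
    by simp_all
  then show "(\<Sum>j<M. cos (real j * (2 * pi * of_int d / real M))) = 0"
    "(\<Sum>j<M. sin (real j * (2 * pi * of_int d / real M))) = 0" by simp_all
qed

text \<open>The Fejer kernel of degree \<open>M - 1\<close>, normalized to the value 1 at zero and written as a sum of squares.\<close>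

definition bump :: "nat \<Rightarrow> real \<Rightarrow> real" where
  "bump M x = ((\<Sum>j<M. cos (real j * (2 * pi * x)))\<^sup>2 + (\<Sum>j<M. sin (real j * (2 * pi * x)))\<^sup>2) / (real M)\<^sup>2"

abbreviation "node k m \<equiv> real m / real (Suc k)"

lemma bump_nonneg: "0 \<le> bump M x" by (simp add: bump_def)

definition fejer :: "nat \<Rightarrow> int \<Rightarrow> real" where
  "fejer k j = (1 - real_of_int \<bar>j\<bar> / real (Suc k)) / real (Suc k)"

lemma bump_expand:
  "bump (Suc k) (x - y) = (\<Sum>j\<in>{- int k..int k}. fejer k j * trig_basis j y * trig_basis j x)"
proof -
  let ?M = "real (Suc k)"
  have "(\<Sum>j\<in>{- int k..int k}. fejer k j * trig_basis j y * trig_basis j x) =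
     (\<Sum>j\<in>{- int k..int k}. (\<lambda>i. (1 - real i / ?M) / ?M) (nat \<bar>j\<bar>) * (trig_basis j x * trig_basis j y))"
    by (intro sum.cong) (auto simp: fejer_def mult_ac)
  also have "\<dots> = 2 * (\<Sum>j<Suc k. (1 - real j / ?M) / ?M * cos (2 * pi * real j * (x - y))) - (1 - real 0 / ?M) / ?M"
    by (rule trig_kernel)
  also have "(\<Sum>j<Suc k. (1 - real j / ?M) / ?M * cos (2 * pi * real j * (x - y))) =
     (\<Sum>j<Suc k. (?M - real j) * cos (real j * (2 * pi * (x - y))) / ?M\<^sup>2)"
    by (intro sum.cong refl) (simp add: field_simps power2_eq_square del: of_nat_Suc)
  also have "\<dots> = (\<Sum>j<Suc k. (?M - real j) * cos (real j * (2 * pi * (x - y)))) / ?M\<^sup>2"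
    by (simp only: sum_divide_distrib)
  also have "2 * ((\<Sum>j<Suc k. (?M - real j) * cos (real j * (2 * pi * (x - y)))) / ?M\<^sup>2) - (1 - real 0 / ?M) / ?M
    = (2 * (\<Sum>j<Suc k. (?M - real j) * cos (real j * (2 * pi * (x - y)))) - ?M) / ?M\<^sup>2"
    by (simp add: field_simps power2_eq_square del: of_nat_Suc sum.lessThan_Suc)
  also have "\<dots> = bump (Suc k) (x - y)"
    unfolding bump_def fejer_identity ..
  finally show ?thesis ..
qed

lemma node_diff_dvd:
  assumes "m \<le> k" "l \<le> k" "m \<noteq> l" shows "\<not> int (Suc k) dvd (int m - int l)"
proof
  assume "int (Suc k) dvd (int m - int l)"
  then have "int (Suc k) \<le> \<bar>int m - int l\<bar>" using assms(3) by (intro zdvd_imp_le) auto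
  then show False using assms by auto
qed

lemma bump_node:
  assumes "m \<le> k" "l \<le> k" shows "bump (Suc k) (node k m - node k l) = (if m = l then 1 else 0)"
proof (cases "m = l")
  case True then show ?thesis by (simp add: bump_def del: of_nat_Suc sum.lessThan_Suc)
next
  case False
  have e: "2 * pi * (node k m - node k l) = 2 * pi * of_int (int m - int l) / real (Suc k)"
    by (simp add: diff_divide_distrib right_diff_distrib)
  show ?thesis
    unfolding bump_def e using roots_of_unity_sum[OF _ node_diff_dvd[OF assms False]] False by simp
qed

lemma trig_node_sum:
  assumes "j \<in> {- int k..int k}"
  shows "(\<Sum>m<Suc k. trig_basis j (node k m)) = (if j = 0 then real (Suc k) else 0)"
proof -
  have e: "2 * pi * of_int i * node k m = real m * (2 * pi * of_int i / real (Suc k))" for i m by simp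
  have nd: "\<not> int (Suc k) dvd i" if "i \<noteq> 0" "\<bar>i\<bar> \<le> int k" for i
  proof
    assume "int (Suc k) dvd i"
    then have "int (Suc k) \<le> \<bar>i\<bar>" using that by (intro zdvd_imp_le) auto
    then show False using that by simp
  qed
  consider "j = 0" | "0 < j" | "j < 0" by linarith
  then show ?thesis
  proof cases
    case 1 then show ?thesis by (simp add: trig_basis_def)
  next
    case 2
    then have "(\<Sum>m<Suc k. trig_basis j (node k m)) = sqrt 2 * (\<Sum>m<Suc k. cos (real m * (2 * pi * of_int j / real (Suc k))))"
      unfolding sum_distrib_left by (intro sum.cong refl) (simp only: trig_basis_def e if_False if_True less_imp_neq[symmetric])
    then show ?thesis using roots_of_unity_sum(1)[of "Suc k" j] nd[of j] 2 assms by simp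
  next
    case 3
    then have j: "(j = 0) = False" "(0 < j) = False" by auto
    have "(\<Sum>m<Suc k. trig_basis j (node k m)) = sqrt 2 * (\<Sum>m<Suc k. sin (real m * (2 * pi * of_int (- j) / real (Suc k))))"
      unfolding sum_distrib_left by (intro sum.cong refl) (simp only: trig_basis_def e if_False if_True j)
    then show ?thesis using roots_of_unity_sum(2)[of "Suc k" "-j"] nd[of "-j"] 3 assms by simp
  qed
qed

text \<open>Only the constant Fourier mode survives summation over equidistant nodes.\<close>

lemma bump_partition_of_unity: "(\<Sum>m<Suc k. bump (Suc k) (x - node k m)) = 1"
proof -
  have "(\<Sum>m<Suc k. bump (Suc k) (x - node k m)) =
     (\<Sum>m<Suc k. \<Sum>j\<in>{- int k..int k}. fejer k j * trig_basis j (node k m) * trig_basis j x)"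
    unfolding bump_expand ..
  also have "\<dots> = (\<Sum>j\<in>{- int k..int k}. \<Sum>m<Suc k. fejer k j * trig_basis j (node k m) * trig_basis j x)"
    by (rule sum.swap)
  also have "\<dots> = (\<Sum>j\<in>{- int k..int k}. fejer k j * trig_basis j x * (\<Sum>m<Suc k. trig_basis j (node k m)))"
    by (intro sum.cong refl) (simp only: sum_distrib_left mult_ac)
  also have "\<dots> = (\<Sum>j\<in>{- int k..int k}. if j = 0 then 1 else 0)"
    by (intro sum.cong refl) (auto simp: trig_node_sum fejer_def trig_zero_val simp del: of_nat_Suc sum.lessThan_Suc)
  also have "\<dots> = 1" by simp
  finally show ?thesis .
qed

lemma bump_sum_le:
  assumes "\<theta> \<subseteq> {..k}" shows "(\<Sum>m\<in>\<theta>. bump (Suc k) (x - node k m)) \<le> 1"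
proof -
  have "(\<Sum>m\<in>\<theta>. bump (Suc k) (x - node k m)) \<le> (\<Sum>m<Suc k. bump (Suc k) (x - node k m))"
    using assms by (intro sum_mono2) (auto simp: bump_nonneg lessThan_Suc_atMost)
  then show ?thesis using bump_partition_of_unity by simp
qed

section \<open>Sampling inequality\<close>

text \<open>The value at a node of the Fourier partial sum of degree \<open>k\<close>: a functional that is continuous on the space of
  square-integrable functions and agrees with evaluation on trigonometric polynomials of degree \<open>k\<close>.\<close>

definition evaluate :: "nat \<Rightarrow> nat \<Rightarrow> (real \<Rightarrow> real) \<Rightarrow> real" where
  "evaluate k m f = (\<Sum>j\<in>{- int k..int k}. L2_inner f (trig_basis j) * trig_basis j (node k m))"

lemma dirichlet_node:
  assumes "m \<le> k" "l \<le> k"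
  shows "(\<Sum>j\<in>{- int k..int k}. trig_basis j (node k m) * trig_basis j (node k l)) = (if m = l then 2 * real (Suc k) - 1 else - 1)"
proof -
  have "(\<Sum>j\<in>{- int k..int k}. trig_basis j (node k m) * trig_basis j (node k l)) =
      2 * (\<Sum>j<Suc k. cos (2 * pi * real j * (node k m - node k l))) - 1"
    using trig_kernel[of "\<lambda>_. 1" "node k m" "node k l" k] by simp
  also have "(\<Sum>j<Suc k. cos (2 * pi * real j * (node k m - node k l))) = (if m = l then real (Suc k) else 0)"
  proof (cases "m = l")
    case False
    have e: "2 * pi * real j * (node k m - node k l) = real j * (2 * pi * of_int (int m - int l) / real (Suc k))" for j
      by (simp add: diff_divide_distrib right_diff_distrib mult.commute mult.left_commute)
    show ?thesis unfolding e using roots_of_unity_sum(1)[OF _ node_diff_dvd[OF assms False]] False by simp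
  qed (simp del: of_nat_Suc sum.lessThan_Suc)
  finally show ?thesis by simp
qed

text \<open>The matrix \<open>B\<close> of values of the basis functions at the \<open>k + 1\<close> nodes has \<open>B * B\<^sup>T = 2 * (k + 1) * 1 - J\<close> with
  \<open>J\<close> the all-ones matrix, so its squared operator norm is at most \<open>2 * (k + 1)\<close>. With \<open>S\<close> the image of the values
  under the transpose, the Cauchy-Schwarz inequality yields the bound without spectral theory.\<close>

lemma sampling_inequality:
  assumes f: "f \<in> L2_fun"
  shows "(\<Sum>m\<le>k. (evaluate k m f)\<^sup>2) \<le> 2 * real (Suc k) * sqn f"
proof -
  let ?J = "{- int k..int k}" and ?t = "\<lambda>m. evaluate k m f" and ?c = "\<lambda>j. L2_inner f (trig_basis j)"
  let ?S = "\<lambda>j. \<Sum>m\<le>k. ?t m * trig_basis j (node k m)"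
  define X where "X = (\<Sum>m\<le>k. (?t m)\<^sup>2)"
  have X0: "0 \<le> X" by (simp add: X_def sum_nonneg)
  have "X = (\<Sum>m\<le>k. \<Sum>j\<in>?J. ?t m * (?c j * trig_basis j (node k m)))"
    unfolding X_def power2_eq_square by (subst (2) evaluate_def) (simp only: sum_distrib_left)
  also have "\<dots> = (\<Sum>j\<in>?J. ?c j * ?S j)"
    by (subst sum.swap) (simp only: sum_distrib_left mult_ac)
  finally have "X\<^sup>2 \<le> (\<Sum>j\<in>?J. (?c j)\<^sup>2) * (\<Sum>j\<in>?J. (?S j)\<^sup>2)"
    using Cauchy_Schwarz_ineq_sum[of ?c ?S ?J] by simp
  also have "(\<Sum>j\<in>?J. (?S j)\<^sup>2) \<le> 2 * real (Suc k) * X"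
  proof -
    have "(\<Sum>j\<in>?J. (?S j)\<^sup>2) = (\<Sum>j\<in>?J. \<Sum>m\<le>k. \<Sum>l\<le>k. ?t m * ?t l * (trig_basis j (node k m) * trig_basis j (node k l)))"
      unfolding power2_eq_square sum_product by (intro sum.cong refl) (simp only: mult_ac)
    also have "\<dots> = (\<Sum>m\<le>k. \<Sum>l\<le>k. ?t m * ?t l * (\<Sum>j\<in>?J. trig_basis j (node k m) * trig_basis j (node k l)))"
      unfolding sum_distrib_left by (subst sum.swap, intro sum.cong refl, subst sum.swap) simp
    also have "\<dots> = (\<Sum>m\<le>k. \<Sum>l\<le>k. (if m = l then 2 * real (Suc k) * (?t m)\<^sup>2 else 0) - ?t m * ?t l)"
      by (intro sum.cong refl) (auto simp: dirichlet_node power2_eq_square algebra_simps simp del: of_nat_Suc)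
    also have "\<dots> = 2 * real (Suc k) * X - (\<Sum>m\<le>k. ?t m)\<^sup>2"
    proof -
      have "(\<Sum>m\<le>k. ?t m)\<^sup>2 = (\<Sum>m\<le>k. \<Sum>l\<le>k. ?t m * ?t l)" by (simp only: power2_eq_square sum_product)
      moreover have "(\<Sum>m\<le>k. \<Sum>l\<le>k. if m = l then 2 * real (Suc k) * (?t m)\<^sup>2 else 0) = 2 * real (Suc k) * X"
        by (simp add: X_def sum_distrib_left del: of_nat_Suc)
      ultimately show ?thesis by (simp only: sum_subtractf)
    qed
    also have "\<dots> \<le> 2 * real (Suc k) * X" by simp
    finally show ?thesis .
  qed
  finally have "X\<^sup>2 \<le> (\<Sum>j\<in>?J. (?c j)\<^sup>2) * (2 * real (Suc k) * X)"
    by (simp add: sum_nonneg mult_left_mono)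
  also have "\<dots> \<le> sqn f * (2 * real (Suc k) * X)"
    using Bessel[OF f, of ?J] X0 by (intro mult_right_mono) auto
  finally have main: "X * X \<le> (2 * real (Suc k) * sqn f) * X" by (simp only: power2_eq_square mult_ac)
  show ?thesis
  proof (cases "X = 0")
    case True then show ?thesis unfolding X_def[symmetric] by simp
  next
    case False then show ?thesis using main X0 unfolding X_def[symmetric] by (simp add: mult_le_cancel_right del: of_nat_Suc)
  qed
qed

lemma evaluate_diff:
  assumes "f \<in> L2_fun" "g \<in> L2_fun"
  shows "evaluate k m (\<lambda>x. f x - g x) = evaluate k m f - evaluate k m g"
  using assms by (simp add: evaluate_def L2_inner_diff left_diff_distrib sum_subtractf)

lemma evaluate_trig_sum:
  "evaluate k m (\<lambda>x. \<Sum>j\<in>{- int k..int k}. c j * trig_basis j x) = (\<Sum>j\<in>{- int k..int k}. c j * trig_basis j (node k m))"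
  by (simp add: evaluate_def L2_inner_trig_sum_basis)

lemma space_L2_borel [simp]: "space L2_borel = L2_fun"
  unfolding L2_borel_def by (rule space_measure_of) auto

lemma L2_inner_measurable: "(\<lambda>f. L2_inner f (trig_basis j)) \<in> borel_measurable L2_borel"
proof (rule borel_measurable_iff_less[THEN iffD2], rule allI)
  fix c
  let ?V = "{f \<in> L2_fun. L2_inner f (trig_basis j) < c}"
  have "\<exists>e>0. \<forall>g\<in>L2_fun. L2_norm (\<lambda>x. g x - f x) < e \<longrightarrow> g \<in> ?V" if f: "f \<in> ?V" for f
  proof (intro exI[of _ "c - L2_inner f (trig_basis j)"] conjI ballI impI)
    fix g assume g: "g \<in> L2_fun" "L2_norm (\<lambda>x. g x - f x) < c - L2_inner f (trig_basis j)"
    have "(L2_inner (\<lambda>x. g x - f x) (trig_basis j))\<^sup>2 \<le> (L2_norm (\<lambda>x. g x - f x))\<^sup>2"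
      using L2_Cauchy_Schwarz[OF L2_fun_diff[of g f] L2_fun_trig] f g by (simp add: L2_norm_sq trig_orthonormal)
    then have "L2_inner (\<lambda>x. g x - f x) (trig_basis j) \<le> L2_norm (\<lambda>x. g x - f x)"
      by (rule power2_le_imp_le) (simp add: L2_norm_def)
    then show "g \<in> ?V" using g f by (simp add: L2_inner_diff)
  qed (use f in simp)
  then have "?V \<in> sets L2_borel"
    unfolding L2_borel_def by (subst sets_measure_of) (auto intro!: sigma_sets.Basic)
  then show "{f \<in> space L2_borel. L2_inner f (trig_basis j) < c} \<in> sets L2_borel" by simp
qed

lemma evaluate_measurable: "evaluate k m \<in> borel_measurable L2_borel"
  unfolding evaluate_def[abs_def] by (intro borel_measurable_sum borel_measurable_times L2_inner_measurable) auto

section \<open>Lower bound\<close>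

text \<open>Pairing each subset without \<open>m\<close> with the subset obtained by adding \<open>m\<close>.\<close>

lemma sum_Pow_split:
  fixes f :: "nat set \<Rightarrow> real"
  assumes I: "finite I" and m: "m \<in> I"
  shows "(\<Sum>\<theta>\<in>Pow I. f \<theta>) = (\<Sum>\<theta>\<in>Pow (I - {m}). f \<theta> + f (insert m \<theta>))"
proof -
  have I': "I = insert m (I - {m})" using m by auto
  have "Pow I = Pow (I - {m}) \<union> insert m ` Pow (I - {m})"
    by (subst I') (rule Pow_insert)
  moreover have "Pow (I - {m}) \<inter> insert m ` Pow (I - {m}) = {}" by auto
  moreover have "inj_on (insert m) (Pow (I - {m}))" by (auto simp: inj_on_def)
  ultimately show ?thesis using I
    by (simp add: sum.union_disjoint sum.reindex sum.distrib)
qed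

context weights
begin

definition perturbed :: "nat \<Rightarrow> real \<Rightarrow> nat set \<Rightarrow> real \<Rightarrow> real" where
  "perturbed k h \<theta> x = L / 2 + h * (\<Sum>m\<in>\<theta>. bump (Suc k) (x - node k m))"

definition perturbed_coeff :: "nat \<Rightarrow> real \<Rightarrow> nat set \<Rightarrow> int \<Rightarrow> real" where
  "perturbed_coeff k h \<theta> j = h * (\<Sum>m\<in>\<theta>. fejer k j * trig_basis j (node k m))"

lemma bump_sum_expand:
  "h * (\<Sum>m\<in>\<theta>. bump (Suc k) (x - node k m)) = (\<Sum>j\<in>{- int k..int k}. perturbed_coeff k h \<theta> j * trig_basis j x)"
proof -
  have "(\<Sum>m\<in>\<theta>. bump (Suc k) (x - node k m)) =
      (\<Sum>m\<in>\<theta>. \<Sum>j\<in>{- int k..int k}. fejer k j * trig_basis j (node k m) * trig_basis j x)"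
    unfolding bump_expand ..
  also have "\<dots> = (\<Sum>j\<in>{- int k..int k}. (\<Sum>m\<in>\<theta>. fejer k j * trig_basis j (node k m)) * trig_basis j x)"
    by (subst sum.swap) (simp only: sum_distrib_right)
  finally have eq: "(\<Sum>m\<in>\<theta>. bump (Suc k) (x - node k m)) =
      (\<Sum>j\<in>{- int k..int k}. (\<Sum>m\<in>\<theta>. fejer k j * trig_basis j (node k m)) * trig_basis j x)" .
  show ?thesis
    unfolding eq by (subst sum_distrib_left) (intro sum.cong refl, simp only: perturbed_coeff_def mult.assoc)
qed

lemma perturbed_expand:
  "perturbed k h \<theta> x = (\<Sum>j\<in>{- int k..int k}. ((if j = 0 then L / 2 else 0) + perturbed_coeff k h \<theta> j) * trig_basis j x)"
proof -
  have "(\<Sum>j\<in>{- int k..int k}. (if j = 0 then L / 2 else 0) * trig_basis j x) = L / 2"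
  proof -
    have "(\<Sum>j\<in>{- int k..int k}. (if j = 0 then L / 2 else 0) * trig_basis j x) =
        (\<Sum>j\<in>{- int k..int k}. if j = 0 then L / 2 else 0)"
      by (intro sum.cong) auto
    then show ?thesis by simp
  qed
  then show ?thesis unfolding perturbed_def bump_sum_expand distrib_right sum.distrib by (simp only:)
qed

lemma perturbed_L2: "perturbed k h \<theta> \<in> L2_fun"
  using L2_fun_trig_sum by (simp add: perturbed_expand[abs_def])

lemma perturbed_ge: "0 \<le> h \<Longrightarrow> L / 2 \<le> perturbed k h \<theta> x"
  by (simp add: perturbed_def sum_nonneg bump_nonneg)

lemma evaluate_perturbed:
  assumes "\<theta> \<subseteq> {..k}" "m \<le> k"
  shows "evaluate k m (perturbed k h \<theta>) = L / 2 + (if m \<in> \<theta> then h else 0)"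
proof -
  have "evaluate k m (perturbed k h \<theta>) = perturbed k h \<theta> (node k m)"
    unfolding perturbed_expand[abs_def] by (rule evaluate_trig_sum)
  also have "\<dots> = L / 2 + h * (\<Sum>l\<in>\<theta>. if m = l then 1 else 0)"
    unfolding perturbed_def using assms by (intro arg_cong2[of _ _ _ _ "(+)"] arg_cong2[of _ _ _ _ "(*)"] sum.cong refl bump_node) auto
  also have "\<dots> = L / 2 + (if m \<in> \<theta> then h else 0)"
    using finite_subset[OF assms(1)] by simp
  finally show ?thesis .
qed

text \<open>The perturbation has degree \<open>k\<close> and takes values between 0 and \<open>h\<close>, so its weighted squared norm is at most
  \<open>(\<gamma> k)\<^sup>2 * h\<^sup>2\<close>. The constant \<open>L / 2\<close> uses up half of the budget \<open>L\<^sup>2\<close>, where the factor 2 comes from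
  \<open>(u + v)\<^sup>2 \<le> 2 * u\<^sup>2 + 2 * v\<^sup>2\<close> at the zeroth coefficient.\<close>

lemma perturbed_in_class:
  assumes h: "0 \<le> h" and \<theta>: "\<theta> \<subseteq> {..k}" and small: "(\<gamma> (int k))\<^sup>2 * h\<^sup>2 \<le> L\<^sup>2 / 4"
  shows "perturbed k h \<theta> \<in> intensity_class \<gamma> L"
proof -
  let ?J = "{- int k..int k}" and ?a = "\<lambda>j. if j = (0::int) then L / 2 else 0" and ?d = "perturbed_coeff k h \<theta>"
  let ?F = "\<lambda>j. (\<gamma> j)\<^sup>2 * (L2_inner (perturbed k h \<theta>) (trig_basis j))\<^sup>2"
  have c: "L2_inner (perturbed k h \<theta>) (trig_basis j) = (if j \<in> ?J then ?a j + ?d j else 0)" for j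
    unfolding perturbed_expand[abs_def] by (rule L2_inner_trig_sum_basis) simp
  have z: "?F j = 0" if "j \<in> UNIV - ?J" for j
  proof -
    have nj: "(j \<in> ?J) = False" using that by blast
    show ?thesis unfolding c nj by simp
  qed
  have s: "?F summable_on UNIV"
    using z by (subst summable_on_cong_neutral[where T = ?J and g = ?F]) auto
  have "(\<Sum>\<^sub>\<infinity>j. ?F j) = (\<Sum>j\<in>?J. ?F j)"
    using z by (subst infsum_cong_neutral[where T = ?J and g = ?F]) auto
  also have "\<dots> = (\<Sum>j\<in>?J. (\<gamma> j)\<^sup>2 * (?a j + ?d j)\<^sup>2)" by (intro sum.cong refl) (simp only: c if_True)
  also have "\<dots> \<le> (\<Sum>j\<in>?J. (if j = 0 then L\<^sup>2 / 2 else 0) + 2 * (\<gamma> (int k))\<^sup>2 * (?d j)\<^sup>2)"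
  proof (rule sum_mono)
    fix j assume j: "j \<in> ?J"
    have "(?a j + ?d j)\<^sup>2 \<le> 2 * (?a j)\<^sup>2 + 2 * (?d j)\<^sup>2"
      using sum_squares_bound[of "?a j" "?d j"] by (simp add: power2_sum)
    then have "(\<gamma> j)\<^sup>2 * (?a j + ?d j)\<^sup>2 \<le> (\<gamma> j)\<^sup>2 * (2 * (?a j)\<^sup>2 + 2 * (?d j)\<^sup>2)" by (rule mult_left_mono) simp
    also have "\<dots> = (\<gamma> j)\<^sup>2 * (2 * (?a j)\<^sup>2) + 2 * (\<gamma> j)\<^sup>2 * (?d j)\<^sup>2" by (simp only: ring_distribs mult_ac)
    also have "(\<gamma> j)\<^sup>2 * (2 * (?a j)\<^sup>2) = (if j = 0 then L\<^sup>2 / 2 else 0)"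
      by (auto simp: \<gamma>_zero power_divide)
    also have "2 * (\<gamma> j)\<^sup>2 * (?d j)\<^sup>2 \<le> 2 * (\<gamma> (int k))\<^sup>2 * (?d j)\<^sup>2"
      using j \<gamma>_pos[of j] by (intro mult_right_mono mult_left_mono power_mono \<gamma>_le) auto
    finally show "(\<gamma> j)\<^sup>2 * (?a j + ?d j)\<^sup>2 \<le> (if j = 0 then L\<^sup>2 / 2 else 0) + 2 * (\<gamma> (int k))\<^sup>2 * (?d j)\<^sup>2"
      by simp
  qed
  also have "\<dots> = L\<^sup>2 / 2 + 2 * (\<gamma> (int k))\<^sup>2 * (\<Sum>j\<in>?J. (?d j)\<^sup>2)"
    by (simp add: sum.distrib sum_distrib_left)
  also have "(\<Sum>j\<in>?J. (?d j)\<^sup>2) \<le> h\<^sup>2"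
  proof -
    have "(\<Sum>j\<in>?J. (?d j)\<^sup>2) = sqn (\<lambda>x. \<Sum>j\<in>?J. ?d j * trig_basis j x)" by (rule sqn_trig_sum[symmetric]) simp
    also have "\<dots> \<le> (LINT x|unit_leb. h * h)"
      unfolding L2_inner_def
    proof (rule integral_mono)
      show "integrable unit_leb (\<lambda>x. (\<Sum>j\<in>?J. ?d j * trig_basis j x) * (\<Sum>j\<in>?J. ?d j * trig_basis j x))"
        by (rule L2_fun_sq_integrable) simp
      fix x
      have "0 \<le> (\<Sum>m\<in>\<theta>. bump (Suc k) (x - node k m))" by (simp add: sum_nonneg bump_nonneg)
      then have "0 \<le> (\<Sum>j\<in>?J. ?d j * trig_basis j x)" "(\<Sum>j\<in>?J. ?d j * trig_basis j x) \<le> h"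
        unfolding bump_sum_expand[symmetric]
        using h bump_sum_le[OF \<theta>, of x] mult_left_mono[of "\<Sum>m\<in>\<theta>. bump (Suc k) (x - node k m)" 1 h] by auto
      then show "(\<Sum>j\<in>?J. ?d j * trig_basis j x) * (\<Sum>j\<in>?J. ?d j * trig_basis j x) \<le> h * h"
        by (intro mult_mono) auto
    qed simp
    also have "\<dots> = h\<^sup>2" by (simp add: power2_eq_square)
    finally show ?thesis .
  qed
  finally have "(\<Sum>\<^sub>\<infinity>j. ?F j) \<le> L\<^sup>2 / 2 + 2 * (\<gamma> (int k))\<^sup>2 * h\<^sup>2"
    by (simp add: mult_left_mono)
  then have "(\<Sum>\<^sub>\<infinity>j. ?F j) \<le> L\<^sup>2" using small by linarith
  moreover have "0 \<le> perturbed k h \<theta> x" for x using perturbed_ge[OF h, of k \<theta> x] L_pos by linarith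
  ultimately show ?thesis using s perturbed_L2 by (simp add: intensity_class_def)
qed

text \<open>A bump lies between 0 and 1, so its squared norm is at most its integral, the constant Fourier mode
  \<open>1 / (k + 1)\<close>.\<close>

lemma perturbed_diff:
  assumes m: "m \<le> k" "m \<notin> \<theta>" "finite \<theta>"
  shows "sqn (\<lambda>x. perturbed k h (insert m \<theta>) x - perturbed k h \<theta> x) \<le> h\<^sup>2 / real (Suc k)"
proof -
  let ?b = "\<lambda>x. bump (Suc k) (x - node k m)"
  have bL: "?b \<in> L2_fun" unfolding bump_expand by simp
  have b1: "?b x \<le> 1" for x using bump_sum_le[of "{m}" k x] m by simp
  have "(\<lambda>x. perturbed k h (insert m \<theta>) x - perturbed k h \<theta> x) = (\<lambda>x. h * ?b x)"
    using m by (simp add: perturbed_def fun_eq_iff algebra_simps)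
  then have "sqn (\<lambda>x. perturbed k h (insert m \<theta>) x - perturbed k h \<theta> x) = (LINT x|unit_leb. h\<^sup>2 * (?b x * ?b x))"
    by (simp add: L2_inner_def power2_eq_square mult_ac)
  also have "\<dots> \<le> (LINT x|unit_leb. h\<^sup>2 * ?b x)"
  proof (rule integral_mono)
    show "integrable unit_leb (\<lambda>x. h\<^sup>2 * (?b x * ?b x))" using L2_fun_sq_integrable[OF bL] by simp
    show "integrable unit_leb (\<lambda>x. h\<^sup>2 * ?b x)" using L2_fun_mult_integrable[OF bL L2_fun_const[of 1]] by simp
    show "h\<^sup>2 * (?b x * ?b x) \<le> h\<^sup>2 * ?b x" for x
      using b1[of x] bump_nonneg[of "Suc k" "x - node k m"] by (intro mult_left_mono mult_left_le) auto
  qed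
  also have "\<dots> = h\<^sup>2 * L2_inner ?b (trig_basis 0)" by (simp add: L2_inner_def)
  also have "L2_inner ?b (trig_basis 0) = 1 / real (Suc k)"
    unfolding bump_expand by (subst L2_inner_trig_sum_basis) (auto simp: fejer_def)
  finally show ?thesis by simp
qed

text \<open>Assouad's method. From an estimate, membership of a node in the subset is guessed by comparing the value at the
  node with \<open>L / 2 + h / 2\<close>; a wrong guess costs \<open>h\<^sup>2 / 4\<close> at that node. For two subsets that differ in this
  node only, the two error probabilities sum to at least \<open>1 / 4\<close>, so some subset has at least
  \<open>(k + 1) / 8\<close> wrong guesses on average. The constant \<open>c0\<close> in \<open>h\<close> serves both purposes: at most \<open>L\<^sup>2 / 4\<close>
  keeps the perturbed intensities in the class, and at most \<open>L / 2\<close>, their lower bound, makes neighbours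
  indistinguishable.\<close>

theorem minimax_lower_bound:
  fixes N :: "nat \<Rightarrow> 'w \<Rightarrow> real measure" and M :: "(real \<Rightarrow> real) \<Rightarrow> 'w measure"
  assumes n: "1 \<le> n" and ps: "\<And>lam. lam \<in> intensity_class \<gamma> L \<Longrightarrow> poisson_sample n (M lam) N lam"
    and k: "(\<gamma> (int k))\<^sup>2 * (2 * real k + 1) \<le> real n" and est: "est \<in> estimators n"
  shows "ennreal (min (L\<^sup>2 / 4) (L / 2) * (real k + 1) / real n / 64) \<le> max_risk n M N (intensity_class \<gamma> L) est"
proof -
  define c0 where "c0 = min (L\<^sup>2 / 4) (L / 2)"
  define h where "h = sqrt (c0 * real (Suc k) / real n)"
  have np: "0 < real n" using n by simp
  have c0: "0 < c0" "c0 \<le> L\<^sup>2 / 4" "c0 \<le> L / 2" using L_pos by (auto simp: c0_def)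
  have h: "0 \<le> h" "h\<^sup>2 = c0 * real (Suc k) / real n" using c0 np by (auto simp: h_def)
  have small: "(\<gamma> (int k))\<^sup>2 * h\<^sup>2 \<le> L\<^sup>2 / 4"
  proof -
    have "(\<gamma> (int k))\<^sup>2 * real (Suc k) \<le> (\<gamma> (int k))\<^sup>2 * (2 * real k + 1)" by (intro mult_left_mono) auto
    then have "(\<gamma> (int k))\<^sup>2 * real (Suc k) \<le> real n" using k by linarith
    then have "c0 * ((\<gamma> (int k))\<^sup>2 * real (Suc k)) \<le> c0 * real n" using c0 by (intro mult_left_mono) auto
    then have "(\<gamma> (int k))\<^sup>2 * h\<^sup>2 \<le> c0" using np by (simp add: h field_simps del: of_nat_Suc)
    then show ?thesis using c0 by linarith
  qed
  let ?I = "{..k}"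
  have cls: "perturbed k h \<theta> \<in> intensity_class \<gamma> L" if "\<theta> \<subseteq> ?I" for \<theta> by (rule perturbed_in_class[OF h(1) that small])
  let ?P = "\<lambda>\<theta>. M (perturbed k h \<theta>)" and ?\<nu> = "\<lambda>w. \<lambda>i\<in>{..<n}. N i w"
  have pr: "prob_space (?P \<theta>)" if "\<theta> \<subseteq> ?I" for \<theta> using ps[OF cls[OF that]] by (simp add: poisson_sample_def)
  have \<nu>m: "?\<nu> \<in> measurable (?P \<theta>) (samples n)" if "\<theta> \<subseteq> ?I" for \<theta>
    using ps[OF cls[OF that]] by (auto simp: poisson_sample_def poisson_process_def intro!: measurable_restrict)
  have estm: "est \<in> measurable (samples n) L2_borel" using est by (simp add: estimators_def)
  let ?T = "\<lambda>m \<nu>. evaluate k m (est \<nu>)"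
  have Tm: "?T m \<in> borel_measurable (samples n)" for m by (rule measurable_compose[OF estm evaluate_measurable])
  define E where "E m = {\<nu> \<in> space (samples n). L / 2 + h / 2 \<le> ?T m \<nu>}" for m
  have Em: "E m \<in> sets (samples n)" for m unfolding E_def using Tm[of m] by measurable
  define err where "err \<theta> m = (if m \<in> \<theta> then space (samples n) - E m else E m)" for \<theta> m
  define pe where "pe \<theta> m = measure (?P \<theta>) {w \<in> space (?P \<theta>). ?\<nu> w \<in> err \<theta> m}" for \<theta> m
  have errm: "err \<theta> m \<in> sets (samples n)" for \<theta> m using Em by (auto simp: err_def)
  have pair: "1 / 4 \<le> pe \<theta> m + pe (insert m \<theta>) m" if m: "m \<in> ?I" and \<theta>: "\<theta> \<in> Pow (?I - {m})" for m \<theta>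
  proof -
    have s: "\<theta> \<subseteq> ?I" "insert m \<theta> \<subseteq> ?I" "m \<notin> \<theta>" using m \<theta> by auto
    interpret Q: prob_space "?P (insert m \<theta>)" by (rule pr[OF s(2)])
    have "real n * sqn (\<lambda>x. perturbed k h (insert m \<theta>) x - perturbed k h \<theta> x) \<le> real n * (h\<^sup>2 / real (Suc k))"
      using m s finite_subset[OF s(1)] by (intro mult_left_mono perturbed_diff) auto
    also have "\<dots> = c0" using np by (simp add: h del: of_nat_Suc)
    also have "\<dots> \<le> L / 2" by (rule c0)
    finally have close: "real n * sqn (\<lambda>x. perturbed k h (insert m \<theta>) x - perturbed k h \<theta> x) \<le> L / 2" .
    have "measure (?P (insert m \<theta>)) {w \<in> space (?P (insert m \<theta>)). ?\<nu> w \<in> E m} \<le>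
        measure (?P \<theta>) {w \<in> space (?P \<theta>). ?\<nu> w \<in> E m} + 3 / 4"
      by (rule poisson_sample_comparison[OF ps[OF cls[OF s(1)]] ps[OF cls[OF s(2)]] _ perturbed_L2 perturbed_L2 _ _ _ close Em])
        (use n L_pos perturbed_ge[OF h(1)] in auto)
    moreover have "measure (?P \<theta>) {w \<in> space (?P \<theta>). ?\<nu> w \<in> E m} = pe \<theta> m" using s by (simp add: pe_def err_def)
    moreover have "pe (insert m \<theta>) m = 1 - measure (?P (insert m \<theta>)) {w \<in> space (?P (insert m \<theta>)). ?\<nu> w \<in> E m}"
    proof -
      have Eset: "{w \<in> space (?P (insert m \<theta>)). ?\<nu> w \<in> E m} \<in> sets (?P (insert m \<theta>))"
        by (rule measurable_sets_Collect[OF \<nu>m[OF s(2)]]) (use Em[of m] in \<open>simp add: sets.Int_space_eq2[symmetric] Collect_conj_eq\<close>)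
      have "{w \<in> space (?P (insert m \<theta>)). ?\<nu> w \<in> err (insert m \<theta>) m} =
          space (?P (insert m \<theta>)) - {w \<in> space (?P (insert m \<theta>)). ?\<nu> w \<in> E m}"
        using measurable_space[OF \<nu>m[OF s(2)]] by (auto simp: err_def)
      then show ?thesis unfolding pe_def using Q.prob_compl[OF Eset] by simp
    qed
    ultimately show ?thesis by linarith
  qed
  have "(\<Sum>\<theta>\<in>Pow ?I. \<Sum>m\<in>?I. pe \<theta> m) = (\<Sum>m\<in>?I. \<Sum>\<theta>\<in>Pow (?I - {m}). pe \<theta> m + pe (insert m \<theta>) m)"
    by (subst sum.swap) (intro sum.cong refl sum_Pow_split; simp)
  also have "\<dots> \<ge> (\<Sum>m\<in>?I. \<Sum>\<theta>\<in>Pow (?I - {m}). 1 / 4)" by (intro sum_mono pair)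
  also have "(\<Sum>m\<in>?I. \<Sum>\<theta>\<in>Pow (?I - {m}). 1 / 4 :: real) = real (Suc k) * 2 ^ k / 4"
    by (simp add: card_Pow)
  finally have avg: "real (Suc k) * 2 ^ k / 4 \<le> (\<Sum>\<theta>\<in>Pow ?I. \<Sum>m\<in>?I. pe \<theta> m)" .
  have "\<exists>\<theta>\<in>Pow ?I. real (Suc k) / 8 \<le> (\<Sum>m\<in>?I. pe \<theta> m)"
  proof (rule ccontr)
    assume "\<not> ?thesis"
    then have lt: "(\<Sum>m\<in>?I. pe \<theta> m) < real (Suc k) / 8" if "\<theta> \<in> Pow ?I" for \<theta>
      using that by (meson not_le)
    have "(\<Sum>\<theta>\<in>Pow ?I. \<Sum>m\<in>?I. pe \<theta> m) < (\<Sum>\<theta>\<in>Pow ?I. real (Suc k) / 8)"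
    proof (rule sum_strict_mono)
      show "finite (Pow ?I)" by simp
      show "Pow ?I \<noteq> {}" by (rule Pow_not_empty)
    qed (rule lt)
    also have "\<dots> = real (Suc k) * 2 ^ k / 4" by (simp add: card_Pow)
    finally show False using avg by simp
  qed
  then obtain \<theta> where \<theta>: "\<theta> \<subseteq> ?I" "real (Suc k) / 8 \<le> (\<Sum>m\<in>?I. pe \<theta> m)" by blast
  interpret P: prob_space "?P \<theta>" by (rule pr[OF \<theta>(1)])
  let ?B = "\<lambda>m. {w \<in> space (?P \<theta>). ?\<nu> w \<in> err \<theta> m}"
  have "ennreal (c0 * (real k + 1) / real n / 64) \<le> ennreal (h\<^sup>2 / (8 * real (Suc k)) * (\<Sum>m\<in>?I. pe \<theta> m))"
  proof (rule ennreal_leI)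
    have "h\<^sup>2 / (8 * real (Suc k)) * (real (Suc k) / 8) \<le> h\<^sup>2 / (8 * real (Suc k)) * (\<Sum>m\<in>?I. pe \<theta> m)"
      using \<theta>(2) by (intro mult_left_mono) auto
    moreover have "c0 * s / real n / (8 * s) * (s / 8) = c0 * s / real n / 64" if "s \<noteq> 0" for s :: real
      using that np by (simp add: field_simps)
    from this[of "real (Suc k)"] have "h\<^sup>2 / (8 * real (Suc k)) * (real (Suc k) / 8) = c0 * (real k + 1) / real n / 64"
      by (simp add: h add.commute)
    ultimately show "c0 * (real k + 1) / real n / 64 \<le> h\<^sup>2 / (8 * real (Suc k)) * (\<Sum>m\<in>?I. pe \<theta> m)"
      by linarith
  qed
  also have "\<dots> = (\<integral>\<^sup>+w. ennreal (h\<^sup>2 / (8 * real (Suc k)) * (\<Sum>m\<in>?I. indicator (?B m) w)) \<partial>?P \<theta>)"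
  proof -
    have Bs: "(?B m) \<in> sets (?P \<theta>)" for m
      by (rule measurable_sets_Collect[OF \<nu>m[OF \<theta>(1)]]) (use errm[of \<theta> m] in \<open>simp add: sets.Int_space_eq2[symmetric] Collect_conj_eq\<close>)
    have i: "integrable (?P \<theta>) (\<lambda>w. h\<^sup>2 / (8 * real (Suc k)) * (\<Sum>m\<in>?I. indicator (?B m) w))"
      using Bs by (intro integrable_mult_right Bochner_Integration.integrable_sum integrable_real_indicator) (auto simp: P.emeasure_eq_measure)
    have nn: "0 \<le> h\<^sup>2 / (8 * real (Suc k)) * (\<Sum>m\<in>?I. indicator (?B m) w :: real)" for w
      by (intro mult_nonneg_nonneg sum_nonneg divide_nonneg_nonneg) auto
    have ex: "P.expectation (\<lambda>w. h\<^sup>2 / (8 * real (Suc k)) * (\<Sum>m\<in>?I. indicator (?B m) w))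
        = h\<^sup>2 / (8 * real (Suc k)) * (\<Sum>m\<in>?I. pe \<theta> m)"
      unfolding integral_mult_right_zero using Bs
      by (subst Bochner_Integration.integral_sum) (auto simp: pe_def P.emeasure_eq_measure Int_absorb2 sets.sets_into_space intro!: integrable_real_indicator)
    show ?thesis unfolding nn_integral_eq_integral[OF i AE_I2[OF nn]] ex ..
  qed
  also have "\<dots> \<le> risk n M' N est (perturbed k h \<theta>)" if "M' = ?P \<theta>" for M'
    unfolding risk_def L2_norm_sq that
  proof (rule nn_integral_mono, rule ennreal_leI)
    fix w assume w: "w \<in> space (?P \<theta>)"
    have \<nu>w: "?\<nu> w \<in> space (samples n)" using measurable_space[OF \<nu>m[OF \<theta>(1)] w] .
    have e: "est (?\<nu> w) \<in> L2_fun" using measurable_space[OF estm \<nu>w] by simp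
    let ?u = "\<lambda>x. est (?\<nu> w) x - perturbed k h \<theta> x"
    have u: "?u \<in> L2_fun" by (rule L2_fun_diff[OF e perturbed_L2])
    have cell: "h\<^sup>2 / 4 * indicator (?B m) w \<le> (evaluate k m ?u)\<^sup>2" if m: "m \<in> ?I" for m
    proof (cases "?\<nu> w \<in> err \<theta> m")
      case True
      have ev: "evaluate k m ?u = ?T m (?\<nu> w) - (L / 2 + (if m \<in> \<theta> then h else 0))"
        using evaluate_diff[OF e perturbed_L2] evaluate_perturbed[OF \<theta>(1)] m by simp
      have "h / 2 \<le> \<bar>evaluate k m ?u\<bar>"
      proof (cases "m \<in> \<theta>")
        case inth: True
        then have "?T m (?\<nu> w) < L / 2 + h / 2" using True \<nu>w by (simp add: err_def E_def)
        then have "evaluate k m ?u \<le> - (h / 2)" unfolding ev using inth by simp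
        then show ?thesis by linarith
      next
        case False
        then have "L / 2 + h / 2 \<le> ?T m (?\<nu> w)" using True by (simp add: err_def E_def)
        then have "h / 2 \<le> evaluate k m ?u" unfolding ev using False by simp
        then show ?thesis by linarith
      qed
      then have "(h / 2)\<^sup>2 \<le> \<bar>evaluate k m ?u\<bar>\<^sup>2" using h(1) by (intro power_mono) auto
      then show ?thesis using True w by (simp add: power_divide)
    qed simp
    have "h\<^sup>2 / (8 * real (Suc k)) * (\<Sum>m\<in>?I. indicator (?B m) w)
        = (\<Sum>m\<in>?I. h\<^sup>2 / 4 * indicator (?B m) w) / (2 * real (Suc k))"
      unfolding sum_distrib_left[symmetric] by (simp del: of_nat_Suc)
    also have "\<dots> \<le> (\<Sum>m\<in>?I. (evaluate k m ?u)\<^sup>2) / (2 * real (Suc k))"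
      by (intro divide_right_mono sum_mono cell) auto
    also have "\<dots> \<le> (2 * real (Suc k) * sqn ?u) / (2 * real (Suc k))"
      using sampling_inequality[OF u, of k] by (intro divide_right_mono) auto
    also have "\<dots> = sqn ?u" by (simp del: of_nat_Suc)
    finally show "h\<^sup>2 / (8 * real (Suc k)) * (\<Sum>m\<in>?I. indicator (?B m) w) \<le> sqn ?u" .
  qed
  also have "risk n (?P \<theta>) N est (perturbed k h \<theta>) \<le> max_risk n M N (intensity_class \<gamma> L) est"
    unfolding max_risk_def by (rule SUP_upper2[OF cls[OF \<theta>(1)]]) simp
  finally show ?thesis by (simp add: c0_def)
qed

text \<open>Since the weights are at least one, only dimensions up to \<open>n\<close> satisfy the first inequality; the
  largest of them violates it at its successor.\<close>

lemma rate_dimension: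
  assumes n: "1 \<le> n"
  obtains k where "k \<le> n" "(\<gamma> (int k))\<^sup>2 * (2 * real k + 1) \<le> real n"
    "real n < (\<gamma> (int (Suc k)))\<^sup>2 * (2 * real k + 3)"
proof -
  let ?S = "{k. (\<gamma> (int k))\<^sup>2 * (2 * real k + 1) \<le> real n}"
  have le: "k \<le> n" if "k \<in> ?S" for k
  proof -
    have "1 * (2 * real k + 1) \<le> (\<gamma> (int k))\<^sup>2 * (2 * real k + 1)"
      using one_le_power[OF \<gamma>_ge1[of "int k"], of 2] by (intro mult_right_mono) auto
    also have "\<dots> \<le> real n" using that by simp
    finally have "2 * real k + 1 \<le> real n" by simp
    then have "real k \<le> real n" by linarith
    then show ?thesis by simp
  qed
  then have fin: "finite ?S" using finite_subset[of ?S "{..n}"] by auto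
  have "0 \<in> ?S" using n \<gamma>_zero by simp
  then have M: "Max ?S \<in> ?S" using Max_in[OF fin] by blast
  have "Suc (Max ?S) \<notin> ?S" using Max_ge[OF fin, of "Suc (Max ?S)"] by auto
  then have "real n < (\<gamma> (int (Suc (Max ?S))))\<^sup>2 * (2 * real (Max ?S) + 3)" by (simp add: algebra_simps)
  then show ?thesis using that[of "Max ?S"] M le[OF M] by simp
qed

end

text \<open>The upper and the lower bound at the common rate \<open>(2 * k + 1) / n\<close>; the factor 128 is the 64 of the
  lower bound, doubled because the lower bound counts \<open>k + 1\<close> instead of \<open>2 * k + 1\<close> dimensions.\<close>

theorem corollary3p11:
  fixes L :: real and \<gamma> :: "int \<Rightarrow> real"
  assumes "0 < L"
    and "\<And>j. 0 < \<gamma> j"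
    and "\<And>j. \<gamma> (- j) = \<gamma> j"
    and "\<gamma> 0 = 1"
    and "mono (\<lambda>m::nat. \<gamma> (int m))"
  shows "\<exists>C::real. 0 < C \<and>
    (\<forall>n\<ge>1. \<forall>(M :: (real \<Rightarrow> real) \<Rightarrow> 'w measure) (N :: nat \<Rightarrow> 'w \<Rightarrow> real measure).
       (\<forall>lam\<in>intensity_class \<gamma> L. poisson_sample n (M lam) N lam) \<longrightarrow>
       max_risk n M N (intensity_class \<gamma> L) (adaptive_est n)
         \<le> ennreal C * (INF est\<in>estimators n. max_risk n M N (intensity_class \<gamma> L) est))"
proof -
  interpret weights \<gamma> L by unfold_locales (use assms in auto)
  define U where "U = risk_const"
  define c where "c = min (L\<^sup>2 / 4) (L / 2) / 128"
  have b: "0 \<le> b" by (simp add: b_def)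
  have "0 < 144 * (L + 1 + b)" using L_pos b by simp
  moreover have "0 \<le> 18 * L\<^sup>2" "0 \<le> 192 * (182400 * b ^ 4)" "0 \<le> L\<^sup>2 * b" "0 \<le> 170 * b\<^sup>2" using b by auto
  ultimately have U: "0 < U" unfolding U_def risk_const_def by linarith
  have c: "0 < c" using L_pos by (simp add: c_def)
  show ?thesis
  proof (intro exI[of _ "U / c"] conjI allI impI)
    show "0 < U / c" using U c by simp
    fix n and M :: "(real \<Rightarrow> real) \<Rightarrow> 'w measure" and N :: "nat \<Rightarrow> 'w \<Rightarrow> real measure"
    assume n: "1 \<le> n" and ps: "\<forall>lam\<in>intensity_class \<gamma> L. poisson_sample n (M lam) N lam"
    obtain k where k: "k \<le> n" "(\<gamma> (int k))\<^sup>2 * (2 * real k + 1) \<le> real n"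
      "real n < (\<gamma> (int (Suc k)))\<^sup>2 * (2 * real k + 3)"
      by (rule rate_dimension[OF n])
    define r where "r = (2 * real k + 1) / real n"
    have np: "0 < real n" using n by simp
    have r: "0 \<le> r" by (simp add: r_def)
    have upper: "max_risk n M N (intensity_class \<gamma> L) (adaptive_est n) \<le> ennreal (U * r)"
      unfolding max_risk_def
    proof (rule SUP_least)
      fix lam assume lam: "lam \<in> intensity_class \<gamma> L"
      interpret S: poisson_sample_setting \<gamma> L "M lam" N n lam
        by unfold_locales (use n lam ps in auto)
      show "risk n (M lam) N (adaptive_est n) lam \<le> ennreal (U * r)"
        using S.risk_adaptive_le[OF k(1,3)] by (simp add: U_def r_def)
    qed
    have lower: "ennreal (c * r) \<le> (INF est\<in>estimators n. max_risk n M N (intensity_class \<gamma> L) est)"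
    proof (rule INF_greatest)
      fix est assume est: "est \<in> estimators n"
      have "c * r \<le> min (L\<^sup>2 / 4) (L / 2) * (real k + 1) / real n / 64"
      proof -
        have "c * (2 * real k + 1) \<le> c * (2 * (real k + 1))" using c by (intro mult_left_mono) auto
        also have "\<dots> = min (L\<^sup>2 / 4) (L / 2) * (real k + 1) / 64" by (simp add: c_def)
        finally have "c * (2 * real k + 1) / real n \<le> min (L\<^sup>2 / 4) (L / 2) * (real k + 1) / 64 / real n"
          using np by (intro divide_right_mono) auto
        then show ?thesis by (simp add: r_def)
      qed
      then have "ennreal (c * r) \<le> ennreal (min (L\<^sup>2 / 4) (L / 2) * (real k + 1) / real n / 64)" by (rule ennreal_leI)
      also have "\<dots> \<le> max_risk n M N (intensity_class \<gamma> L) est"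
        using ps by (intro minimax_lower_bound[OF n _ k(2) est]) auto
      finally show "ennreal (c * r) \<le> max_risk n M N (intensity_class \<gamma> L) est" .
    qed
    have "ennreal (U * r) = ennreal (U / c) * ennreal (c * r)"
      using U c r by (subst ennreal_mult[symmetric]) auto
    also have "\<dots> \<le> ennreal (U / c) * (INF est\<in>estimators n. max_risk n M N (intensity_class \<gamma> L) est)"
      by (intro mult_left_mono lower) simp
    finally show "max_risk n M N (intensity_class \<gamma> L) (adaptive_est n)
        \<le> ennreal (U / c) * (INF est\<in>estimators n. max_risk n M N (intensity_class \<gamma> L) est)"
      using upper by (rule order_trans[rotated])
  qed
qed

end
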